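(* The measures $m_y$ become uniformly distributed with respect to Haar measure as $y\to 0$: $$\lim_{y\to 0^+} m_y(f)=\overline m(f)\qquad\text{for every } f\in C^0(\widehat M).$$
   Context: Let $\mathbb H=\{x+iy: y>0\}$ be the upper half-plane with the hyperbolic metric $(dx^2+dy^2)/y^2$, and let $T_1\mathbb H$ be its unit tangent bundle. A unit tangent vector is written $(z,\theta)$, where $z=x+iy\in\mathbb H$ is the base point and $\theta\in\mathbb R/2\pi\mathbb Z$ is its angle measured counter-clockwise from the upward vertical direction. The group $\mathrm{PSL}(2,\mathbb R)$ acts simply transitively on $T_1\mathbb H$ by differentials of Möbius transformations: for $\sigma(z)=\frac{az+b}{cz+d}$, $\sigma(z,\theta)=(\sigma(z),\theta-2\arg(cz+d))$. $M=\mathrm{PSL}(2,\mathbb R)/\mathrm{PSL}(2,\mathbb Z)$ is identified with the quotient of $T_1\mathbb H$ by this action of $\mathrm{PSL}(2,\mathbb Z)$. $\overline m$ is the normalized Haar measure on $M$, i.e. the probability measure on $M$ proportional to the one induced by $y^{-2}\,dx\,dy\,d\theta$ on $T_1\mathbb H$. For $y>0$, $m_y$ is the Borel probability measure on $M$ uniformly distributed (with respect to arc length) on the closed unstable horocycle orbit of period $1/y$, which is the image in $M$ of $\{((x,y),\pi): 0\le x\le 1\}$; that is, $m_y(f)=\int_0^1 f((x,y),\pi)\,dx$. $\widehat M$ is the one-point compactification of $M$, and $C^0(\widehat M)$ is the space of continuous real-valued functions on $\widehat M$; $m_y$ and $\overline m$ are regarded as measures on $\widehat M$ giving mass zero to the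 point at infinity, and $\mu(f)$ denotes $\int f\,d\mu$. *)

theory Defs
  imports "HOL-Analysis.Analysis"
begin

section \<open>Generic constructions\<close>

definition quotient_topology :: "'a topology \<Rightarrow> ('a \<Rightarrow> 'b) \<Rightarrow> 'b topology" where
  "quotient_topology X q =
     topology (\<lambda>U. U \<subseteq> q ` topspace X \<and> openin X {x \<in> topspace X. q x \<in> U})"

lemma openin_quotient_topology:
  "openin (quotient_topology X q) U \<longleftrightarrow>
     U \<subseteq> q ` topspace X \<and> openin X {x \<in> topspace X. q x \<in> U}"
proof -
  let ?V = "\<lambda>U. {x \<in> topspace X. q x \<in> U}"
  let ?L = "\<lambda>U. U \<subseteq> q ` topspace X \<and> openin X (?V U)"
  have inter: "?L (S \<inter> T)" if "?L S" "?L T" for S T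
  proof -
    have "?V (S \<inter> T) = ?V S \<inter> ?V T"
      by blast
    then have "openin X (?V (S \<inter> T))"
      using that by (simp only: openin_Int)
    then show ?thesis
      using that by blast
  qed
  have union: "?L (\<Union>K)" if K: "\<forall>S\<in>K. ?L S" for K
  proof -
    have "?V (\<Union>K) = \<Union>(?V ` K)"
      by blast
    moreover have "openin X (\<Union>(?V ` K))"
      by (rule openin_Union) (use K in blast)
    ultimately have "openin X (?V (\<Union>K))"
      by (simp only:)
    moreover have "\<Union>K \<subseteq> q ` topspace X"
      using K by blast
    ultimately show ?thesis
      by (rule conjI[rotated])
  qed
  have "istopology ?L"
    unfolding istopology_def
  proof (rule conjI)
    show "\<forall>S T. ?L S \<longrightarrow> ?L T \<longrightarrow> ?L (S \<inter> T)"
      by (rule allI, rule allI, rule impI, rule impI, rule inter)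
    show "\<forall>K. (\<forall>S\<in>K. ?L S) \<longrightarrow> ?L (\<Union>K)"
      by (rule allI, rule impI, rule union)
  qed
  then have "openin (topology ?L) = ?L"
    by (rule topology_inverse')
  then show ?thesis
    unfolding quotient_topology_def by (rule fun_cong)
qed

lemma topspace_quotient_topology [simp]:
  "topspace (quotient_topology X q) = q ` topspace X"
proof (rule subset_antisym)
  show "topspace (quotient_topology X q) \<subseteq> q ` topspace X"
    using openin_topspace[of "quotient_topology X q"]
    unfolding openin_quotient_topology by (rule conjunct1)
  have "{x \<in> topspace X. q x \<in> q ` topspace X} = topspace X"
    by blast
  then have "openin (quotient_topology X q) (q ` topspace X)"
    by (simp only: openin_quotient_topology openin_topspace order_refl simp_thms)
  then show "q ` topspace X \<subseteq> topspace (quotient_topology X q)"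
    by (rule openin_subset)
qed

lemma quotient_map_quotient_topology: "quotient_map X (quotient_topology X q) q"
  unfolding quotient_map_def topspace_quotient_topology openin_quotient_topology
  by blast

definition borel_of :: "'a topology \<Rightarrow> 'a measure" where
  "borel_of X = sigma (topspace X) {U. openin X U}"

section \<open>The unit tangent bundle of the upper half-plane\<close>

definition upper_half_plane :: "complex set" where
  "upper_half_plane = {z. Im z > 0}"

text \<open>The unit tangent vector \<open>(z, \<theta>)\<close> is encoded as \<open>(z, cis \<theta>)\<close>, so that the angle
  \<open>\<theta>\<close>, taken modulo \<open>2\<pi>\<close> and measured counter-clockwise from the upward
  vertical, is a point of the unit circle.\<close>

definition T1H :: "(complex \<times> complex) set" where
  "T1H = upper_half_plane \<times> sphere 0 1"

definition moebius_act :: "real^2^2 \<Rightarrow> complex \<times> complex \<Rightarrow> complex \<times> complex" where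
  "moebius_act A = (\<lambda>(z, w).
     let j = of_real (A$2$1) * z + of_real (A$2$2)
     in ((of_real (A$1$1) * z + of_real (A$1$2)) / j, w * cis (- 2 * Arg j)))"

definition SL2Z :: "(real^2^2) set" where
  "SL2Z = {A. det A = 1 \<and> (\<forall>i j. A$i$j \<in> \<int>)}"

definition liouville :: "(complex \<times> complex) measure" where
  "liouville =
     density (restrict_space lborel upper_half_plane) (\<lambda>z. ennreal (1 / (Im z)\<^sup>2))
     \<Otimes>\<^sub>M distr (restrict_space lborel {0..<2*pi}) (restrict_space borel (sphere 0 1)) cis"

section \<open>The quotient M\<close>

text \<open>The matrices \<open>A\<close> and \<open>-A\<close> act identically on \<^const>\<open>T1H\<close>, so the orbits of
  \<^const>\<open>SL2Z\<close> are those of \<open>PSL(2,\<int>)\<close>.\<close>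

definition proj_M :: "complex \<times> complex \<Rightarrow> (complex \<times> complex) set" where
  "proj_M p = (\<lambda>A. moebius_act A p) ` SL2Z"

definition M_top :: "(complex \<times> complex) set topology" where
  "M_top = quotient_topology (top_of_set T1H) proj_M"

text \<open>The measure on the quotient induced by \<^const>\<open>liouville\<close> is the one for which the
  covering map \<^const>\<open>proj_M\<close> preserves the measure of every Borel set on which it is
  injective.\<close>

definition M_induced :: "(complex \<times> complex) set measure" where
  "M_induced = (THE \<nu>. space \<nu> = topspace M_top \<and> sets \<nu> = sets (borel_of M_top) \<and>
     (\<forall>B \<in> sets liouville. inj_on proj_M B \<longrightarrow>
        emeasure \<nu> (proj_M ` B) = emeasure liouville B))"

definition M_haar :: "(complex \<times> complex) set measure" where
  "M_haar = uniform_measure M_induced (topspace M_top)"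

definition horocycle_measure :: "real \<Rightarrow> (complex \<times> complex) set measure" where
  "horocycle_measure y =
     distr (restrict_space lborel {0..1}) (borel_of M_top)
       (\<lambda>x. proj_M (Complex x y, cis pi))"

section \<open>The one-point compactification\<close>

abbreviation Mhat_top :: "(complex \<times> complex) set option topology" where
  "Mhat_top \<equiv> Alexandroff_compactification M_top"

text \<open>A measure on \<open>M\<close> regarded as a measure on the compactification; the added point
  \<^const>\<open>None\<close> gets mass zero.\<close>

definition on_Mhat ::
    "(complex \<times> complex) set measure \<Rightarrow> (complex \<times> complex) set option measure" where
  "on_Mhat \<mu> = distr \<mu> (borel_of Mhat_top) Some"

end

theory Submission
  imports Defs
begin

text \<open>
  The proof unfolds the integral over a closed horocycle into a sum over primitive lattice points,
  and the theorem then follows from the fact that primitive points have density \<open>6/\<pi>\<^sup>2\<close>.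

  A frame is an element of \<open>PSL(2,\<real>)\<close>. The frame of a matrix with first column \<open>(r, s)\<close> depends on
  one further real parameter \<open>t\<close>, the position along a horocycle, and is called \<open>horo (r, s) t\<close>.
  In these coordinates \<open>SL(2,\<real>)\<close> acts linearly on \<open>(r, s)\<close> and translates \<open>t\<close>, and Liouville
  measure is \<open>4 dr ds dt\<close> on \<open>s > 0\<close> (\<open>nn_integral_liouville\<close>). Let \<open>f \<ge> 0\<close> be an invariant
  function and let \<open>F\<close> be \<open>f\<close> on the open fundamental domain and \<open>0\<close> elsewhere. Almost everywhere
  \<open>f\<close> is the sum of \<open>F\<close> over the \<open>PSL(2,\<int>)\<close>-orbit. Grouping the group elements by their
  first column \<open>(a, c)\<close>, and using the second column to unroll the circle \<open>0 \<le> x \<le> 1\<close> to the real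
  line, the mean of \<open>f\<close> over the horocycle at height \<open>y\<close> is at least
  \<open>\<integral> y (\<Sum>(a, c). F (horo (\<surd>y a, \<surd>y c) t)) dt\<close>, where \<open>(a, c)\<close> runs over primitive vectors with
  \<open>c > 0\<close> (\<open>horocycle_unfolding\<close>). As \<open>y \<rightarrow> 0\<close> the vectors \<open>\<surd>y (a, c)\<close> fill the plane with
  density \<open>6/\<pi>\<^sup>2\<close> (\<open>liminf_primitive_sum\<close>), so by Fatou the lower limit of these means is at least
  \<open>6/\<pi>\<^sup>2 \<cdot> 1/4\<close> times the Liouville integral of \<open>F\<close>. The fundamental domain has area \<open>\<pi>/3\<close>, so its
  frames have total mass \<open>2\<pi>\<^sup>2/3\<close>, and this bound is exactly the Haar mean of \<open>f\<close>
  (\<open>liminf_horocycle_measure\<close>). As both sides are probability measures, no mass can escape: the lower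
  bound for \<open>C + f\<close> and for \<open>C - f\<close>, with \<open>C\<close> a bound for \<open>\<bar>f\<bar>\<close>, gives the limit.

  The density of primitive points comes from the relation \<open>A(l) = \<Sum>\<^sub>g B(g l)/g\<^sup>2\<close> between the
  normalised sum \<open>A\<close> of a test function over all lattice points and the sum \<open>B\<close> over primitive ones.
  Riemann sums give the limit of \<open>A\<close>, and since \<open>\<zeta>(2) - 1 < 1\<close> the relation determines the limit
  of \<open>B\<close> by a contraction argument (\<open>primitive_sum_tendsto\<close>).

  The measure on the quotient is the image of Liouville measure on the fundamental domain
  (\<open>M_induced_eq\<close>). It has the covering property because any injective Borel set can be moved into
  the domain piece by piece, and it is the only such measure because the frames without representative
  in the open domain form a null set which is covered by countably many injective pieces.
\<close>

section \<open>Counting primitive lattice points\<close>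

definition primitive :: "(int \<times> int) set" where
  "primitive = {v. coprime (fst v) (snd v)}"

definition scaled :: "real \<Rightarrow> int \<times> int \<Rightarrow> real \<times> real" where
  "scaled l v = (l * of_int (fst v), l * of_int (snd v))"

text \<open>Outside the window a function supported in the square of half-side \<open>R\<close> vanishes at the scaled
  lattice points, so the sums below are sums over the whole lattice, written as finite sums.\<close>

definition window :: "real \<Rightarrow> real \<Rightarrow> (int \<times> int) set" where
  "window R l = {v. \<bar>l * of_int (fst v)\<bar> \<le> R \<and> \<bar>l * of_int (snd v)\<bar> \<le> R}"

definition lattice_sum :: "(real \<times> real \<Rightarrow> real) \<Rightarrow> real \<Rightarrow> real \<Rightarrow> real" where
  "lattice_sum h R l = l\<^sup>2 * (\<Sum>v\<in>window R l. h (scaled l v))"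

definition primitive_sum :: "(real \<times> real \<Rightarrow> real) \<Rightarrow> real \<Rightarrow> real \<Rightarrow> real" where
  "primitive_sum h R l = l\<^sup>2 * (\<Sum>v\<in>window R l \<inter> primitive. h (scaled l v))"

lemma window_subset:
  assumes "l > 0"
  shows "window R l \<subseteq> {-\<lfloor>R / l\<rfloor>..\<lfloor>R / l\<rfloor>} \<times> {-\<lfloor>R / l\<rfloor>..\<lfloor>R / l\<rfloor>}"
proof -
  have "\<bar>a\<bar> \<le> \<lfloor>R / l\<rfloor>" if "\<bar>l * of_int a\<bar> \<le> R" for a :: int
  proof -
    have "real_of_int \<bar>a\<bar> \<le> R / l"
      using that assms by (simp add: abs_mult field_simps)
    then show ?thesis by (simp add: le_floor_iff)
  qed
  then show ?thesis
    unfolding window_def by (auto simp: abs_le_iff) (force simp: abs_le_iff)+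
qed

lemma finite_window: "l > 0 \<Longrightarrow> finite (window R l)"
  by (rule finite_subset[OF window_subset]) auto

lemma card_window:
  assumes "l > 0" "R \<ge> 0"
  shows "real (card (window R l)) \<le> (2 * (R / l) + 1)\<^sup>2"
proof -
  have N: "\<lfloor>R / l\<rfloor> \<ge> 0" using assms by simp
  have "card (window R l) \<le> card ({-\<lfloor>R / l\<rfloor>..\<lfloor>R / l\<rfloor>} \<times> {-\<lfloor>R / l\<rfloor>..\<lfloor>R / l\<rfloor>})"
    by (rule card_mono[OF _ window_subset]) (use assms in auto)
  also have "\<dots> = (nat (2 * \<lfloor>R / l\<rfloor> + 1))\<^sup>2"
    by (simp add: card_cartesian_product power2_eq_square)
  finally have "real (card (window R l)) \<le> (real (nat (2 * \<lfloor>R / l\<rfloor> + 1)))\<^sup>2"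
    by (metis of_nat_le_iff of_nat_power)
  also have "\<dots> \<le> (2 * (R / l) + 1)\<^sup>2"
    using N of_int_floor_le[of "R / l"] by (intro power_mono) linarith+
  finally show ?thesis .
qed

context
  fixes h :: "real \<times> real \<Rightarrow> real" and R C :: real
  assumes R: "R > 0" and cont: "continuous_on UNIV h" and bound: "\<And>w. \<bar>h w\<bar> \<le> C"
    and supp: "\<And>x y. \<bar>x\<bar> > R \<or> \<bar>y\<bar> > R \<Longrightarrow> h (x, y) = 0" and h0: "h (0, 0) = 0"
begin

lemma bound_nonneg: "C \<ge> 0"
  using bound[of "(0,0)"] by simp

text \<open>A lattice sum is the integral of the step function that is constant on each cell of the scaled lattice.\<close>

lemma lattice_sum_eq_integral:
  assumes l: "l > 0"
  shows "lattice_sum h R l = (\<integral>w. h (l * of_int \<lfloor>fst w / l\<rfloor>, l * of_int \<lfloor>snd w / l\<rfloor>) \<partial>lborel)"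
proof -
  define cell :: "int \<times> int \<Rightarrow> (real \<times> real) set" where
    "cell v = {l * of_int (fst v)..<l * of_int (fst v) + l} \<times> {l * of_int (snd v)..<l * of_int (snd v) + l}" for v
  have em: "emeasure lborel (cell v) = ennreal (l\<^sup>2)" for v
  proof -
    have "emeasure lborel (cell v) = emeasure (lborel \<Otimes>\<^sub>M lborel) (cell v)"
      by (simp add: lborel_prod)
    also have "\<dots> = ennreal l * ennreal l"
      unfolding cell_def using l by (subst lborel.emeasure_pair_measure_Times) auto
    finally show ?thesis using l by (simp add: ennreal_mult' power2_eq_square)
  qed
  have cell_borel [measurable]: "cell v \<in> sets borel" for v
    unfolding cell_def by (intro borel_Times) auto
  have mem: "w \<in> cell v \<longleftrightarrow> v = (\<lfloor>fst w / l\<rfloor>, \<lfloor>snd w / l\<rfloor>)" for w v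
  proof -
    have *: "x \<in> {l * of_int a..<l * of_int a + l} \<longleftrightarrow> a = \<lfloor>x / l\<rfloor>" for x a
      using l by (auto simp: floor_eq_iff field_simps eq_commute[of a])
    show ?thesis unfolding cell_def by (cases v; cases w) (simp add: * del: atLeastLessThan_iff)
  qed
  have step: "h (l * of_int \<lfloor>fst w / l\<rfloor>, l * of_int \<lfloor>snd w / l\<rfloor>)
      = (\<Sum>v\<in>window R l. h (scaled l v) * indicator (cell v) w)" for w
  proof -
    let ?v = "(\<lfloor>fst w / l\<rfloor>, \<lfloor>snd w / l\<rfloor>)"
    have "(\<Sum>v\<in>window R l. h (scaled l v) * indicator (cell v) w)
        = (\<Sum>v\<in>window R l. if v = ?v then h (scaled l v) else 0)"
      by (rule sum.cong) (auto simp: mem indicator_def)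
    also have "\<dots> = (if ?v \<in> window R l then h (scaled l ?v) else 0)"
      using finite_window[OF l] by simp
    also have "\<dots> = h (scaled l ?v)"
      unfolding window_def scaled_def using supp by (auto simp: not_le)
    finally show ?thesis by (simp add: scaled_def)
  qed
  have "(\<integral>w. h (l * of_int \<lfloor>fst w / l\<rfloor>, l * of_int \<lfloor>snd w / l\<rfloor>) \<partial>lborel)
     = (\<integral>w. (\<Sum>v\<in>window R l. h (scaled l v) * indicator (cell v) w) \<partial>lborel)"
    by (simp only: step)
  also have "\<dots> = (\<Sum>v\<in>window R l. h (scaled l v) * l\<^sup>2)"
    by (subst Bochner_Integration.integral_sum) (auto simp: em measure_def)
  finally show ?thesis
    unfolding lattice_sum_def by (simp add: sum_distrib_left mult.commute)
qed

lemma lattice_sum_tendsto: "(lattice_sum h R \<longlongrightarrow> (\<integral>w. h w \<partial>lborel)) (at_right 0)"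
proof (rule tendsto_at_right_sequentially[of 0 1])
  fix S :: "nat \<Rightarrow> real"
  assume S: "\<And>n. 0 < S n" "\<And>n. S n < 1" "S \<longlonglongrightarrow> 0"
  define s where "s n w = h (S n * of_int \<lfloor>fst w / S n\<rfloor>, S n * of_int \<lfloor>snd w / S n\<rfloor>)" for n w
  have near: "\<bar>S n * of_int \<lfloor>x / S n\<rfloor> - x\<bar> \<le> S n" for n x
  proof -
    have "S n * of_int \<lfloor>x / S n\<rfloor> \<le> x" "x \<le> S n * of_int \<lfloor>x / S n\<rfloor> + S n"
      using S(1)[of n] floor_divide_lower[of "S n" x] floor_divide_upper[of "S n" x]
      by (auto simp: algebra_simps)
    then show ?thesis by (simp add: abs_le_iff)
  qed
  have [measurable]: "h \<in> borel_measurable borel"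
    using cont by (rule borel_measurable_continuous_onI)
  have "(\<lambda>n. \<integral>w. s n w \<partial>lborel) \<longlonglongrightarrow> (\<integral>w. h w \<partial>lborel)"
  proof (rule integral_dominated_convergence)
    show "h \<in> borel_measurable lborel" by simp
    show "s n \<in> borel_measurable lborel" for n
    proof -
      have f: "(\<lambda>w. S n * of_int \<lfloor>fst w / S n\<rfloor>) \<in> borel_measurable (borel :: (real \<times> real) measure)"
        "(\<lambda>w. S n * of_int \<lfloor>snd w / S n\<rfloor>) \<in> borel_measurable (borel :: (real \<times> real) measure)"
        unfolding borel_prod[symmetric] by measurable
      have "(\<lambda>w. (S n * of_int \<lfloor>fst w / S n\<rfloor>, S n * of_int \<lfloor>snd w / S n\<rfloor>))
         \<in> borel_measurable (borel :: (real \<times> real) measure)" by (intro borel_measurable_Pair f)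
      from measurable_compose[OF this \<open>h \<in> borel_measurable borel\<close>]
      show ?thesis unfolding s_def by simp
    qed
    show "integrable lborel (\<lambda>w::real\<times>real. C * indicator (cbox (-(R+1), -(R+1)) (R+1, R+1)) w)"
      by (intro integrable_mult_right integrable_real_indicator) (auto simp: emeasure_lborel_cbox_eq)
    show "AE w in lborel. (\<lambda>n. s n w) \<longlonglongrightarrow> h w"
    proof (rule AE_I2)
      fix w :: "real \<times> real"
      have "(\<lambda>n. S n * of_int \<lfloor>x / S n\<rfloor>) \<longlonglongrightarrow> x" for x
      proof (rule Lim_transform_bound[where ?g = S, THEN LIM_zero_cancel])
      qed (use S in \<open>auto intro!: always_eventually order_trans[OF near abs_ge_self]\<close>)
      then have "(\<lambda>n. (S n * of_int \<lfloor>fst w / S n\<rfloor>, S n * of_int \<lfloor>snd w / S n\<rfloor>)) \<longlonglongrightarrow> (fst w, snd w)"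
        by (intro tendsto_Pair) auto
      then show "(\<lambda>n. s n w) \<longlonglongrightarrow> h w"
        unfolding s_def using continuous_on_tendsto_compose[OF cont] by fastforce
    qed
    show "AE w in lborel. norm (s n w) \<le> C * indicator (cbox (-(R+1), -(R+1)) (R+1, R+1)) w" for n
    proof (rule AE_I2)
      fix w :: "real \<times> real"
      show "norm (s n w) \<le> C * indicator (cbox (-(R+1), -(R+1)) (R+1, R+1)) w"
      proof (cases "w \<in> cbox (-(R+1), -(R+1)) (R+1, R+1)")
        case True then show ?thesis using bound by (simp add: s_def)
      next
        case False
        obtain x y where w: "w = (x, y)" by (cases w)
        have "\<bar>x\<bar> > R + 1 \<or> \<bar>y\<bar> > R + 1"
          using False unfolding w by (auto simp: cbox_Pair_eq)
        then have "\<bar>S n * of_int \<lfloor>x / S n\<rfloor>\<bar> > R \<or> \<bar>S n * of_int \<lfloor>y / S n\<rfloor>\<bar> > R"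
          using near[of n x] near[of n y] S(2)[of n] by linarith
        then show ?thesis using False supp by (simp add: s_def w)
      qed
    qed
  qed
  then show "(\<lambda>n. lattice_sum h R (S n)) \<longlonglongrightarrow> (\<integral>w. h w \<partial>lborel)"
    using S(1) by (simp add: s_def lattice_sum_eq_integral)
qed simp

lemma primitive_sum_zero:
  assumes "l > R"
  shows "primitive_sum h R l = 0"
proof -
  have "h (scaled l v) = 0" for v
  proof (cases "fst v = 0 \<and> snd v = 0")
    case True
    then show ?thesis using h0 by (simp add: scaled_def)
  next
    case nz: False
    have "\<bar>l * of_int a\<bar> > R" if "a \<noteq> 0" for a :: int
    proof -
      have "real_of_int \<bar>a\<bar> \<ge> 1" using that by linarith
      then have "l * real_of_int \<bar>a\<bar> \<ge> l" using assms R by simp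
      moreover have "\<bar>l * of_int a\<bar> = l * real_of_int \<bar>a\<bar>"
        using assms R by (simp add: abs_mult)
      ultimately show ?thesis using assms by linarith
    qed
    then show ?thesis using nz supp unfolding scaled_def by blast
  qed
  then show ?thesis unfolding primitive_sum_def by simp
qed

lemma primitive_sum_bounded:
  assumes l: "l > 0"
  shows "\<bar>primitive_sum h R l\<bar> \<le> 9 * R\<^sup>2 * C"
proof (cases "l \<le> R")
  case True
  have "\<bar>\<Sum>v\<in>window R l \<inter> primitive. h (scaled l v)\<bar> \<le> (\<Sum>v\<in>window R l \<inter> primitive. C)"
    by (rule order_trans[OF sum_abs sum_mono]) (use bound in auto)
  also have "\<dots> \<le> card (window R l) * C"
    using bound_nonneg finite_window[OF l] by (auto intro!: mult_right_mono card_mono)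
  also have "\<dots> \<le> (2 * (R / l) + 1)\<^sup>2 * C"
    using card_window[OF l] R bound_nonneg by (intro mult_right_mono) auto
  finally have "\<bar>primitive_sum h R l\<bar> \<le> l\<^sup>2 * ((2 * (R / l) + 1)\<^sup>2 * C)"
    unfolding primitive_sum_def abs_mult by (intro mult_mono) auto
  also have "\<dots> = (2 * R + l)\<^sup>2 * C"
    using l by (simp add: field_simps power2_eq_square)
  also have "\<dots> \<le> (3 * R)\<^sup>2 * C"
    using True l bound_nonneg by (intro mult_right_mono power_mono) auto
  finally show ?thesis by (simp add: power_mult_distrib)
next
  case False
  then show ?thesis using primitive_sum_zero bound_nonneg by simp
qed

text \<open>Every nonzero lattice vector is, in exactly one way, a positive integer \<open>g\<close> times a primitive
  vector, and the factor \<open>g\<close> can be absorbed into the scale.\<close>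

lemma lattice_sum_decompose:
  assumes l: "l > 0"
  shows "(\<lambda>g. primitive_sum h R (real (Suc g) * l) / (real (Suc g))\<^sup>2) sums lattice_sum h R l"
proof -
  define N where "N = nat \<lceil>R / l\<rceil>"
  have N: "primitive_sum h R (real (Suc g) * l) = 0" if "g \<notin> {..<N}" for g
  proof (rule primitive_sum_zero)
    have "R / l \<le> real N" unfolding N_def by linarith
    also have "\<dots> < real (Suc g)" using that by simp
    finally show "R < real (Suc g) * l" using l by (simp add: field_simps)
  qed
  let ?S = "SIGMA g:{..<N}. window R (real (Suc g) * l) \<inter> primitive"
  let ?f = "\<lambda>(g, v). (int (Suc g) * fst v, int (Suc g) * snd v)"
  have scaled_f: "scaled l (?f p) = scaled (real (Suc (fst p)) * l) (snd p)" for p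
    by (cases p) (simp add: scaled_def mult_ac)
  have "(\<Sum>v\<in>window R l. h (scaled l v)) = (\<Sum>v\<in>window R l - {(0,0)}. h (scaled l v))"
    by (rule sum.mono_neutral_right) (use finite_window[OF l] h0 in \<open>auto simp: scaled_def\<close>)
  also have "\<dots> = (\<Sum>p\<in>?S. h (scaled l (?f p)))"
  proof (rule sum.reindex_bij_betw[symmetric], rule bij_betwI')
    fix p q assume pq: "p \<in> ?S" "q \<in> ?S"
    obtain g v g' v' where [simp]: "p = (g, v)" "q = (g', v')" by (cases p; cases q)
    have gcd_eq: "gcd (int (Suc k) * fst u) (int (Suc k) * snd u) = int (Suc k)"
      if "u \<in> primitive" for k and u :: "int \<times> int"
      using that unfolding primitive_def by (simp add: gcd_mult_distrib_int[symmetric] del: of_nat_Suc)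
    show "?f p = ?f q \<longleftrightarrow> p = q"
    proof
      assume eq: "?f p = ?f q"
      then have "int (Suc g) = int (Suc g')"
        using gcd_eq[of v g] gcd_eq[of v' g'] pq by (simp del: of_nat_Suc)
      then have "g = g'" by simp
      then show "p = q" using eq by (auto simp: prod_eq_iff)
    qed simp
  next
    fix p assume p: "p \<in> ?S"
    obtain g v where [simp]: "p = (g, v)" by (cases p)
    have "fst v \<noteq> 0 \<or> snd v \<noteq> 0" using p by (auto simp: primitive_def)
    then show "?f p \<in> window R l - {(0,0)}"
      using p by (auto simp: window_def mult_ac)
  next
    fix w assume w: "w \<in> window R l - {(0,0)}"
    obtain a c where [simp]: "w = (a, c)" by (cases w)
    have nz: "a \<noteq> 0 \<or> c \<noteq> 0" using w by auto
    define k where "k = gcd a c"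
    have k: "k > 0" using nz unfolding k_def by (simp add: gcd_pos_int)
    obtain a' c' where ac: "a = k * a'" "c = k * c'" "coprime a' c'"
      using gcd_coprime_exists[of a c] nz unfolding k_def by (metis mult.commute gcd_eq_0_iff)
    define g where "g = nat (k - 1)"
    have kg: "k = int (Suc g)" using k unfolding g_def by simp
    have win: "\<bar>l * of_int k * of_int a'\<bar> \<le> R" "\<bar>l * of_int k * of_int c'\<bar> \<le> R"
      using w unfolding window_def by (auto simp: ac mult_ac)
    have "l * of_int k \<le> R"
    proof -
      have "\<exists>b::int. b \<noteq> 0 \<and> \<bar>l * of_int k * of_int b\<bar> \<le> R"
        using win nz ac by auto
      then obtain b :: int where b: "b \<noteq> 0" "\<bar>l * of_int k * of_int b\<bar> \<le> R" by blast
      have "real_of_int \<bar>b\<bar> \<ge> 1" using b by linarith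
      then have "l * of_int k * real_of_int \<bar>b\<bar> \<ge> l * of_int k" using l k by simp
      moreover have "\<bar>l * of_int k * of_int b\<bar> = l * of_int k * real_of_int \<bar>b\<bar>"
        using l k by (simp add: abs_mult)
      ultimately show ?thesis using b(2) by linarith
    qed
    then have "of_int k \<le> R / l" using l by (simp add: field_simps)
    then have "k \<le> \<lceil>R / l\<rceil>" by linarith
    then have "g < N" using k unfolding g_def N_def by linarith
    then have "(g, (a', c')) \<in> ?S"
      using win ac unfolding window_def primitive_def kg by (auto simp: mult_ac)
    moreover have "w = ?f (g, (a', c'))" using ac kg by simp
    ultimately show "\<exists>p\<in>?S. w = ?f p" by blast
  qed
  also have "\<dots> = (\<Sum>g<N. \<Sum>v\<in>window R (real (Suc g) * l) \<inter> primitive. h (scaled (real (Suc g) * l) v))"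
    unfolding scaled_f using l
    by (subst sum.Sigma) (auto intro!: finite_window sum.cong simp del: of_nat_Suc)
  finally have "lattice_sum h R l = (\<Sum>g<N. primitive_sum h R (real (Suc g) * l) / (real (Suc g))\<^sup>2)"
    unfolding lattice_sum_def primitive_sum_def using l
    by (simp add: power_mult_distrib sum_distrib_left[of "l\<^sup>2" _ "{..<N}"] del: of_nat_Suc)
  moreover have "(\<lambda>g. primitive_sum h R (real (Suc g) * l) / (real (Suc g))\<^sup>2) sums
      (\<Sum>g<N. primitive_sum h R (real (Suc g) * l) / (real (Suc g))\<^sup>2)"
    by (rule sums_finite) (use N in auto)
  ultimately show ?thesis by simp
qed


text \<open>Write \<open>e(l)\<close> for the deviation of the primitive sum from the expected limit. The decomposition by
  the gcd expresses \<open>e(l)\<close> as the deviation of the lattice sum, which tends to \<open>0\<close>, minus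
  \<open>\<Sum>\<^sub>g e(g l)/g\<^sup>2\<close> over \<open>g \<ge> 2\<close>. The weights of the last sum add up to \<open>\<zeta>(2) - 1 < 1\<close>, so an eventual
  bound \<open>K\<close> for \<open>\<bar>e\<bar>\<close> improves to \<open>q K\<close> with a fixed \<open>q < 1\<close>, and iteration forces \<open>e \<rightarrow> 0\<close>.\<close>

lemma primitive_sum_tendsto:
  "(primitive_sum h R \<longlongrightarrow> 6 / pi\<^sup>2 * (\<integral>w. h w \<partial>lborel)) (at_right 0)"
proof -
  define I where "I = (\<integral>w. h w \<partial>lborel)"
  define z where "z = pi\<^sup>2 / 6"
  define J where "J = I / z"
  define e where "e l = primitive_sum h R l - J" for l
  define C0 where "C0 = 9 * R\<^sup>2 * C + \<bar>J\<bar>"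
  have zeta: "(\<lambda>g. 1 / (real (Suc g))\<^sup>2) sums z"
    using inverse_squares_sums unfolding z_def by (simp add: add.commute)
  have zeta': "(\<lambda>g. 1 / (real (Suc (Suc g)))\<^sup>2) sums (z - 1)"
    using zeta by (subst sums_Suc_iff) simp
  have z_pos: "z > 0" unfolding z_def by simp
  have z_less: "z - 1 < 1"
  proof -
    have "pi\<^sup>2 < 3.2\<^sup>2"
      using pi_approx by (intro power_strict_mono) auto
    then show ?thesis by (simp add: z_def power2_eq_square)
  qed
  have z_ge: "z - 1 \<ge> 0"
    using sums_le[OF _ sums_zero zeta'] by simp
  have e_bound: "\<bar>e l\<bar> \<le> C0" if "l > 0" for l
    using primitive_sum_bounded[OF that] unfolding e_def C0_def by linarith
  have C0: "C0 \<ge> 0" using e_bound[of 1] by simp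
  have e_sums: "(\<lambda>g. e (real (Suc (Suc g)) * l) / (real (Suc (Suc g)))\<^sup>2) sums
      (lattice_sum h R l - I - e l)" if "l > 0" for l
  proof -
    have "(\<lambda>g. primitive_sum h R (real (Suc g) * l) / (real (Suc g))\<^sup>2 - J * (1 / (real (Suc g))\<^sup>2))
        sums (lattice_sum h R l - J * z)"
      by (intro sums_diff lattice_sum_decompose[OF that] sums_mult zeta)
    then have "(\<lambda>g. e (real (Suc g) * l) / (real (Suc g))\<^sup>2) sums (lattice_sum h R l - I)"
      using z_pos by (simp add: e_def J_def diff_divide_distrib)
    then show ?thesis by (subst sums_Suc_iff) simp
  qed
  define q where "q = (1 + (z - 1)) / 2"
  have q: "0 \<le> q" "q < 1" using z_less z_ge unfolding q_def by auto
  have contract: "\<forall>\<^sub>F l in at_right 0. \<bar>e l\<bar> \<le> q * K"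
    if K: "K > 0" and ev: "\<forall>\<^sub>F l in at_right 0. \<bar>e l\<bar> \<le> K" for K
  proof -
    \<comment> \<open>The slack \<open>(q - (z - 1)) K\<close> is shared between the lattice deviation and the tail of the series.\<close>
    define d where "d = (q - (z - 1)) * K / 2"
    have d: "d > 0" unfolding d_def q_def using z_less K by simp
    obtain G where G: "norm (\<Sum>i. C0 * (1 / (real (Suc (Suc (i + G))))\<^sup>2)) < d"
      using suminf_exist_split[OF d summable_mult[OF sums_summable[OF zeta'], of C0]] by blast
    obtain b where b: "b > 0" "\<And>l. 0 < l \<Longrightarrow> l < b \<Longrightarrow> \<bar>e l\<bar> \<le> K"
      using ev unfolding eventually_at_right_field by blast
    have "\<forall>\<^sub>F l in at_right 0. \<bar>lattice_sum h R l - I\<bar> < d"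
      using lattice_sum_tendsto d unfolding tendsto_iff dist_real_def I_def by blast
    moreover have "\<forall>\<^sub>F l in at_right 0. 0 < l \<and> l < b / real (Suc (Suc G))"
      unfolding eventually_at_right_field using b(1)
      by (intro exI[of _ "b / real (Suc (Suc G))"]) auto
    ultimately show ?thesis
    proof eventually_elim
      case (elim l)
      define t where "t g = e (real (Suc (Suc g)) * l) / (real (Suc (Suc g)))\<^sup>2" for g
      define r where "r g = 1 / (real (Suc (Suc g)))\<^sup>2" for g
      have r0: "r g \<ge> 0" for g unfolding r_def by simp
      have t_sum: "t sums (lattice_sum h R l - I - e l)"
        unfolding t_def using e_sums elim by blast
      have r_sum: "r sums (z - 1)" unfolding r_def by (rule zeta')
      have t1: "\<bar>t g\<bar> \<le> K * r g" if "g < G" for g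
      proof -
        have "real (Suc (Suc g)) * l \<le> real (Suc (Suc G)) * l"
          using that elim by (intro mult_right_mono) auto
        also have "\<dots> < b" using elim by (simp add: field_simps)
        finally have "\<bar>e (real (Suc (Suc g)) * l)\<bar> \<le> K"
          using elim by (intro b(2)) auto
        then show ?thesis unfolding t_def r_def by (simp add: abs_divide divide_right_mono)
      qed
      have t2: "\<bar>t g\<bar> \<le> C0 * r g" for g
        using e_bound[of "real (Suc (Suc g)) * l"] elim
        unfolding t_def r_def by (simp add: abs_divide divide_right_mono)
      have summ: "summable (\<lambda>i. C0 * r (i + G))"
        by (intro summable_mult summable_ignore_initial_segment sums_summable[OF r_sum])
      have "\<bar>\<Sum>i. t (i + G)\<bar> \<le> (\<Sum>i. C0 * r (i + G))"
        using norm_suminf_le[OF _ summ, of "\<lambda>i. t (i + G)"] t2 by simp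
      also have "\<dots> < d" using G unfolding r_def by simp
      finally have tail: "\<bar>\<Sum>i. t (i + G)\<bar> < d" .
      have "\<bar>\<Sum>g<G. t g\<bar> \<le> (\<Sum>g<G. K * r g)"
        by (rule order_trans[OF sum_abs sum_mono]) (use t1 in auto)
      also have "\<dots> \<le> K * (z - 1)"
        unfolding sum_distrib_left[symmetric] using K r_sum r0
        by (intro mult_left_mono) (auto simp: sums_iff dest: sum_le_suminf[of r "{..<G}"])
      finally have head: "\<bar>\<Sum>g<G. t g\<bar> \<le> K * (z - 1)" .
      have "lattice_sum h R l - I - e l = (\<Sum>i. t (i + G)) + (\<Sum>g<G. t g)"
        using suminf_split_initial_segment[OF sums_summable[OF t_sum], of G] t_sum
        by (simp add: sums_iff)
      then have "\<bar>e l\<bar> \<le> K * (z - 1) + 2 * d"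
        using tail head elim by linarith
      also have "\<dots> = q * K" unfolding d_def by (simp add: field_simps)
      finally show ?case .
    qed
  qed
  have iterate: "\<forall>\<^sub>F l in at_right 0. \<bar>e l\<bar> \<le> q ^ n * (C0 + 1)" for n
  proof (induction n)
    case 0
    show ?case unfolding eventually_at_right_field using e_bound
      by (intro exI[of _ 1]) (auto simp: add_increasing2)
  next
    case (Suc n)
    have "q > 0" using z_ge unfolding q_def by simp
    then have "q ^ n * (C0 + 1) > 0" using C0 by simp
    from contract[OF this Suc] show ?case by (simp add: mult.assoc)
  qed
  have "(e \<longlongrightarrow> 0) (at_right 0)"
  proof (rule tendstoI)
    fix x :: real assume x: "x > 0"
    have "(\<lambda>n. q ^ n * (C0 + 1)) \<longlonglongrightarrow> 0 * (C0 + 1)"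
      by (intro tendsto_mult LIMSEQ_power_zero tendsto_const) (use q in auto)
    then have "\<forall>\<^sub>F n in sequentially. q ^ n * (C0 + 1) < x"
      using x by (simp add: order_tendstoD)
    then obtain n where n: "q ^ n * (C0 + 1) < x"
      by (meson eventually_happens' sequentially_bot)
    show "\<forall>\<^sub>F l in at_right 0. dist (e l) 0 < x"
      using iterate[of n] by eventually_elim (use n in auto)
  qed
  then have "((\<lambda>l. e l + J) \<longlongrightarrow> 0 + J) (at_right 0)"
    by (intro tendsto_add tendsto_const)
  then show ?thesis unfolding e_def J_def z_def I_def by (simp add: mult.commute)
qed

end

lemma borel_measurable_ennreal_indicator:
  fixes f :: "'a::topological_space \<Rightarrow> real"
  assumes "U \<in> sets borel" "continuous_on U f"
  shows "(\<lambda>x. ennreal (f x) * indicator U x) \<in> borel_measurable borel"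
proof -
  have "(\<lambda>x. indicator U x *\<^sub>R f x) \<in> borel_measurable borel"
    using assms by (rule borel_measurable_continuous_on_indicator)
  then have "(\<lambda>x. ennreal (indicator U x *\<^sub>R f x)) \<in> borel_measurable borel" by simp
  also have "(\<lambda>x. ennreal (indicator U x *\<^sub>R f x)) = (\<lambda>x. ennreal (f x) * indicator U x)"
    by (auto simp: indicator_def)
  finally show ?thesis .
qed

text \<open>A function that is continuous on an open set and zero outside is the increasing limit of
  continuous functions \<open>u k\<close> of compact support, for which the limit is known. The limit in
  \<open>k\<close> keeps the lower bound.\<close>

lemma liminf_primitive_sum:
  fixes h :: "real \<times> real \<Rightarrow> real"
  assumes "open U" and zero: "(0, 0) \<notin> U" and cont: "continuous_on U h"
    and h: "\<And>w. w \<in> U \<Longrightarrow> 0 \<le> h w" "\<And>w. w \<in> U \<Longrightarrow> h w \<le> C"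
    and S: "\<And>n. S n > 0" "S \<longlonglongrightarrow> 0"
  shows "ennreal (6 / pi\<^sup>2) * (\<integral>\<^sup>+w. ennreal (h w) * indicator U w \<partial>lborel)
    \<le> liminf (\<lambda>n. ennreal ((S n)\<^sup>2) *
         (\<integral>\<^sup>+v. ennreal (h (scaled (S n) v)) * indicator U (scaled (S n) v) \<partial>count_space primitive))"
    (is "_ \<le> ?L")
proof -
  define D where "D = max C 0"
  have ne: "- U \<noteq> {}" and cl: "closed (- U)" using zero assms(1) by auto
  define g where "g k w = (if w \<in> U then h w else 0) * min 1 (real k * infdist w (- U))"
    for k :: nat and w
  \<comment> \<open>The first cut-off makes the function continuous at the boundary of \<open>U\<close>, the second gives it compact support.\<close>
  define u where "u k w = g k w * max 0 (min 1 (real k - norm w))" for k :: nat and w :: "real \<times> real"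
  have g_bound: "0 \<le> g k w" "g k w \<le> D * (real k * infdist w (- U))" "g k w \<le> h w" "g k w \<le> D"
    if "w \<in> U" for k w
  proof -
    have m: "0 \<le> min 1 (real k * infdist w (- U))" by (simp add: infdist_nonneg)
    show "0 \<le> g k w" using h that m unfolding g_def by simp
    show "g k w \<le> D * (real k * infdist w (- U))" unfolding g_def D_def
      using h that by (intro mult_mono) (auto simp: infdist_nonneg intro: order_trans[OF h(2)])
    show "g k w \<le> h w" unfolding g_def using h that by (simp add: mult_left_le)
    then show "g k w \<le> D" unfolding D_def using h(2)[OF that] by linarith
  qed
  have g_out: "g k w = 0" if "w \<notin> U" for k w using that by (simp add: g_def)
  have u_bound: "0 \<le> u k w" "u k w \<le> g k w" for k w
  proof -
    have "0 \<le> g k w" using g_bound(1) g_out by (cases "w \<in> U") auto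
    then show "0 \<le> u k w" "u k w \<le> g k w" unfolding u_def by (auto simp: mult_left_le)
  qed
  have u_D: "\<bar>u k w\<bar> \<le> D" for k w
    using u_bound[of k w] g_bound(4)[of w k] g_out[of w k] unfolding D_def by (cases "w \<in> U") auto
  have g_cont: "isCont (g k) w" for k w
  proof (cases "w \<in> U")
    case True
    have "continuous_on U (\<lambda>w. h w * min 1 (real k * infdist w (- U)))"
      by (intro continuous_intros cont)
    then have "continuous_on U (g k)"
      by (rule continuous_on_eq) (simp add: g_def)
    then show ?thesis using True assms(1) continuous_on_eq_continuous_at by blast
  next
    case False
    have "((\<lambda>x. D * (real k * infdist x (- U))) \<longlongrightarrow> D * (real k * infdist w (- U))) (at w)"
      by (intro tendsto_intros tendsto_infdist)
    then have "((\<lambda>x. D * (real k * infdist x (- U))) \<longlongrightarrow> 0) (at w)"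
      using False by simp
    moreover have "norm (g k x) \<le> D * (real k * infdist x (- U))" for x
      using g_bound[of x k] g_out[of x k] unfolding D_def
      by (cases "x \<in> U") (auto simp: infdist_nonneg)
    ultimately have "(g k \<longlongrightarrow> 0) (at w)"
      by (rule Lim_null_comparison[OF always_eventually[OF allI], rotated])
    then show ?thesis using False g_out unfolding isCont_def by simp
  qed
  have u_cont: "continuous_on UNIV (u k)" for k
    unfolding u_def using g_cont
    by (intro continuous_intros) (simp add: continuous_on_eq_continuous_at)
  have u_supp: "u k w = 0" if "norm w > real k" for k w
    using that unfolding u_def by simp
  have int_u: "integrable lborel (u k)" for k
  proof -
    have "integrable lborel (\<lambda>x. indicator (cball 0 (real k)) x *\<^sub>R u k x)"
      by (rule borel_integrable_compact) (auto intro: continuous_on_subset[OF u_cont])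
    moreover have "(\<lambda>x. indicator (cball 0 (real k)) x *\<^sub>R u k x) = u k"
      using u_supp[of k] by (auto simp: indicator_def fun_eq_iff not_le)
    ultimately show ?thesis by simp
  qed
  have lower: "ennreal (6 / pi\<^sup>2) * (\<integral>\<^sup>+w. ennreal (u (Suc k) w) \<partial>lborel) \<le> ?L" for k
  proof -
    let ?u = "u (Suc k)" and ?R = "real (Suc k)"
    have "(primitive_sum ?u ?R \<longlongrightarrow> 6 / pi\<^sup>2 * (\<integral>w. ?u w \<partial>lborel)) (at_right 0)"
    proof (rule primitive_sum_tendsto[where C = D])
      show "?u (x, y) = 0" if "\<bar>x\<bar> > ?R \<or> \<bar>y\<bar> > ?R" for x y
      proof (rule u_supp)
        have "\<bar>x\<bar> \<le> norm (x, y)" "\<bar>y\<bar> \<le> norm (x, y)"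
          using norm_fst_le[of x y] norm_snd_le[of y x] by auto
        then show "norm (x, y) > ?R" using that by linarith
      qed
      show "?u (0, 0) = 0" using zero by (simp add: u_def g_def)
    qed (use u_cont u_D in auto)
    moreover have "filterlim S (at_right 0) sequentially"
      using S by (intro filterlim_at_withinI) auto
    ultimately have "(\<lambda>n. primitive_sum ?u ?R (S n)) \<longlonglongrightarrow> 6 / pi\<^sup>2 * (\<integral>w. ?u w \<partial>lborel)"
      by (rule filterlim_compose)
    then have "(\<lambda>n. ennreal (primitive_sum ?u ?R (S n))) \<longlonglongrightarrow> ennreal (6 / pi\<^sup>2 * (\<integral>w. ?u w \<partial>lborel))"
      by (rule tendsto_ennrealI)
    then have "ennreal (6 / pi\<^sup>2 * (\<integral>w. ?u w \<partial>lborel)) = liminf (\<lambda>n. ennreal (primitive_sum ?u ?R (S n)))"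
      by (rule lim_imp_Liminf[rotated, symmetric]) simp
    also have "\<dots> \<le> ?L"
    proof (rule Liminf_mono, rule always_eventually, rule allI)
      fix n
      let ?W = "window ?R (S n) \<inter> primitive"
      have "ennreal (\<Sum>v\<in>?W. ?u (scaled (S n) v)) = (\<Sum>v\<in>?W. ennreal (?u (scaled (S n) v)))"
        by (rule sum_ennreal[symmetric]) (rule u_bound)
      also have "\<dots> \<le> (\<Sum>v\<in>?W. ennreal (h (scaled (S n) v)) * indicator U (scaled (S n) v))"
      proof (rule sum_mono)
        fix v
        show "ennreal (?u (scaled (S n) v)) \<le> ennreal (h (scaled (S n) v)) * indicator U (scaled (S n) v)"
          using u_bound(2)[of "Suc k" "scaled (S n) v"] g_bound(3)[of "scaled (S n) v" "Suc k"]
            g_out[of "scaled (S n) v" "Suc k"] u_bound(1)[of "Suc k" "scaled (S n) v"]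
          by (cases "scaled (S n) v \<in> U") (auto intro!: ennreal_leI)
      qed
      also have "\<dots> = (\<integral>\<^sup>+v. ennreal (h (scaled (S n) v)) * indicator U (scaled (S n) v) \<partial>count_space ?W)"
        by (rule nn_integral_count_space_finite[symmetric]) (use S finite_window in blast)
      also have "\<dots> \<le> (\<integral>\<^sup>+v. ennreal (h (scaled (S n) v)) * indicator U (scaled (S n) v) \<partial>count_space primitive)"
        by (auto simp: nn_integral_count_space_indicator indicator_def intro!: nn_integral_mono)
      finally show "ennreal (primitive_sum ?u ?R (S n)) \<le> ennreal ((S n)\<^sup>2) *
         (\<integral>\<^sup>+v. ennreal (h (scaled (S n) v)) * indicator U (scaled (S n) v) \<partial>count_space primitive)"
        unfolding primitive_sum_def by (subst ennreal_mult') (auto intro!: mult_left_mono)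
    qed
    finally show ?thesis
      using u_bound int_u by (simp add: nn_integral_eq_integral ennreal_mult'[symmetric])
  qed
  have h_meas: "(\<lambda>w. ennreal (h w) * indicator U w) \<in> borel_measurable lborel"
    using borel_measurable_ennreal_indicator[OF _ cont] assms(1) by simp
  let ?c = "ennreal (6 / pi\<^sup>2)"
  have "?c * (\<integral>\<^sup>+w. ennreal (h w) * indicator U w \<partial>lborel)
      = (\<integral>\<^sup>+w. ?c * (ennreal (h w) * indicator U w) \<partial>lborel)"
    by (rule nn_integral_cmult[OF h_meas, symmetric])
  also have "\<dots> = (\<integral>\<^sup>+w. liminf (\<lambda>k. ?c * ennreal (u (Suc k) w)) \<partial>lborel)"
  proof (rule nn_integral_cong)
    fix w :: "real \<times> real"
    show "?c * (ennreal (h w) * indicator U w) = liminf (\<lambda>k. ?c * ennreal (u (Suc k) w))"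
    proof (cases "w \<in> U")
      case True
      have pos: "infdist w (- U) > 0" using True cl ne infdist_pos_not_in_closed[of "- U" w] by simp
      obtain k0 :: nat where k0: "real k0 \<ge> 1 / infdist w (- U)" "real k0 \<ge> norm w + 1"
        using real_arch_simple[of "max (1 / infdist w (- U)) (norm w + 1)"] by auto
      have "u k w = h w" if "k \<ge> k0" for k
      proof -
        have k: "real k \<ge> 1 / infdist w (- U)" "real k - norm w \<ge> 1" using that k0 by linarith+
        then have "real k * infdist w (- U) \<ge> 1" using pos by (simp add: field_simps)
        then show ?thesis using True k(2) by (simp add: u_def g_def min_absorb1)
      qed
      then have "(\<lambda>k. ?c * ennreal (u (Suc k) w)) \<longlonglongrightarrow> ?c * ennreal (h w)"
        by (intro tendsto_eventually eventually_sequentiallyI[of k0]) auto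
      then show ?thesis using True lim_imp_Liminf[of sequentially] by fastforce
    next
      case False
      then show ?thesis using g_out u_def by (simp add: Liminf_const)
    qed
  qed
  also have "\<dots> \<le> liminf (\<lambda>k. \<integral>\<^sup>+w. ?c * ennreal (u (Suc k) w) \<partial>lborel)"
    by (rule nn_integral_liminf) (use borel_measurable_continuous_onI[OF u_cont] in measurable)
  also have "\<dots> = liminf (\<lambda>k. ?c * (\<integral>\<^sup>+w. ennreal (u (Suc k) w) \<partial>lborel))"
    using int_u by (subst nn_integral_cmult) auto
  also have "\<dots> \<le> ?L"
    using lower by (intro Liminf_le) auto
  finally show ?thesis .
qed

section \<open>The modular group acting on frames\<close>

definition mat2 :: "real \<Rightarrow> real \<Rightarrow> real \<Rightarrow> real \<Rightarrow> real^2^2" where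
  "mat2 a b c d = vector [vector [a, b], vector [c, d]]"

lemma mat2_nth [simp]:
  "mat2 a b c d $ 1 $ 1 = a" "mat2 a b c d $ 1 $ 2 = b"
  "mat2 a b c d $ 2 $ 1 = c" "mat2 a b c d $ 2 $ 2 = d"
  by (simp_all add: mat2_def)

lemma mat2_collapse: "mat2 (A$1$1) (A$1$2) (A$2$1) (A$2$2) = A"
  by (simp add: vec_eq_iff forall_2)

lemma mat2_cases:
  obtains a b c d where "A = mat2 a b c d"
  using mat2_collapse[of A] by metis

lemma mat2_eq_iff: "mat2 a b c d = mat2 a' b' c' d' \<longleftrightarrow> a = a' \<and> b = b' \<and> c = c' \<and> d = d'"
  by (auto simp: vec_eq_iff forall_2)

lemma det_mat2: "det (mat2 a b c d) = a * d - b * c"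
  by (simp add: det_2)

lemma mat2_mult: "mat2 a b c d ** mat2 a' b' c' d' =
    mat2 (a * a' + b * c') (a * b' + b * d') (c * a' + d * c') (c * b' + d * d')"
  by (simp add: vec_eq_iff forall_2 matrix_matrix_mult_def sum_2)

lemma SL2Z_cases:
  assumes "A \<in> SL2Z"
  obtains a b c d :: int where "A = mat2 a b c d" "a * d - b * c = 1"
proof -
  have "A$1$1 \<in> \<int>" "A$1$2 \<in> \<int>" "A$2$1 \<in> \<int>" "A$2$2 \<in> \<int>" and det: "det A = 1"
    using assms by (auto simp: SL2Z_def)
  then obtain a b c d :: int
    where e: "A$1$1 = a" "A$1$2 = b" "A$2$1 = c" "A$2$2 = d" by (auto elim!: Ints_cases)
  have A: "A = mat2 a b c d" using mat2_collapse[of A] e by simp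
  have "real_of_int (a * d - b * c) = 1" using det unfolding A det_mat2 by simp
  then have "a * d - b * c = 1" by linarith
  with A show thesis by (rule that)
qed

lemma mat2_in_SL2Z: "a * d - b * c = 1 \<Longrightarrow> mat2 (of_int a) (of_int b) (of_int c) (of_int d) \<in> SL2Z"
  for a b c d :: int
proof -
  assume "a * d - b * c = 1"
  then have "real_of_int (a * d - b * c) = 1" by simp
  then show ?thesis by (simp add: SL2Z_def forall_2 det_mat2)
qed

lemma countable_SL2Z: "countable SL2Z"
proof -
  have "SL2Z \<subseteq> range (\<lambda>(a, b, c, d). mat2 (of_int a) (of_int b) (of_int c) (of_int d))"
    by (force elim!: SL2Z_cases simp: image_iff)
  then show ?thesis by (rule countable_subset) simp
qed

lemma det_SL2Z: "A \<in> SL2Z \<Longrightarrow> det A = 1"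
  by (simp add: SL2Z_def)

text \<open>The angle cocycle is a rational function; this removes the discontinuous argument from all that follows.\<close>

lemma cis_minus_twice_Arg:
  assumes "j \<noteq> 0"
  shows "cis (- 2 * Arg j) = cnj j / j"
proof -
  have "cis (Arg j) = j / cmod j" using assms by (simp add: cis_Arg sgn_eq)
  have "cis (- 2 * Arg j) = inverse (cis (Arg j)) ^ 2"
    by (simp add: cis_inverse Complex.DeMoivre)
  also have "\<dots> = of_real (cmod j ^ 2) / j ^ 2"
    unfolding \<open>cis (Arg j) = _\<close> by (simp add: power_divide)
  also have "\<dots> = cnj j / j"
    using assms unfolding complex_norm_square by (simp add: power2_eq_square)
  finally show ?thesis .
qed

lemma T1H_iff: "(z, w) \<in> T1H \<longleftrightarrow> Im z > 0 \<and> cmod w = 1"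
  by (simp add: T1H_def upper_half_plane_def)

lemma denominator_nonzero:
  assumes "det (mat2 a b c d) = 1" "Im z > 0"
  shows "of_real c * z + of_real d \<noteq> (0 :: complex)"
proof
  assume 0: "of_real c * z + of_real d = (0 :: complex)"
  then have "c * Im z = 0" by (auto simp: complex_eq_iff)
  then have "c = 0" using assms by simp
  then show False using 0 assms by (auto simp: det_mat2)
qed

lemma moebius_act_mat2:
  assumes "det (mat2 a b c d) = 1" "Im z > 0"
  shows "moebius_act (mat2 a b c d) (z, w) =
    ((of_real a * z + of_real b) / (of_real c * z + of_real d),
     w * (cnj (of_real c * z + of_real d) / (of_real c * z + of_real d)))"
  using cis_minus_twice_Arg[OF denominator_nonzero[OF assms]]
  by (simp add: moebius_act_def Let_def)

lemma Im_moebius: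
  assumes "det (mat2 a b c d) = 1" "Im z > 0"
  shows "Im ((of_real a * z + of_real b) / (of_real c * z + of_real d))
    = Im z / (cmod (of_real c * z + of_real d))\<^sup>2"
proof -
  have "Im ((of_real a * z + of_real b) / (of_real c * z + of_real d))
    = ((a * d - b * c) * Im z) / (cmod (of_real c * z + of_real d))\<^sup>2"
    by (simp add: Im_divide cmod_power2 algebra_simps)
  then show ?thesis using assms by (simp add: det_mat2)
qed

lemma moebius_act_T1H:
  assumes "det A = 1" "p \<in> T1H"
  shows "moebius_act A p \<in> T1H"
proof -
  obtain z w where p: "p = (z, w)" by (cases p)
  obtain a b c d where A: "A = mat2 a b c d" by (rule mat2_cases)
  have z: "Im z > 0" "cmod w = 1" using assms p by (auto simp: T1H_iff)
  have det: "det (mat2 a b c d) = 1" using assms A by simp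
  note j = denominator_nonzero[OF det z(1)]
  show ?thesis
    unfolding p A moebius_act_mat2[OF det z(1)] T1H_iff Im_moebius[OF det z(1)]
    using z j by (simp add: norm_mult norm_divide del: complex_cnj_add complex_cnj_mult)
qed

lemma moebius_act_mult:
  assumes "det A = 1" "det B = 1" "p \<in> T1H"
  shows "moebius_act A (moebius_act B p) = moebius_act (A ** B) p"
proof -
  obtain z w where p: "p = (z, w)" by (cases p)
  obtain a b c d where A: "A = mat2 a b c d" by (rule mat2_cases)
  obtain a' b' c' d' where B: "B = mat2 a' b' c' d'" by (rule mat2_cases)
  have z: "Im z > 0" "cmod w = 1" using assms p by (auto simp: T1H_iff)
  have detA: "det (mat2 a b c d) = 1" and detB: "det (mat2 a' b' c' d') = 1"
    using assms A B by auto
  have detAB: "det (mat2 (a * a' + b * c') (a * b' + b * d') (c * a' + d * c') (c * b' + d * d')) = 1"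
    using assms unfolding A B mat2_mult[symmetric] by (simp add: det_mul)
  define j where "j = of_real c' * z + of_real d'"
  define u where "u = (of_real a' * z + of_real b') / j"
  define k where "k = of_real c * u + of_real d"
  have Bp: "moebius_act B p = (u, w * (cnj j / j))"
    unfolding p B u_def j_def by (rule moebius_act_mat2[OF detB z(1)])
  have u: "Im u > 0" using moebius_act_T1H[OF assms(2,3)] unfolding Bp T1H_iff by simp
  have j0: "j \<noteq> 0" unfolding j_def by (rule denominator_nonzero[OF detB z(1)])
  have k0: "k \<noteq> 0" unfolding k_def by (rule denominator_nonzero[OF detA u])
  have kj: "of_real (c * a' + d * c') * z + of_real (c * b' + d * d') = k * j"
    using j0 unfolding k_def u_def by (simp add: field_simps) (simp add: j_def algebra_simps)
  have num: "of_real (a * a' + b * c') * z + of_real (a * b' + b * d') = (of_real a * u + of_real b) * j"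
    using j0 unfolding u_def by (simp add: field_simps) (simp add: j_def algebra_simps)
  have "moebius_act A (u, w * (cnj j / j)) =
     ((of_real a * u + of_real b) / k, w * (cnj j / j) * (cnj k / k))"
    unfolding A k_def by (rule moebius_act_mat2[OF detA u])
  moreover have "moebius_act (A ** B) p =
     ((of_real a * u + of_real b) * j / (k * j), w * (cnj (k * j) / (k * j)))"
    unfolding A B p mat2_mult moebius_act_mat2[OF detAB z(1)] kj num ..
  ultimately show ?thesis unfolding Bp using j0 by (simp add: mult_ac)
qed

lemma moebius_act_mat1: "moebius_act (mat 1) p = p"
  by (cases p) (simp add: moebius_act_def mat_def)

lemma SL2Z_mult: "A \<in> SL2Z \<Longrightarrow> B \<in> SL2Z \<Longrightarrow> A ** B \<in> SL2Z"
  unfolding SL2Z_def by (auto simp: det_mul) (auto simp: matrix_matrix_mult_def sum_2)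

lemma mat1_SL2Z: "mat 1 \<in> SL2Z"
  unfolding SL2Z_def by (auto simp: mat_def) (auto simp: mat_def[symmetric] det_I)

lemma SL2Z_inverse:
  assumes "A \<in> SL2Z"
  obtains B where "B \<in> SL2Z" "A ** B = mat 1" "B ** A = mat 1"
proof -
  obtain a b c d :: int where A: "A = mat2 a b c d" "a * d - b * c = 1"
    using assms by (rule SL2Z_cases)
  have 1: "mat 1 = mat2 1 0 0 1" by (simp add: vec_eq_iff forall_2 mat_def)
  have r: "real_of_int (a * d - b * c) = 1" using A(2) by simp
  show thesis
  proof (rule that)
    show "mat2 (of_int d) (of_int (- b)) (of_int (- c)) (of_int a) \<in> SL2Z"
      by (rule mat2_in_SL2Z) (use A in \<open>simp add: algebra_simps\<close>)
  qed (use r in \<open>simp_all add: A(1) 1 mat2_mult mat2_eq_iff algebra_simps\<close>)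
qed

lemma moebius_act_cancel:
  assumes "A \<in> SL2Z" "B \<in> SL2Z" "B ** A = mat 1" "p \<in> T1H"
  shows "moebius_act B (moebius_act A p) = p"
  using assms by (simp add: moebius_act_mult det_SL2Z moebius_act_mat1)

lemma proj_M_eq_iff:
  assumes p: "p \<in> T1H"
  shows "proj_M p = proj_M q \<longleftrightarrow> (\<exists>A\<in>SL2Z. q = moebius_act A p)"
proof
  assume "proj_M p = proj_M q"
  moreover have "q \<in> proj_M q"
    unfolding proj_M_def using moebius_act_mat1 mat1_SL2Z by (metis imageI)
  ultimately show "\<exists>A\<in>SL2Z. q = moebius_act A p" unfolding proj_M_def by auto
next
  assume "\<exists>A\<in>SL2Z. q = moebius_act A p"
  then obtain A where A: "A \<in> SL2Z" "q = moebius_act A p" by blast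
  obtain B where B: "B \<in> SL2Z" "B ** A = mat 1" using SL2Z_inverse[OF A(1)] by metis
  have "q \<in> T1H" using A p moebius_act_T1H det_SL2Z by blast
  have pB: "p = moebius_act B q" using A B p by (simp add: moebius_act_cancel)
  show "proj_M p = proj_M q"
  proof (rule set_eqI, unfold proj_M_def, intro iffI; elim imageE)
    fix x C assume "C \<in> SL2Z" "x = moebius_act C p"
    then show "x \<in> (\<lambda>A. moebius_act A q) ` SL2Z"
      unfolding pB using \<open>q \<in> T1H\<close> B
      by (intro image_eqI[of _ _ "C ** B"]) (auto simp: moebius_act_mult det_SL2Z SL2Z_mult)
  next
    fix x C assume "C \<in> SL2Z" "x = moebius_act C q"
    then show "x \<in> (\<lambda>A. moebius_act A p) ` SL2Z"
      unfolding A(2) using p A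
      by (intro image_eqI[of _ _ "C ** A"]) (auto simp: moebius_act_mult det_SL2Z SL2Z_mult)
  qed
qed

definition fund_dom :: "complex set" where
  "fund_dom = {z. \<bar>Re z\<bar> < 1 / 2 \<and> cmod z > 1 \<and> Im z > 0}"

text \<open>The kernel of the action on frames.\<close>

definition pm_one :: "(real^2^2) set" where
  "pm_one = {mat2 1 0 0 1, mat2 (-1) 0 0 (-1)}"

lemma moebius_act_pm_one: "A \<in> pm_one \<Longrightarrow> moebius_act A p = p"
  by (cases p) (auto simp: pm_one_def moebius_act_def Arg_minus Let_def simp flip: cis_cnj)

lemma diagonal_pm_one:
  fixes a b d :: int
  assumes "a * d = 1" "b = 0"
  shows "mat2 a b 0 d \<in> pm_one"
  using assms zmult_eq_1_iff[of a d] by (auto simp: pm_one_def mat2_eq_iff)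

text \<open>The form \<open>c\<^sup>2 \<bar>z\<bar>\<^sup>2 + 2 c d Re z + d\<^sup>2\<close> exceeds \<open>c\<^sup>2 - \<bar>c d\<bar> + d\<^sup>2\<close>, a positive integer.\<close>

lemma lattice_norm_gt_1:
  fixes c d :: int
  assumes z: "z \<in> fund_dom" and "c \<noteq> 0"
  shows "cmod (of_int c * z + of_int d) > 1"
proof -
  have x: "\<bar>Re z\<bar> < 1 / 2" and n: "(cmod z)\<^sup>2 > 1"
    using z by (auto simp: fund_dom_def)
  have "(of_int c)\<^sup>2 + (of_int d)\<^sup>2 - \<bar>real_of_int (c * d)\<bar> < (of_int c)\<^sup>2 * (cmod z)\<^sup>2 + 2 * of_int (c * d) * Re z + (of_int d)\<^sup>2"
  proof -
    have "(real_of_int c)\<^sup>2 * 1 < (of_int c)\<^sup>2 * (cmod z)\<^sup>2"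
      using n assms(2) by (intro mult_strict_left_mono) auto
    moreover have "\<bar>2 * of_int (c * d) * Re z\<bar> \<le> \<bar>real_of_int (c * d)\<bar>"
    proof -
      have "\<bar>2 * of_int (c * d) * Re z\<bar> = \<bar>real_of_int (c * d)\<bar> * (2 * \<bar>Re z\<bar>)"
        by (simp add: abs_mult)
      also have "\<dots> \<le> \<bar>real_of_int (c * d)\<bar> * 1"
        using x by (intro mult_left_mono) auto
      finally show ?thesis by simp
    qed
    ultimately show ?thesis by linarith
  qed
  also have "\<dots> = (cmod (of_int c * z + of_int d))\<^sup>2"
    unfolding cmod_power2 by (simp add: power2_eq_square algebra_simps)
  finally have *: "(of_int c)\<^sup>2 + (of_int d)\<^sup>2 - \<bar>real_of_int (c * d)\<bar> < (cmod (of_int c * z + of_int d))\<^sup>2" .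
  have "c\<^sup>2 + d\<^sup>2 - \<bar>c * d\<bar> \<ge> 1"
  proof -
    have "c\<^sup>2 \<ge> 1" using assms(2) by (metis int_one_le_iff_zero_less zero_less_power2)
    have "2 * (c\<^sup>2 + d\<^sup>2 - \<bar>c * d\<bar>) = c\<^sup>2 + d\<^sup>2 + (\<bar>c\<bar> - \<bar>d\<bar>)\<^sup>2"
      by (simp add: power2_eq_square algebra_simps abs_mult)
    also have "\<dots> \<ge> 1" using \<open>c\<^sup>2 \<ge> 1\<close> by (simp add: add_increasing2)
    finally have "2 * X \<ge> 1 \<Longrightarrow> X \<ge> 1" "2 * (c\<^sup>2 + d\<^sup>2 - \<bar>c * d\<bar>) \<ge> 1" for X :: int by auto
    then show ?thesis by blast
  qed
  then have "real_of_int (c\<^sup>2 + d\<^sup>2 - \<bar>c * d\<bar>) \<ge> 1" by linarith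
  then have "1 < (cmod (of_int c * z + of_int d))\<^sup>2" using * by simp
  then show ?thesis by (metis abs_norm_cancel abs_square_le_1 not_le)
qed

text \<open>Had the matrix a nonzero lower left entry, then both it and its inverse would strictly decrease the
  imaginary part of a point of the domain; so up to sign it is a translation by an
  integer of absolute value less than \<open>1\<close>.\<close>

lemma fund_dom_free:
  assumes A: "A \<in> SL2Z" and z: "z \<in> fund_dom" and w: "cmod w = 1"
    and fz: "fst (moebius_act A (z, w)) \<in> fund_dom"
  shows "A \<in> pm_one"
proof -
  obtain a b c d :: int where A': "A = mat2 a b c d" "a * d - b * c = 1"
    using A by (rule SL2Z_cases)
  have det: "det (mat2 (of_int a) (of_int b) (of_int c) (of_int d)) = 1"
    using det_SL2Z[OF A] A' by simp
  have Imz: "Im z > 0" using z by (simp add: fund_dom_def)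
  define j where "j = of_int c * z + of_int d"
  define u where "u = (of_int a * z + of_int b) / j"
  have j0: "j \<noteq> 0" using denominator_nonzero[OF det Imz] by (simp add: j_def)
  have fu: "u \<in> fund_dom"
    using fz unfolding A' moebius_act_mat2[OF det Imz] by (simp add: u_def j_def)
  have c0: "c = 0"
  proof (rule ccontr)
    assume "c \<noteq> 0"
    have 1: "cmod j > 1" unfolding j_def by (rule lattice_norm_gt_1[OF z \<open>c \<noteq> 0\<close>])
    have "cmod (of_int (- c) * u + of_int a) > 1"
      by (rule lattice_norm_gt_1[OF fu]) (use \<open>c \<noteq> 0\<close> in simp)
    moreover have "of_int (- c) * u + of_int a = 1 / j"
    proof -
      have "(of_int (- c) * u + of_int a) * j = of_int (a * d - b * c)"
        using j0 unfolding u_def by (simp add: field_simps) (simp add: j_def algebra_simps)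
      then show ?thesis using j0 A'(2) by (simp add: field_simps)
    qed
    ultimately have "1 < 1 / cmod j" by (simp only: norm_divide norm_one)
    moreover have "1 / cmod j < 1" using 1 by (subst divide_less_eq) auto
    ultimately show False by simp
  qed
  then have ad: "a * d = 1" using A' by simp
  then have "a = 1 \<and> d = 1 \<or> a = - 1 \<and> d = - 1" by (simp add: zmult_eq_1_iff)
  then have "\<bar>Re u - Re z\<bar> = \<bar>of_int b\<bar>" unfolding u_def j_def c0 by auto
  then have "real_of_int \<bar>b\<bar> < 1" using fu z unfolding fund_dom_def by auto
  then have "b = 0" by linarith
  then show ?thesis using diagonal_pm_one[OF ad] unfolding A' c0 by simp
qed

text \<open>Choose the lower row \<open>(c, d)\<close> so that \<open>\<bar>c z + d\<bar>\<close> is minimal, which makes it primitive, and then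
  translate. The upper row also competes for the minimum, so the image has modulus at least \<open>1\<close>.\<close>

lemma reduction:
  assumes "p \<in> T1H"
  obtains A where "A \<in> SL2Z" "\<bar>Re (fst (moebius_act A p))\<bar> \<le> 1 / 2" "cmod (fst (moebius_act A p)) \<ge> 1"
proof -
  obtain z w where p: "p = (z, w)" by (cases p)
  have Imz: "Im z > 0" using assms by (simp add: p T1H_iff)
  define f where "f v = cmod (of_int (fst v) * z + of_int (snd v))" for v :: "int \<times> int"
  define S where "S = {v. v \<noteq> (0, 0) \<and> f v \<le> 1}"
  have Im_le: "\<bar>of_int (fst v)\<bar> * Im z \<le> f v" for v
    using abs_Im_le_cmod[of "of_int (fst v) * z + of_int (snd v)"] Imz by (simp add: f_def abs_mult)
  have "finite S"
  proof -
    define K where "K = \<lceil>1 / Im z\<rceil>"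
    define L where "L = \<lceil>1 + of_int K * cmod z\<rceil>"
    have "S \<subseteq> {-K..K} \<times> {-L..L}"
    proof
      fix v assume v: "v \<in> S"
      have "\<bar>of_int (fst v)\<bar> * Im z \<le> 1" using Im_le[of v] v by (simp add: S_def)
      then have c: "\<bar>of_int (fst v)\<bar> \<le> 1 / Im z" using Imz by (simp add: field_simps)
      then have cK: "\<bar>fst v\<bar> \<le> K" unfolding K_def by linarith
      have "\<bar>real_of_int (snd v)\<bar> = cmod (of_int (snd v))" by simp
      also have "\<dots> = cmod ((of_int (fst v) * z + of_int (snd v)) - of_int (fst v) * z)" by simp
      also have "\<dots> \<le> f v + cmod (of_int (fst v) * z)" unfolding f_def by (rule norm_triangle_ineq4)
      also have "\<dots> \<le> 1 + of_int K * cmod z"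
        using v cK by (intro add_mono) (auto simp: S_def norm_mult intro!: mult_right_mono)
      finally have "\<bar>snd v\<bar> \<le> L" unfolding L_def by linarith
      with cK show "v \<in> {-K..K} \<times> {-L..L}" by (cases v) auto
    qed
    then show ?thesis by (rule finite_subset) auto
  qed
  moreover have "(0, 1) \<in> S" by (simp add: S_def f_def)
  ultimately obtain v where v: "v \<in> S" "\<And>u. u \<in> S \<Longrightarrow> f v \<le> f u"
    using arg_min_if_finite(1)[of S f] arg_min_least[of S _ f] by (metis empty_iff)
  have v_min: "f v \<le> f u" if "u \<noteq> (0, 0)" for u
    using v that by (cases "u \<in> S") (auto simp: S_def)
  obtain c d where cd: "v = (c, d)" by (cases v)
  have nz: "c \<noteq> 0 \<or> d \<noteq> 0" using v(1) cd by (auto simp: S_def)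
  have f_pos: "f v > 0"
  proof (cases "c = 0")
    case True then show ?thesis using nz cd by (simp add: f_def)
  next
    case False
    then have "0 < \<bar>real_of_int c\<bar> * Im z" using Imz by simp
    then show ?thesis using Im_le[of v] cd by simp
  qed
  have "gcd c d = 1"
  proof -
    define g where "g = gcd c d"
    have g: "g > 0" using nz unfolding g_def by (simp add: gcd_pos_int)
    obtain c' d' where e: "c = g * c'" "d = g * d'" 
      unfolding g_def by (meson dvdE gcd_dvd1 gcd_dvd2)
    have "f v \<le> f (c', d')" by (rule v_min) (use nz e in auto)
    moreover have "f v = of_int g * f (c', d')"
    proof -
      have "of_int c * z + of_int d = of_int g * (of_int c' * z + of_int d')"
        unfolding e by (simp add: algebra_simps)
      then show ?thesis unfolding f_def cd using g by (simp add: norm_mult)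
    qed
    ultimately have "of_int g * f (c', d') \<le> 1 * f (c', d')" "f (c', d') > 0"
      using f_pos g by (auto simp: zero_less_mult_iff)
    then have "real_of_int g \<le> 1" using mult_right_le_imp_le by blast
    then show ?thesis using g unfolding g_def by linarith
  qed
  then obtain a b0 where "a * d + b0 * c = 1"
    using bezout_int[of d c] by (auto simp: gcd.commute)
  then have ab: "a * d - (- b0) * c = 1" by simp
  define b where "b = - b0"
  define n where "n = - round (Re ((of_int a * z + of_int b) / (of_int c * z + of_int d)))"
  define a' b' where "a' = a + n * c" "b' = b + n * d"
  have det: "a' * d - b' * c = 1" using ab unfolding a'_b'_def b_def by (simp add: algebra_simps)
  let ?A = "mat2 (of_int a') (of_int b') (of_int c) (of_int d)"
  have A: "?A \<in> SL2Z" by (rule mat2_in_SL2Z[OF det])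
  have j0: "of_int c * z + of_int d \<noteq> 0" using f_pos unfolding f_def cd by auto
  have fst: "fst (moebius_act ?A p) = (of_int a' * z + of_int b') / (of_int c * z + of_int d)"
    unfolding p moebius_act_mat2[OF det_SL2Z[OF A] Imz] by simp
  also have "\<dots> = (of_int a * z + of_int b) / (of_int c * z + of_int d) + of_int n"
    using j0 unfolding a'_b'_def by (simp add: field_simps)
  finally have tr: "fst (moebius_act ?A p) = (of_int a * z + of_int b) / (of_int c * z + of_int d) + of_int n" .
  have "\<bar>Re (fst (moebius_act ?A p))\<bar> \<le> 1 / 2"
    unfolding tr n_def using of_int_round_abs_le[of "Re ((of_int a * z + of_int b) / (of_int c * z + of_int d))"]
    by (simp add: abs_minus_commute)
  moreover have "cmod (fst (moebius_act ?A p)) \<ge> 1"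
  proof -
    have "f v \<le> f (a', b')" by (rule v_min) (use det in auto)
    then show ?thesis unfolding fst using f_pos unfolding cd f_def by (simp add: norm_divide)
  qed
  ultimately show thesis using A that by blast
qed

text \<open>Two frames determine the automorphy factor \<open>j = c z + d\<close> of the element that maps one to the other up to
  sign, since \<open>j\<^sup>2\<close> is the quotient of the heights times the quotient of the directions. For frames near
  each other \<open>j\<^sup>2\<close> is near \<open>1\<close>, so \<open>Im j = c Im z\<close> is small, and integrality gives \<open>c = 0\<close>. This
  covers the frames over elliptic points as well.\<close>

lemma locally_free:
  assumes p: "p \<in> T1H"
  obtains U where "open U" "p \<in> U"
    "\<And>A q. A \<in> SL2Z \<Longrightarrow> q \<in> U \<inter> T1H \<Longrightarrow> moebius_act A q \<in> U \<Longrightarrow> A \<in> pm_one"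
proof -
  obtain z w where p': "p = (z, w)" by (cases p)
  have Imz: "Im z > 0" and w: "cmod w = 1" using p by (auto simp: p' T1H_iff)
  define F where "F = (\<lambda>(p1, p2). of_real (Im (fst p1) / Im (fst p2)) * (snd p1 / snd p2) :: complex)"
  define e where "e = (Im z / 2)\<^sup>2"
  have e: "e > 0" unfolding e_def using Imz by simp
  have "isCont F (p, p)"
    unfolding F_def case_prod_beta using Imz w p' by (intro continuous_intros) auto
  moreover have "F (p, p) = 1" using Imz w by (auto simp: F_def p')
  ultimately have "(F \<longlongrightarrow> 1) (nhds (p, p))"
    by (metis isCont_def tendsto_at_iff_tendsto_nhds)
  then have "\<forall>\<^sub>F x in nhds (p, p). dist (F x) 1 < e"
    using e by (rule tendstoD)
  then obtain S where S: "open S" "(p, p) \<in> S" "\<And>x. x \<in> S \<Longrightarrow> dist (F x) 1 < e"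
    unfolding eventually_nhds by blast
  obtain V V' where V: "open V" "open V'" "p \<in> V" "p \<in> V'" "V \<times> V' \<subseteq> S"
    using open_prod_elim[OF S(1,2)] by (metis mem_Sigma_iff)
  define U where "U = V \<inter> V' \<inter> ((ball z (1 / 2) \<inter> {u. Im u > Im z / 2}) \<times> UNIV)"
  have "open U" unfolding U_def using V
    by (intro open_Int open_Times open_halfspace_Im_gt) auto
  moreover have "p \<in> U" unfolding U_def using V Imz by (auto simp: p')
  moreover have "A \<in> pm_one" if A: "A \<in> SL2Z" and q: "q \<in> U \<inter> T1H" and Aq: "moebius_act A q \<in> U" for A q
  proof -
    obtain z1 w1 where q': "q = (z1, w1)" by (cases q)
    obtain z2 w2 where Aq': "moebius_act A q = (z2, w2)" by (cases "moebius_act A q")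
    have z1: "Im z1 > 0" "cmod w1 = 1" using q by (auto simp: q' T1H_iff)
    obtain a b c d :: int where A': "A = mat2 a b c d" "a * d - b * c = 1"
      using A by (rule SL2Z_cases)
    have det: "det (mat2 (of_int a) (of_int b) (of_int c) (of_int d)) = 1"
      using det_SL2Z[OF A] A' by simp
    define j where "j = of_int c * z1 + of_int d"
    have j0: "j \<noteq> 0" using denominator_nonzero[OF det z1(1)] by (simp add: j_def)
    have act: "z2 = (of_int a * z1 + of_int b) / j" "w2 = w1 * (cnj j / j)"
      using Aq' unfolding q' A' moebius_act_mat2[OF det z1(1)] j_def by simp_all
    have "Im z2 = Im z1 / (cmod j)\<^sup>2"
      using Im_moebius[OF det z1(1)] act j_def by simp
    then have "Im z1 / Im z2 = (cmod j)\<^sup>2" using z1 by simp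
    moreover have "w1 / w2 = j / cnj j" using z1 j0 unfolding act by (auto simp: field_simps)
    moreover have "F (q, moebius_act A q) = of_real (Im z1 / Im z2) * (w1 / w2)"
      unfolding F_def Aq' by (simp add: q')
    ultimately have "F (q, moebius_act A q) = of_real ((cmod j)\<^sup>2) * (j / cnj j)" by simp
    also have "\<dots> = j\<^sup>2"
      using j0 unfolding complex_norm_square by (simp add: power2_eq_square)
    finally have "F (q, moebius_act A q) = j\<^sup>2" .
    moreover have "(q, moebius_act A q) \<in> S" using q Aq V unfolding U_def by blast
    ultimately have "cmod (j\<^sup>2 - 1) < (Im z / 2)\<^sup>2"
      using S(3)[of "(q, moebius_act A q)"] by (simp add: dist_norm e_def)
    moreover have "j\<^sup>2 - 1 = (j - 1) * (j + 1)" by (simp add: power2_eq_square algebra_simps)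
    ultimately have prod: "cmod (j - 1) * cmod (j + 1) < (Im z / 2) * (Im z / 2)"
      by (simp add: norm_mult power2_eq_square)
    have "cmod (j - 1) < Im z / 2 \<or> cmod (j + 1) < Im z / 2"
    proof (rule ccontr)
      assume "\<not> ?thesis"
      then have "(Im z / 2) * (Im z / 2) \<le> cmod (j - 1) * cmod (j + 1)"
        using Imz by (intro mult_mono) auto
      then show False using prod by simp
    qed
    then have "\<bar>Im j\<bar> < Im z / 2"
      using abs_Im_le_cmod[of "j - 1"] abs_Im_le_cmod[of "j + 1"] by auto
    moreover have "\<bar>Im j\<bar> = \<bar>of_int c\<bar> * Im z1" unfolding j_def using z1 by (simp add: abs_mult)
    moreover have "Im z1 > Im z / 2" using q unfolding U_def q' by simp
    ultimately have "\<bar>real_of_int c\<bar> * (Im z / 2) < 1 * (Im z / 2)"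
      by (smt (verit) mult_left_mono abs_ge_zero)
    then have "\<bar>real_of_int c\<bar> < 1" using Imz by (simp add: mult_less_cancel_right)
    then have c0: "c = 0" by linarith
    then have ad: "a * d = 1" using A' by simp
    then have "a = 1 \<and> d = 1 \<or> a = - 1 \<and> d = - 1" by (simp add: zmult_eq_1_iff)
    then have "cmod (z2 - z1) = \<bar>of_int b\<bar>" unfolding act j_def c0 by (auto simp: norm_minus_commute)
    moreover have "z1 \<in> ball z (1 / 2)" "z2 \<in> ball z (1 / 2)"
      using q Aq[unfolded Aq'] unfolding q' U_def by auto
    then have "dist z2 z1 < 1" using dist_triangle_half_r[of z z2 1 z1] by simp
    ultimately have "b = 0" by (simp add: dist_norm)
    then show ?thesis using diagonal_pm_one[OF ad] unfolding A' c0 by simp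
  qed
  ultimately show thesis by (rule that)
qed

section \<open>Liouville measure in horocyclic coordinates\<close>

text \<open>Monotone convergence extends substitution on compact intervals to their union.\<close>

lemma nn_integral_substitution_exhaust:
  fixes f :: "real \<Rightarrow> ennreal" and g g' :: "real \<Rightarrow> real" and a b :: "nat \<Rightarrow> real"
  assumes f [measurable]: "f \<in> borel_measurable borel"
    and [measurable]: "g \<in> borel_measurable borel" "g' \<in> borel_measurable borel"
    and deriv: "\<And>n x. x \<in> {a n..b n} \<Longrightarrow> (g has_real_derivative g' x) (at x)"
    and cont: "\<And>n. continuous_on {a n..b n} g'"
    and nonneg: "\<And>n x. x \<in> {a n..b n} \<Longrightarrow> 0 \<le> g' x"
    and ab: "\<And>n. a n < b n"
    and mono: "decseq a" "incseq b"
    and gmono: "decseq (\<lambda>n. g (a n))" "incseq (\<lambda>n. g (b n))"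
  shows "(\<integral>\<^sup>+x. f x * indicator (\<Union>n. {g (a n)..g (b n)}) x \<partial>lborel)
    = (\<integral>\<^sup>+x. f (g x) * ennreal (g' x) * indicator (\<Union>n. {a n..b n}) x \<partial>lborel)"
proof -
  have lim: "(\<integral>\<^sup>+x. h x * indicator (\<Union>n. {p n..q n}) x \<partial>lborel)
      = (SUP n. \<integral>\<^sup>+x. h x * indicator {p n..q n} x \<partial>lborel)"
    if [measurable]: "h \<in> borel_measurable borel" and p: "decseq p" and q: "incseq q"
    for h :: "real \<Rightarrow> ennreal" and p q :: "nat \<Rightarrow> real"
  proof -
    have inc: "incseq (\<lambda>n. {p n..q n})"
    proof (unfold incseq_def, intro allI impI subsetI)
      fix m n x assume "m \<le> n" "x \<in> {p m..q m}"
      then show "x \<in> {p n..q n}"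
        using decseqD[OF p, of m n] incseqD[OF q, of m n] by auto
    qed
    have "h x * indicator (\<Union>n. {p n..q n}) x = (SUP n. h x * indicator {p n..q n} x)" for x
    proof -
      have "indicator (\<Union>n. {p n..q n}) x = (SUP n. indicator {p n..q n} x :: ennreal)"
      proof (rule LIMSEQ_unique[OF LIMSEQ_indicator_incseq LIMSEQ_SUP])
        show "incseq (\<lambda>n. {p n..q n})" by (rule inc)
        show "incseq (\<lambda>n. indicator {p n..q n} x :: ennreal)"
          using incseq_SucD[OF inc]
          by (intro incseq_SucI) (auto simp: subset_eq split: split_indicator)
      qed
      then show ?thesis by (simp add: SUP_mult_left_ennreal)
    qed
    then have "(\<integral>\<^sup>+x. h x * indicator (\<Union>n. {p n..q n}) x \<partial>lborel)
        = (\<integral>\<^sup>+x. (SUP n. h x * indicator {p n..q n} x) \<partial>lborel)" by simp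
    also have "\<dots> = (SUP n. \<integral>\<^sup>+x. h x * indicator {p n..q n} x \<partial>lborel)"
    proof (rule nn_integral_monotone_convergence_SUP)
      show "incseq (\<lambda>n x. h x * indicator {p n..q n} x)"
        using incseq_SucD[OF inc]
        by (intro incseq_SucI) (auto simp: le_fun_def subset_eq split: split_indicator)
    qed measurable
    finally show ?thesis .
  qed
  have "(\<integral>\<^sup>+x. f x * indicator {g (a n)..g (b n)} x \<partial>lborel)
    = (\<integral>\<^sup>+x. f (g x) * ennreal (g' x) * indicator {a n..b n} x \<partial>lborel)" for n
    by (rule nn_integral_substitution_aux[OF f _ deriv cont nonneg ab]) simp_all
  then show ?thesis
    by (subst lim[OF f gmono], subst lim[OF _ mono]) simp_all
qed

lemma nn_integral_inverse_square:
  fixes f :: "real \<Rightarrow> ennreal"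
  assumes [measurable]: "f \<in> borel_measurable borel" and k: "k > 0"
  shows "(\<integral>\<^sup>+y. f y * indicator {0<..} y \<partial>lborel)
    = (\<integral>\<^sup>+s. f (1 / (s\<^sup>2 * k)) * ennreal (2 / (s ^ 3 * k)) * indicator {0<..} s \<partial>lborel)"
proof -
  let ?g = "\<lambda>s. 1 / (s\<^sup>2 * k)" and ?g' = "\<lambda>s. - 2 / (s ^ 3 * k)"
  let ?a = "\<lambda>n. - real (Suc n)" and ?b = "\<lambda>n. - (1 / (real (Suc n) + 1))"
  have ab: "?a n < ?b n" for n
  proof -
    have "1 / (real (Suc n) + 1) < 1" "1 \<le> real (Suc n)" by simp_all
    then show ?thesis by linarith
  qed
  have neg: "x < 0" if "x \<in> {?a n..?b n}" for n x
  proof -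
    have "x \<le> ?b n" "?b n < 0" using that by (simp_all add: add_nonneg_pos)
    then show ?thesis by (rule le_less_trans)
  qed
  have U1: "(\<Union>n. {?g (?a n)..?g (?b n)}) = {0<..}"
  proof (intro equalityI subsetI)
    fix y assume "y \<in> (\<Union>n. {?g (?a n)..?g (?b n)})"
    then obtain n where "y \<ge> ?g (?a n)" by auto
    moreover have "?g (?a n) > 0" using k by simp
    ultimately have "0 < y" by (rule less_le_trans[rotated])
    then show "y \<in> {0<..}" by simp
  next
    fix y :: real assume "y \<in> {0<..}"
    then have y: "y > 0" by simp
    obtain n where n: "real n \<ge> max (1 / (y * k)) (y * k)" using real_arch_simple by blast
    have sq: "real n \<le> (real (Suc n))\<^sup>2" "real n \<le> (real (Suc n) + 1)\<^sup>2"
      by (simp_all add: power2_eq_square algebra_simps)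
    have "?g (?a n) \<le> y"
    proof -
      have "1 / (y * k) \<le> (real (Suc n))\<^sup>2" using n sq by simp
      then have "1 / ((real (Suc n))\<^sup>2 * k) \<le> y" using y k by (simp add: field_simps)
      then show ?thesis by (simp only: power2_minus)
    qed
    moreover have "y \<le> ?g (?b n)"
    proof -
      have "y * k \<le> (real (Suc n) + 1)\<^sup>2" using n sq by simp
      then have "y \<le> 1 / ((1 / (real (Suc n) + 1))\<^sup>2 * k)" using y k by (simp add: field_simps)
      then show ?thesis by (simp only: power2_minus)
    qed
    ultimately show "y \<in> (\<Union>n. {?g (?a n)..?g (?b n)})" by auto
  qed
  have U2: "(\<Union>n. {?a n..?b n}) = {..<0}"
  proof (intro equalityI subsetI)
    fix y assume "y \<in> (\<Union>n. {?a n..?b n})"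
    then show "y \<in> {..<0}" using neg by auto
  next
    fix y :: real assume "y \<in> {..<0}"
    then have y: "y < 0" by simp
    obtain n where n: "real n \<ge> max (- y) (1 / (- y))" using real_arch_simple by blast
    have "1 / (- y) \<le> real (Suc n) + 1" using n by simp
    then have "y \<le> ?b n" using y by (simp add: field_simps)
    then show "y \<in> (\<Union>n. {?a n..?b n})" using n by (auto intro!: exI[of _ n])
  qed
  have "(\<integral>\<^sup>+y. f y * indicator {0<..} y \<partial>lborel)
    = (\<integral>\<^sup>+s. f (?g s) * ennreal (?g' s) * indicator {..<0} s \<partial>lborel)"
    unfolding U1[symmetric] U2[symmetric]
  proof (rule nn_integral_substitution_exhaust)
    show "(?g has_real_derivative ?g' x) (at x)" if "x \<in> {?a n..?b n}" for n x
      using neg[OF that] k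
      by (auto intro!: derivative_eq_intros simp: power2_eq_square power3_eq_cube field_simps)
    show "continuous_on {?a n..?b n} ?g'" for n
      using neg[of _ n] k by (intro continuous_intros) auto
    show "0 \<le> ?g' x" if "x \<in> {?a n..?b n}" for n x
    proof -
      have "x ^ 3 * k \<le> 0" using neg[OF that] k
        by (intro mult_nonpos_nonneg) (auto simp: power3_eq_cube mult_nonneg_nonpos mult_nonpos_nonpos)
      then show ?thesis by (simp add: divide_nonpos_nonpos)
    qed
    show "decseq (\<lambda>n. ?g (?a n))"
    proof (rule decseq_SucI)
      fix n
      have "(real (Suc n))\<^sup>2 \<le> (real (Suc (Suc n)))\<^sup>2" by (rule power_mono) auto
      then show "?g (?a (Suc n)) \<le> ?g (?a n)"
        unfolding power2_minus using k by (intro divide_left_mono mult_right_mono mult_pos_pos) auto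
    qed
    show "incseq (\<lambda>n. ?g (?b n))"
    proof (rule incseq_SucI)
      fix n
      have "(1 / (real (Suc (Suc n)) + 1))\<^sup>2 \<le> (1 / (real (Suc n) + 1))\<^sup>2"
        by (rule power_mono) (auto simp: field_simps)
      then show "?g (?b n) \<le> ?g (?b (Suc n))"
        unfolding power2_minus using k
        by (intro divide_left_mono mult_right_mono mult_pos_pos) (auto simp: add_nonneg_eq_0_iff)
    qed
    show "decseq ?a" by (intro decseq_SucI) simp
    show "incseq ?b" by (intro incseq_SucI) (simp add: field_simps)
  qed (use ab in auto)
  also have "\<dots> = (\<integral>\<^sup>+s. f (?g (- s)) * ennreal (?g' (- s)) * indicator {..<0} (- s) \<partial>lborel)"
    by (subst nn_integral_real_affine[where c = "-1" and t = 0]) auto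
  also have "\<dots> = (\<integral>\<^sup>+s. f (?g s) * ennreal (2 / (s ^ 3 * k)) * indicator {0<..} s \<partial>lborel)"
    by (intro nn_integral_cong) (auto simp: indicator_def)
  finally show ?thesis .
qed

text \<open>The substitution is \<open>\<theta> = 2 arctan t\<close>, and the frame direction \<open>cis \<theta>\<close> is then rational in \<open>t\<close>.\<close>

lemma nn_integral_circle:
  fixes G :: "complex \<Rightarrow> ennreal"
  assumes [measurable]: "G \<in> borel_measurable borel"
  shows "(\<integral>\<^sup>+\<theta>. G (cis \<theta>) * indicator {0..<2 * pi} \<theta> \<partial>lborel)
    = (\<integral>\<^sup>+t. G (- cnj (Complex t 1) / Complex t 1) * ennreal (2 / (1 + t\<^sup>2)) \<partial>lborel)"
proof -
  have [measurable]: "cis \<in> borel_measurable borel"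
    by (intro borel_measurable_continuous_onI continuous_intros)
  have cis_eq: "cis (2 * arctan t) = - cnj (Complex t 1) / Complex t 1" for t
  proof -
    have "cis (2 * arctan t) = (cis (arctan t))\<^sup>2" by (simp add: Complex.DeMoivre)
    also have "cis (arctan t) = Complex 1 t / of_real (sqrt (1 + t\<^sup>2))"
      by (simp add: cis.ctr cos_arctan sin_arctan complex_eq_iff Re_divide_of_real Im_divide_of_real)
    also have "(\<dots>)\<^sup>2 = (Complex 1 t)\<^sup>2 / of_real (1 + t\<^sup>2)"
      by (simp add: power_divide flip: of_real_power)
    also have "\<dots> = - cnj (Complex t 1) / Complex t 1"
    proof -
      have "1 + t\<^sup>2 \<noteq> 0" by (smt (verit) zero_le_power2)
      then show ?thesis
        by (simp add: complex_eq_iff Re_divide Im_divide power2_eq_square divide_simps)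
    qed
    finally show ?thesis .
  qed
  let ?g = "\<lambda>t. 2 * arctan t" and ?g' = "\<lambda>t::real. 2 / (1 + t\<^sup>2)"
  let ?a = "\<lambda>n. - real (Suc n)" and ?b = "\<lambda>n. real (Suc n)"
  have U2: "(\<Union>n. {?a n..?b n}) = UNIV"
  proof -
    have "\<exists>n. x \<in> {?a n..?b n}" for x
    proof -
      obtain n where "\<bar>x\<bar> \<le> real n" using real_arch_simple by blast
      then have "x \<in> {?a n..?b n}" by auto
      then show ?thesis by blast
    qed
    then show ?thesis by auto
  qed
  have U1: "(\<Union>n. {?g (?a n)..?g (?b n)}) = {- pi<..<pi}"
  proof (intro equalityI subsetI)
    fix y assume "y \<in> (\<Union>n. {?g (?a n)..?g (?b n)})"
    then obtain n where "?g (?a n) \<le> y" "y \<le> ?g (?b n)" by auto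
    moreover have "?g (?b n) < pi" "- pi < ?g (?a n)"
      using arctan_ubound[of "?b n"] arctan_lbound[of "?a n"] by linarith+
    ultimately show "y \<in> {- pi<..<pi}" by auto
  next
    fix y assume y: "y \<in> {- pi<..<pi}"
    then have at: "arctan (tan (y / 2)) = y / 2" by (intro arctan_tan) auto
    have "tan (y / 2) \<in> (\<Union>n. {?a n..?b n})" unfolding U2 by (rule UNIV_I)
    then obtain n where "tan (y / 2) \<in> {?a n..?b n}" by (rule UN_E)
    then have "arctan (?a n) \<le> arctan (tan (y / 2))" "arctan (tan (y / 2)) \<le> arctan (?b n)"
      unfolding arctan_le_iff by simp_all
    then have "arctan (?a n) \<le> y / 2" "y / 2 \<le> arctan (?b n)"
      unfolding at .
    then have "y \<in> {?g (?a n)..?g (?b n)}" by auto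
    then show "y \<in> (\<Union>n. {?g (?a n)..?g (?b n)})" by blast
  qed
  have "(\<integral>\<^sup>+\<theta>. G (cis \<theta>) * indicator {0..<2 * pi} \<theta> \<partial>lborel)
    = (\<integral>\<^sup>+\<theta>. G (cis \<theta>) * indicator {0..<pi} \<theta> + G (cis \<theta>) * indicator {pi..<2 * pi} \<theta> \<partial>lborel)"
    by (intro nn_integral_cong) (auto simp: indicator_def)
  also have "\<dots> = (\<integral>\<^sup>+\<theta>. G (cis \<theta>) * indicator {0..<pi} \<theta> \<partial>lborel)
      + (\<integral>\<^sup>+\<theta>. G (cis \<theta>) * indicator {pi..<2 * pi} \<theta> \<partial>lborel)"
    by (rule nn_integral_add) measurable
  also have "(\<integral>\<^sup>+\<theta>. G (cis \<theta>) * indicator {pi..<2 * pi} \<theta> \<partial>lborel)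
      = (\<integral>\<^sup>+\<theta>. G (cis (2 * pi + 1 * \<theta>)) * indicator {pi..<2 * pi} (2 * pi + 1 * \<theta>) \<partial>lborel)"
    by (subst nn_integral_real_affine[where c = 1 and t = "2 * pi"]) auto
  also have "\<dots> = (\<integral>\<^sup>+\<theta>. G (cis \<theta>) * indicator {- pi..<0} \<theta> \<partial>lborel)"
    by (intro nn_integral_cong) (auto simp: indicator_def cis_mult[symmetric])
  also have "(\<integral>\<^sup>+\<theta>. G (cis \<theta>) * indicator {0..<pi} \<theta> \<partial>lborel) + \<dots>
     = (\<integral>\<^sup>+\<theta>. G (cis \<theta>) * indicator {0..<pi} \<theta> + G (cis \<theta>) * indicator {- pi..<0} \<theta> \<partial>lborel)"
    by (rule nn_integral_add[symmetric]) measurable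
  also have "\<dots> = (\<integral>\<^sup>+\<theta>. G (cis \<theta>) * indicator {- pi<..<pi} \<theta> \<partial>lborel)"
    by (rule nn_integral_cong_AE, rule AE_mp[OF AE_lborel_singleton[of "- pi"]])
      (auto simp: indicator_def)
  also have "\<dots> = (\<integral>\<^sup>+t. G (cis (?g t)) * ennreal (?g' t) * indicator UNIV t \<partial>lborel)"
    unfolding U1[symmetric] U2[symmetric]
  proof (rule nn_integral_substitution_exhaust)
    have nz: "1 + x\<^sup>2 \<noteq> 0" for x :: real by (smt (verit) zero_le_power2)
    show "(?g has_real_derivative ?g' x) (at x)" for x
      by (auto intro!: derivative_eq_intros simp: field_simps)
    show "continuous_on {?a n..?b n} ?g'" for n
      using nz by (intro continuous_intros) auto
    show "?g \<in> borel_measurable borel"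
      by (intro borel_measurable_continuous_onI continuous_intros)
    show "decseq (\<lambda>n. ?g (?a n))"
      by (intro decseq_SucI) (simp add: arctan_le_iff)
    show "incseq (\<lambda>n. ?g (?b n))"
      by (intro incseq_SucI) (simp add: arctan_le_iff)
    show "decseq ?a" by (intro decseq_SucI) simp
    show "incseq ?b" by (intro incseq_SucI) simp
  qed auto
  finally show ?thesis by (simp add: cis_eq)
qed

lemma nn_integral_lborel_complex:
  fixes f :: "complex \<Rightarrow> ennreal"
  assumes [measurable]: "f \<in> borel_measurable borel"
  shows "(\<integral>\<^sup>+z. f z \<partial>lborel) = (\<integral>\<^sup>+x. \<integral>\<^sup>+y. f (Complex x y) \<partial>lborel \<partial>lborel)"
proof -
  have C: "(\<lambda>p. Complex (fst p) (snd p)) \<in> borel_measurable (lborel \<Otimes>\<^sub>M lborel)"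
    unfolding Complex_eq by measurable
  have "lborel = distr (lborel \<Otimes>\<^sub>M lborel) borel (\<lambda>p. Complex (fst p) (snd p))"
  proof (rule lborel_eqI)
    fix l u :: complex assume le: "\<And>b. b \<in> Basis \<Longrightarrow> l \<bullet> b \<le> u \<bullet> b"
    then have lu: "Re l \<le> Re u" "Im l \<le> Im u" using le[of 1] le[of "\<i>"] by (simp_all add: Basis_complex_def)
    have "(\<lambda>p. Complex (fst p) (snd p)) -` box l u \<inter> space (lborel \<Otimes>\<^sub>M lborel)
        = {Re l<..<Re u} \<times> {Im l<..<Im u}"
      by (auto simp: in_box_complex_iff space_pair_measure)
    then show "emeasure (distr (lborel \<Otimes>\<^sub>M lborel) borel (\<lambda>p. Complex (fst p) (snd p))) (box l u)
        = ennreal (\<Prod>b\<in>Basis. (u - l) \<bullet> b)"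
      using C lu by (simp add: emeasure_distr lborel.emeasure_pair_measure_Times Basis_complex_def
         ennreal_mult')
  qed simp
  from arg_cong[OF this, of "\<lambda>M. integral\<^sup>N M f"]
  have "(\<integral>\<^sup>+z. f z \<partial>lborel) = (\<integral>\<^sup>+p. f (Complex (fst p) (snd p)) \<partial>(lborel \<Otimes>\<^sub>M lborel))"
    using C by (simp add: nn_integral_distr)
  also have "\<dots> = (\<integral>\<^sup>+x. \<integral>\<^sup>+y. f (Complex x y) \<partial>lborel \<partial>lborel)"
    using C by (subst lborel.nn_integral_fst[symmetric]) simp_all
  finally show ?thesis .
qed

lemma borel_measurable_Complex [measurable (raw)]:
  assumes [measurable]: "f \<in> borel_measurable M" "g \<in> borel_measurable M"
  shows "(\<lambda>x. Complex (f x) (g x)) \<in> borel_measurable M"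
  unfolding Complex_eq by measurable

lemma borel_measurable_cnj [measurable (raw)]:
  "f \<in> borel_measurable M \<Longrightarrow> (\<lambda>x. cnj (f x)) \<in> borel_measurable M"
  by (rule measurable_compose[of _ _ borel]) (auto intro: borel_measurable_continuous_onI continuous_intros)

text \<open>The image of the frame \<open>(\<i>, \<pi>)\<close> under the matrix \<open>(r, r t - 1/s; s, s t)\<close> of determinant \<open>1\<close>, where
  \<open>v = (r, s)\<close> is the first column. As \<open>t\<close> varies it runs through a horocycle.\<close>

definition horo :: "real \<times> real \<Rightarrow> real \<Rightarrow> complex \<times> complex" where
  "horo v t = (of_real (fst v / snd v) - 1 / (of_real ((snd v)\<^sup>2) * Complex t 1),
               - cnj (Complex t 1) / Complex t 1)"

lemma Complex_t_1_nonzero: "Complex t 1 \<noteq> 0"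
  by (simp add: complex_eq_iff)

lemma horo_eq:
  assumes "s \<noteq> 0"
  shows "horo (r, s) t = (Complex (r / s - t / (s\<^sup>2 * (1 + t\<^sup>2))) (1 / (s\<^sup>2 * (1 + t\<^sup>2))),
    - cnj (Complex t 1) / Complex t 1)"
proof -
  have "1 + t\<^sup>2 \<noteq> 0" by (smt (verit) zero_le_power2)
  then have "Re (1 / (of_real (s\<^sup>2) * Complex t 1)) = t / (s\<^sup>2 * (1 + t\<^sup>2))"
    "Im (1 / (of_real (s\<^sup>2) * Complex t 1)) = - (1 / (s\<^sup>2 * (1 + t\<^sup>2)))"
    using assms by (simp_all add: Re_divide Im_divide power2_eq_square divide_simps) (simp_all add: algebra_simps)
  then show ?thesis by (simp add: horo_def complex_eq_iff)
qed

lemma horo_T1H: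
  assumes "snd v \<noteq> 0"
  shows "horo v t \<in> T1H"
proof -
  have "1 + t\<^sup>2 > 0" by (smt (verit) zero_le_power2)
  then show ?thesis
    using assms horo_eq[of "snd v" "fst v" t] Complex_t_1_nonzero[of t]
    by (simp add: T1H_iff norm_divide del: complex_cnj)
qed

lemma horo_minus: "horo (- v) t = horo v t"
  by (simp add: horo_def)

lemma measurable_horo [measurable (raw)]:
  assumes [measurable]: "f \<in> borel_measurable M" "g \<in> borel_measurable M"
  shows "(\<lambda>x. horo (f x) (g x)) \<in> borel_measurable M"
proof -
  have [measurable]: "(\<lambda>x. fst (f x)) \<in> borel_measurable M" "(\<lambda>x. snd (f x)) \<in> borel_measurable M"
    by (rule measurable_compose[OF assms(1)];
        intro borel_measurable_continuous_onI continuous_intros)+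
  show ?thesis unfolding horo_def by measurable
qed

text \<open>Multiplying matrices from the left multiplies the first column; the new matrix differs from the
  standard one with that column by a unipotent factor on the right, which shifts \<open>t\<close>.\<close>

lemma moebius_act_horo:
  assumes det: "det (mat2 a b c d) = 1" and s: "s \<noteq> 0" and s': "c * r + d * s \<noteq> 0"
  shows "moebius_act (mat2 a b c d) (horo (r, s) t)
    = horo (a * r + b * s, c * r + d * s) (t - c / (s * (c * r + d * s)))"
proof -
  define r' s' where "r' = a * r + b * s" "s' = c * r + d * s"
  define u where "u = Complex t 1"
  define u' where "u' = Complex (t - c / (s * s')) 1"
  have u: "u \<noteq> 0" "u' \<noteq> 0" unfolding u_def u'_def by (rule Complex_t_1_nonzero)+
  have s0: "s' \<noteq> 0" using s' by (simp add: r'_s'_def)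
  have u'_eq: "u' = u - of_real (c / (s * s'))" by (simp add: u_def u'_def complex_eq_iff)
  have uu: "of_real (s * s') * u' = of_real (s * s') * u - of_real c"
    unfolding u'_eq using s s0 by (simp add: field_simps)
  define z where "z = of_real (r / s) - 1 / (of_real (s\<^sup>2) * u)"
  have z: "Im z > 0" using horo_T1H[of "(r, s)" t] s by (simp add: horo_def z_def u_def T1H_iff)
  have ad: "a * d - b * c = 1" using det by (simp add: det_mat2)
  have den: "of_real c * z + of_real d = of_real (s' / s) * (u' / u)"
  proof -
    have "(of_real c * z + of_real d) * (of_real (s\<^sup>2) * u) = of_real s * (of_real s' * u) - of_real c"
      unfolding z_def r'_s'_def using s u by (simp add: field_simps power2_eq_square)
    also have "\<dots> = of_real (s * s') * u'" unfolding uu by simp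
    also have "\<dots> = (of_real (s' / s) * (u' / u)) * (of_real (s\<^sup>2) * u)"
      using s u by (simp add: field_simps power2_eq_square)
    finally show ?thesis using s u by (simp only: mult_cancel_right) simp
  qed
  have num: "of_real a * z + of_real b = (of_real (r' * s) * u - of_real a) / (of_real (s\<^sup>2) * u)"
    unfolding z_def r'_s'_def using s u by (simp add: field_simps power2_eq_square)
  have "(of_real a * z + of_real b) / (of_real c * z + of_real d)
      = of_real (r' / s') - 1 / (of_real (s'\<^sup>2) * u')"
  proof -
    have key: "a * s' = c * r' + s"
    proof -
      have "a * s' - c * r' = (a * d - b * c) * s" unfolding r'_s'_def by (simp add: algebra_simps)
      then show ?thesis unfolding ad by simp
    qed
    have "(of_real (r' * s) * u - of_real a) * of_real s'
        = (of_real (r' * s') * u' - 1) * of_real s"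
    proof -
      have "(of_real (r' * s') * u' - 1) * of_real s = of_real r' * (of_real (s * s') * u') - of_real s"
        by (simp add: algebra_simps)
      also have "\<dots> = of_real r' * of_real (s * s') * u - of_real (c * r' + s)"
        unfolding uu by (simp add: algebra_simps)
      also have "\<dots> = (of_real (r' * s) * u - of_real a) * of_real s'"
        unfolding key[symmetric] by (simp add: algebra_simps)
      finally show ?thesis ..
    qed
    then have N: "(of_real (r' * s) * u - of_real a) = (of_real (r' * s') * u' - 1) * of_real (s / s')"
      using s0 by (simp add: field_simps)
    show ?thesis unfolding num den N using s s0 u
      by (simp add: field_simps power2_eq_square)
  qed
  moreover have "- cnj u / u * (cnj (of_real (s' / s) * (u' / u)) / (of_real (s' / s) * (u' / u)))
      = - cnj u' / u'"
    using s s0 u by (simp add: field_simps)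
  ultimately show ?thesis
    unfolding horo_def fst_conv snd_conv r'_s'_def[symmetric] u_def[symmetric] u'_def[symmetric]
      z_def[symmetric] moebius_act_mat2[OF det z] den
    by simp
qed

lemma sets_liouville: "sets liouville = sets (restrict_space borel T1H)"
proof -
  let ?P = "restrict_space borel upper_half_plane \<Otimes>\<^sub>M restrict_space borel (sphere 0 1 :: complex set)"
  have "sets liouville = sets ?P"
    unfolding liouville_def by (intro sets_pair_measure_cong) (simp_all add: sets_restrict_space)
  also have "\<dots> = sets (restrict_space borel T1H)"
  proof (rule subset_antisym)
    show "sets ?P
      \<subseteq> sets (restrict_space borel T1H)"
      unfolding pair_measure_def
    proof (rule sets_pair_in_sets[unfolded pair_measure_def])
      fix X Y assume "X \<in> sets (restrict_space borel upper_half_plane)"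
        and "Y \<in> sets (restrict_space borel (sphere 0 1 :: complex set))"
      then obtain B C where "B \<in> sets borel" "C \<in> sets borel"
        "X \<times> Y = T1H \<inter> (B \<times> C)" by (force simp: sets_restrict_space T1H_def)
      then show "X \<times> Y \<in> sets (restrict_space borel T1H)"
        unfolding sets_restrict_space using borel_Times by blast
    qed
    show "sets (restrict_space borel T1H) \<subseteq>
      sets ?P"
    proof
      fix X assume "X \<in> sets (restrict_space borel T1H)"
      then obtain B where B: "B \<in> sets borel" "X = T1H \<inter> B" by (auto simp: sets_restrict_space)
      have "(\<lambda>p. (fst p, snd p)) \<in> ?P \<rightarrow>\<^sub>M borel \<Otimes>\<^sub>M borel"
        by (intro measurable_Pair measurable_compose[OF measurable_fst] measurable_compose[OF measurable_snd])
          (auto intro: measurable_restrict_space1)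
      then have "(\<lambda>p. p) -` B \<inter> space ?P \<in> sets ?P"
        using B(1) by (intro measurable_sets[where A = borel]) (simp_all add: borel_prod)
      moreover have "(\<lambda>p. p) -` B \<inter> space ?P = X"
        unfolding B by (auto simp: space_pair_measure space_restrict_space T1H_def)
      ultimately show "X \<in> sets ?P" by simp
    qed
  qed
  finally show ?thesis .
qed

lemma space_liouville: "space liouville = T1H"
  using sets_eq_imp_space_eq[OF sets_liouville] by (simp add: space_restrict_space)

lemma borel_measurable_liouville:
  "F \<in> borel_measurable borel \<Longrightarrow> F \<in> borel_measurable liouville"
  using measurable_cong_sets[OF sets_liouville refl] measurable_restrict_space1 by blast

lemma open_upper_half_plane: "open upper_half_plane"
  unfolding upper_half_plane_def by (rule open_halfspace_Im_gt)

lemma nn_integral_liouville_polar: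
  fixes F :: "complex \<times> complex \<Rightarrow> ennreal"
  assumes F [measurable]: "F \<in> borel_measurable borel"
  shows "(\<integral>\<^sup>+p. F p \<partial>liouville) = (\<integral>\<^sup>+x. \<integral>\<^sup>+y. (\<integral>\<^sup>+\<theta>. F (Complex x y, cis \<theta>) * indicator {0..<2 * pi} \<theta> \<partial>lborel)
      * (ennreal (1 / y\<^sup>2) * indicator {0<..} y) \<partial>lborel \<partial>lborel)"
proof -
  have [measurable]: "cis \<in> borel_measurable borel" "upper_half_plane \<in> sets borel"
    "Im \<in> borel_measurable borel"
    using open_upper_half_plane by (auto intro!: borel_measurable_continuous_onI continuous_intros)
  define M2 where "M2 = distr (restrict_space lborel {0..<2*pi}) (restrict_space borel (sphere 0 1)) cis"
  have cis_M: "cis \<in> restrict_space lborel {0..<2*pi} \<rightarrow>\<^sub>M restrict_space borel (sphere 0 1)"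
    by (intro measurable_restrict_space2 measurable_restrict_space1) auto
  have "finite_measure (restrict_space lborel {0..<2*pi})"
    by (rule finite_measureI) (simp add: space_restrict_space emeasure_restrict_space)
  then interpret M2: finite_measure M2
    unfolding M2_def using cis_M by (rule finite_measure.finite_measure_distr)
  define M1 where "M1 = density (restrict_space lborel upper_half_plane) (\<lambda>z. ennreal (1 / (Im z)\<^sup>2))"
  have L: "liouville = M1 \<Otimes>\<^sub>M M2" unfolding liouville_def M1_def M2_def ..
  have F': "F \<in> borel_measurable (M1 \<Otimes>\<^sub>M M2)"
    using borel_measurable_liouville[OF F] unfolding L .
  have inner: "(\<integral>\<^sup>+w. F (z, w) \<partial>M2) = (\<integral>\<^sup>+\<theta>. F (z, cis \<theta>) * indicator {0..<2 * pi} \<theta> \<partial>lborel)" for z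
  proof -
    have "(\<lambda>w. F (z, w)) \<in> borel_measurable (restrict_space borel (sphere 0 1))"
      by (rule measurable_restrict_space1) measurable
    then show ?thesis
      unfolding M2_def using cis_M by (simp add: nn_integral_distr nn_integral_restrict_space)
  qed
  define I where "I z = (\<integral>\<^sup>+\<theta>. F (z, cis \<theta>) * indicator {0..<2 * pi} \<theta> \<partial>lborel)" for z
  have I [measurable]: "I \<in> borel_measurable borel"
    unfolding I_def by measurable
  have "(\<integral>\<^sup>+p. F p \<partial>liouville) = (\<integral>\<^sup>+z. \<integral>\<^sup>+w. F (z, w) \<partial>M2 \<partial>M1)"
    unfolding L by (rule M2.nn_integral_fst[OF F', symmetric])
  also have "\<dots> = (\<integral>\<^sup>+z. ennreal (1 / (Im z)\<^sup>2) * I z \<partial>restrict_space lborel upper_half_plane)"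
    unfolding inner I_def[symmetric] M1_def
    by (rule nn_integral_density) (auto intro!: measurable_restrict_space1)
  also have "\<dots> = (\<integral>\<^sup>+z. ennreal (1 / (Im z)\<^sup>2) * I z * indicator upper_half_plane z \<partial>lborel)"
    by (rule nn_integral_restrict_space) simp
  also have "\<dots> = (\<integral>\<^sup>+x. \<integral>\<^sup>+y. ennreal (1 / y\<^sup>2) * I (Complex x y) * indicator upper_half_plane (Complex x y) \<partial>lborel \<partial>lborel)"
    by (subst nn_integral_lborel_complex) simp_all
  also have "\<dots> = (\<integral>\<^sup>+x. \<integral>\<^sup>+y. I (Complex x y) * (ennreal (1 / y\<^sup>2) * indicator {0<..} y) \<partial>lborel \<partial>lborel)"
    by (intro nn_integral_cong) (auto simp: indicator_def upper_half_plane_def mult_ac)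
  finally show ?thesis unfolding I_def .
qed

lemma sets_half_plane [measurable]:
  "{v :: real \<times> real. snd v > 0} \<in> sets borel" "{v :: real \<times> real. snd v < 0} \<in> sets borel"
  by (intro borel_open open_Collect_less continuous_intros)+

text \<open>With \<open>k = 1 + t\<^sup>2\<close> and first column \<open>(r, s)\<close> the substitutions are \<open>\<theta> = 2 arctan t\<close>,
  \<open>y = 1/(s\<^sup>2 k)\<close> and \<open>x = r/s - t/(s\<^sup>2 k)\<close>. They contribute the factors \<open>2/k\<close>, \<open>2 s k\<close> and \<open>1/s\<close>,
  whose product is the constant \<open>4\<close>.\<close>

lemma nn_integral_liouville:
  fixes F :: "complex \<times> complex \<Rightarrow> ennreal"
  assumes F [measurable]: "F \<in> borel_measurable borel"
  shows "(\<integral>\<^sup>+p. F p \<partial>liouville)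
    = 4 * (\<integral>\<^sup>+t. \<integral>\<^sup>+v. F (horo v t) * indicator {v. snd v > 0} v \<partial>lborel \<partial>lborel)"
proof -
  define E where "E t = - cnj (Complex t 1) / Complex t 1" for t
  have [measurable]: "E \<in> borel_measurable borel" unfolding E_def by measurable
  define W where "W t = ennreal (2 / (1 + t\<^sup>2))" for t :: real
  have [measurable]: "W \<in> borel_measurable borel" unfolding W_def by measurable
  define c where "c y = ennreal (1 / y\<^sup>2) * indicator {0<..} y" for y :: real
  have [measurable]: "c \<in> borel_measurable borel" unfolding c_def by measurable
  have "(\<integral>\<^sup>+p. F p \<partial>liouville)
      = (\<integral>\<^sup>+x. \<integral>\<^sup>+y. (\<integral>\<^sup>+t. F (Complex x y, E t) * W t \<partial>lborel) * c y \<partial>lborel \<partial>lborel)"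
    unfolding nn_integral_liouville_polar[OF F] c_def W_def E_def
    by (subst nn_integral_circle) simp_all
  also have "\<dots> = (\<integral>\<^sup>+x. \<integral>\<^sup>+y. \<integral>\<^sup>+t. F (Complex x y, E t) * W t * c y \<partial>lborel \<partial>lborel \<partial>lborel)"
    by (simp add: nn_integral_multc)
  also have "\<dots> = (\<integral>\<^sup>+x. \<integral>\<^sup>+t. \<integral>\<^sup>+y. F (Complex x y, E t) * W t * c y \<partial>lborel \<partial>lborel \<partial>lborel)"
    by (subst lborel_pair.Fubini') simp_all
  also have "\<dots> = (\<integral>\<^sup>+t. \<integral>\<^sup>+x. \<integral>\<^sup>+y. F (Complex x y, E t) * W t * c y \<partial>lborel \<partial>lborel \<partial>lborel)"
    by (subst lborel_pair.Fubini') simp_all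
  also have "\<dots> = (\<integral>\<^sup>+t. \<integral>\<^sup>+y. \<integral>\<^sup>+x. F (Complex x y, E t) * W t * c y \<partial>lborel \<partial>lborel \<partial>lborel)"
    by (subst lborel_pair.Fubini') simp_all
  also have "\<dots> = (\<integral>\<^sup>+t. 4 * (\<integral>\<^sup>+v. F (horo v t) * indicator {v. snd v > 0} v \<partial>lborel) \<partial>lborel)"
  proof (rule nn_integral_cong)
    fix t :: real
    define k where "k = 1 + t\<^sup>2"
    have k: "k > 0" unfolding k_def by (smt (verit) zero_le_power2)
    define f where "f y = (\<integral>\<^sup>+x. F (Complex x y, E t) \<partial>lborel)" for y
    have [measurable]: "f \<in> borel_measurable borel" unfolding f_def by measurable
    have f_eq: "f (1 / (s\<^sup>2 * k)) = ennreal (1 / s) * (\<integral>\<^sup>+r. F (horo (r, s) t) \<partial>lborel)" if "s > 0" for s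
    proof -
      have "f (1 / (s\<^sup>2 * k)) = ennreal \<bar>1 / s\<bar> * (\<integral>\<^sup>+r. F (Complex (- t / (s\<^sup>2 * k) + 1 / s * r) (1 / (s\<^sup>2 * k)), E t) \<partial>lborel)"
        unfolding f_def using that by (subst nn_integral_real_affine[where c = "1 / s" and t = "- t / (s\<^sup>2 * k)"]) auto
      also have "(\<lambda>r. (Complex (- t / (s\<^sup>2 * k) + 1 / s * r) (1 / (s\<^sup>2 * k)), E t)) = (\<lambda>r. horo (r, s) t)"
        using that by (auto simp: horo_eq E_def k_def fun_eq_iff)
      finally show ?thesis using that by (simp add: fun_eq_iff)
    qed
    have "(\<integral>\<^sup>+x. F (Complex x y, E t) * W t * c y \<partial>lborel) = f y * W t * c y" for y
      unfolding f_def by (simp add: nn_integral_multc)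
    then have "(\<integral>\<^sup>+y. \<integral>\<^sup>+x. F (Complex x y, E t) * W t * c y \<partial>lborel \<partial>lborel)
       = (\<integral>\<^sup>+y. W t * (f y * ennreal (1 / y\<^sup>2) * indicator {0<..} y) \<partial>lborel)"
      by (simp add: c_def mult_ac)
    also have "\<dots> = W t * (\<integral>\<^sup>+y. f y * ennreal (1 / y\<^sup>2) * indicator {0<..} y \<partial>lborel)"
      by (rule nn_integral_cmult) simp
    also have "(\<integral>\<^sup>+y. f y * ennreal (1 / y\<^sup>2) * indicator {0<..} y \<partial>lborel)
      = (\<integral>\<^sup>+s. f (1 / (s\<^sup>2 * k)) * ennreal (1 / (1 / (s\<^sup>2 * k))\<^sup>2) * ennreal (2 / (s ^ 3 * k)) * indicator {0<..} s \<partial>lborel)"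
      by (rule nn_integral_inverse_square[OF _ k]) simp
    also have "\<dots> = (\<integral>\<^sup>+s. ennreal (2 * k) * (\<integral>\<^sup>+r. F (horo (r, s) t) * indicator {v. snd v > 0} (r, s) \<partial>lborel) \<partial>lborel)"
    proof (rule nn_integral_cong)
      fix s :: real
      show "f (1 / (s\<^sup>2 * k)) * ennreal (1 / (1 / (s\<^sup>2 * k))\<^sup>2) * ennreal (2 / (s ^ 3 * k)) * indicator {0<..} s
         = ennreal (2 * k) * (\<integral>\<^sup>+r. F (horo (r, s) t) * indicator {v. snd v > 0} (r, s) \<partial>lborel)"
      proof (cases "s > 0")
        case True
        have "f (1 / (s\<^sup>2 * k)) * ennreal (1 / (1 / (s\<^sup>2 * k))\<^sup>2) * ennreal (2 / (s ^ 3 * k))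
          = (\<integral>\<^sup>+r. F (horo (r, s) t) \<partial>lborel) * (ennreal (1 / s) * ennreal (1 / (1 / (s\<^sup>2 * k))\<^sup>2) * ennreal (2 / (s ^ 3 * k)))"
          unfolding f_eq[OF True] by (simp add: mult_ac)
        also have "ennreal (1 / s) * ennreal (1 / (1 / (s\<^sup>2 * k))\<^sup>2) * ennreal (2 / (s ^ 3 * k)) = ennreal (2 * k)"
          using True k by (simp add: ennreal_mult'[symmetric] field_simps power2_eq_square power3_eq_cube)
        finally show ?thesis using True by (simp add: mult_ac)
      qed simp
    qed
    also have "\<dots> = ennreal (2 * k) * (\<integral>\<^sup>+s. \<integral>\<^sup>+r. F (horo (r, s) t) * indicator {v. snd v > 0} (r, s) \<partial>lborel \<partial>lborel)"
      by (rule nn_integral_cmult) simp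
    also have "(\<integral>\<^sup>+s. \<integral>\<^sup>+r. F (horo (r, s) t) * indicator {v. snd v > 0} (r, s) \<partial>lborel \<partial>lborel)
      = (\<integral>\<^sup>+v. F (horo v t) * indicator {v. snd v > 0} v \<partial>lborel)"
      by (subst lborel_pair.nn_integral_snd) (simp_all add: lborel_prod)
    also have "W t * (ennreal (2 * k) * \<dots>) = 4 * \<dots>"
    proof -
      have "W t * ennreal (2 * k) = ennreal 4"
        unfolding W_def k_def[symmetric] using k by (simp add: ennreal_mult'[symmetric])
      then show ?thesis by (simp add: mult.assoc[symmetric])
    qed
    finally show "(\<integral>\<^sup>+y. \<integral>\<^sup>+x. F (Complex x y, E t) * W t * c y \<partial>lborel \<partial>lborel)
      = 4 * (\<integral>\<^sup>+v. F (horo v t) * indicator {v. snd v > 0} v \<partial>lborel)" .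
  qed
  also have "\<dots> = 4 * (\<integral>\<^sup>+t. \<integral>\<^sup>+v. F (horo v t) * indicator {v. snd v > 0} v \<partial>lborel \<partial>lborel)"
    by (rule nn_integral_cmult) simp
  finally show ?thesis .
qed

lemma nn_integral_lborel_pair:
  fixes g :: "real \<times> real \<Rightarrow> ennreal"
  assumes "g \<in> borel_measurable borel"
  shows "(\<integral>\<^sup>+v. g v \<partial>lborel) = (\<integral>\<^sup>+s. \<integral>\<^sup>+r. g (r, s) \<partial>lborel \<partial>lborel)"
  using assms by (subst lborel_pair.nn_integral_snd) (simp_all add: lborel_prod)

text \<open>Tonelli and two one-dimensional affine substitutions, whose Jacobians cancel.\<close>

lemma nn_integral_SL2_linear:
  fixes g :: "real \<times> real \<Rightarrow> ennreal"
  assumes g [measurable]: "g \<in> borel_measurable borel" and det: "a * d - b * c = 1"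
  shows "(\<integral>\<^sup>+v. g (a * fst v + b * snd v, c * fst v + d * snd v) \<partial>lborel) = (\<integral>\<^sup>+v. g v \<partial>lborel)"
proof -
  have [measurable]: "(\<lambda>v. g (a * fst v + b * snd v, c * fst v + d * snd v)) \<in> borel_measurable borel"
    unfolding borel_prod[symmetric] by measurable
  have "(\<integral>\<^sup>+v. g (a * fst v + b * snd v, c * fst v + d * snd v) \<partial>lborel)
     = (\<integral>\<^sup>+s. \<integral>\<^sup>+r. g (a * r + b * s, c * r + d * s) \<partial>lborel \<partial>lborel)"
    by (subst nn_integral_lborel_pair) simp_all
  also have "\<dots> = (\<integral>\<^sup>+s. \<integral>\<^sup>+r. g (r, s) \<partial>lborel \<partial>lborel)"
  proof (cases "c = 0")
    case False
    have e1: "a * (- d * s / c + 1 / c * r) + b * s = (a * r - s) / c" for r s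
    proof -
      have "a * (- d * s / c + 1 / c * r) + b * s = (a * r - (a * d - b * c) * s) / c"
        using False by (simp add: field_simps)
      then show ?thesis using det by simp
    qed
    have e2: "c * (- d * s / c + 1 / c * r) + d * s = r" for r s
      using False by (simp add: field_simps)
    have "(\<integral>\<^sup>+r. g (a * r + b * s, c * r + d * s) \<partial>lborel)
       = ennreal \<bar>1 / c\<bar> * (\<integral>\<^sup>+r. g ((a * r - s) / c, r) \<partial>lborel)" for s
      using False e1 e2 by (subst nn_integral_real_affine[where c = "1 / c" and t = "- d * s / c"]) simp_all
    then have "(\<integral>\<^sup>+s. \<integral>\<^sup>+r. g (a * r + b * s, c * r + d * s) \<partial>lborel \<partial>lborel)
       = (\<integral>\<^sup>+s. \<integral>\<^sup>+r. ennreal \<bar>1 / c\<bar> * g ((a * r - s) / c, r) \<partial>lborel \<partial>lborel)"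
      by (simp add: nn_integral_cmult)
    also have "\<dots> = (\<integral>\<^sup>+r. \<integral>\<^sup>+s. ennreal \<bar>1 / c\<bar> * g ((a * r - s) / c, r) \<partial>lborel \<partial>lborel)"
      by (rule lborel_pair.Fubini') simp
    also have "\<dots> = (\<integral>\<^sup>+r. \<integral>\<^sup>+s. g (s, r) \<partial>lborel \<partial>lborel)"
    proof (rule nn_integral_cong)
      fix r
      have "(\<integral>\<^sup>+s. ennreal \<bar>1 / c\<bar> * g ((a * r - s) / c, r) \<partial>lborel)
        = ennreal \<bar>- c\<bar> * (\<integral>\<^sup>+s. ennreal \<bar>1 / c\<bar> * g ((a * r - (a * r + (- c) * s)) / c, r) \<partial>lborel)"
        using False by (subst nn_integral_real_affine[where c = "- c" and t = "a * r"]) simp_all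
      also have "\<dots> = ennreal \<bar>- c\<bar> * (ennreal \<bar>1 / c\<bar> * (\<integral>\<^sup>+s. g (s, r) \<partial>lborel))"
        using False by (simp add: nn_integral_cmult)
      also have "\<dots> = (\<integral>\<^sup>+s. g (s, r) \<partial>lborel)"
        using False by (simp add: mult.assoc[symmetric] ennreal_mult'[symmetric])
      finally show "(\<integral>\<^sup>+s. ennreal \<bar>1 / c\<bar> * g ((a * r - s) / c, r) \<partial>lborel) = (\<integral>\<^sup>+s. g (s, r) \<partial>lborel)" .
    qed
    finally show ?thesis .
  next
    case True
    then have ad: "a * d = 1" "a \<noteq> 0" "d \<noteq> 0" using det by auto
    have "(\<integral>\<^sup>+r. g (a * r + b * s, c * r + d * s) \<partial>lborel)
       = ennreal \<bar>1 / a\<bar> * (\<integral>\<^sup>+r. g (r, d * s) \<partial>lborel)" for s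
      using True ad by (subst nn_integral_real_affine[where c = "1 / a" and t = "- b * s / a"])
        (simp_all add: field_simps)
    then have "(\<integral>\<^sup>+s. \<integral>\<^sup>+r. g (a * r + b * s, c * r + d * s) \<partial>lborel \<partial>lborel)
       = ennreal \<bar>1 / a\<bar> * (\<integral>\<^sup>+s. \<integral>\<^sup>+r. g (r, d * s) \<partial>lborel \<partial>lborel)"
      by (simp add: nn_integral_cmult)
    also have "(\<integral>\<^sup>+s. \<integral>\<^sup>+r. g (r, d * s) \<partial>lborel \<partial>lborel)
       = ennreal \<bar>1 / d\<bar> * (\<integral>\<^sup>+s. \<integral>\<^sup>+r. g (r, s) \<partial>lborel \<partial>lborel)"
      using ad by (subst nn_integral_real_affine[where c = "1 / d" and t = 0]) simp_all
    also have "ennreal \<bar>1 / a\<bar> * \<dots> = (\<integral>\<^sup>+s. \<integral>\<^sup>+r. g (r, s) \<partial>lborel \<partial>lborel)"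
    proof -
      have "\<bar>1 / a\<bar> * \<bar>1 / d\<bar> = 1" using ad by (simp add: abs_mult[symmetric])
      then have "ennreal \<bar>1 / a\<bar> * ennreal \<bar>1 / d\<bar> = 1" by (simp add: ennreal_mult'[symmetric])
      then show ?thesis by (simp add: mult.assoc[symmetric])
    qed
    finally show ?thesis .
  qed
  also have "\<dots> = (\<integral>\<^sup>+v. g v \<partial>lborel)"
    by (subst nn_integral_lborel_pair) simp_all
  finally show ?thesis .
qed

lemma AE_lborel_line:
  assumes "c \<noteq> 0 \<or> d \<noteq> 0"
  shows "AE v in lborel :: (real \<times> real) measure. c * fst v + d * snd v \<noteq> 0"
proof -
  let ?H = "{v :: real \<times> real. (c, d) \<bullet> v = 0}"
  have "negligible ?H" using assms by (intro negligible_hyperplane) (auto simp: zero_prod_def)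
  moreover have "?H \<in> sets lborel" by (simp add: borel_closed closed_hyperplane)
  ultimately have "?H \<in> null_sets lborel"
    by (simp add: negligible_iff_null_sets null_sets_completion_iff)
  from AE_not_in[OF this] show ?thesis by eventually_elim (simp add: inner_prod_def)
qed

lemma AE_lborel_snd: "AE v in lborel :: (real \<times> real) measure. snd v \<noteq> 0"
  using AE_lborel_line[of 0 1] by simp

text \<open>The columns \<open>v\<close> and \<open>- v\<close> give the same frame, so each half-plane carries the same integral.\<close>

lemma nn_integral_liouville_full:
  fixes F :: "complex \<times> complex \<Rightarrow> ennreal"
  assumes F [measurable]: "F \<in> borel_measurable borel"
  shows "(\<integral>\<^sup>+p. F p \<partial>liouville) = 2 * (\<integral>\<^sup>+v. \<integral>\<^sup>+t. F (horo v t) \<partial>lborel \<partial>lborel)"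
proof -
  define G where "G v = (\<integral>\<^sup>+t. F (horo v t) \<partial>lborel)" for v
  have G [measurable]: "G \<in> borel_measurable borel" unfolding G_def by measurable
  have sym: "G (- v) = G v" for v unfolding G_def by (simp only: horo_minus)
  have "(\<integral>\<^sup>+v. G v * indicator {v. snd v > 0} v \<partial>lborel) = (\<integral>\<^sup>+v. G (- v) * indicator {v. snd v > 0} (- v) \<partial>lborel)"
    using nn_integral_SL2_linear[of "\<lambda>v. G v * indicator {v. snd v > 0} v" "-1" "-1" 0 0]
    by (simp add: uminus_prod_def)
  also have "\<dots> = (\<integral>\<^sup>+v. G v * indicator {v. snd v < 0} v \<partial>lborel)"
    unfolding sym by (intro nn_integral_cong) (auto simp: indicator_def)
  finally have halves: "(\<integral>\<^sup>+v. G v * indicator {v. snd v < 0} v \<partial>lborel) = (\<integral>\<^sup>+v. G v * indicator {v. snd v > 0} v \<partial>lborel)" ..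
  have "(\<integral>\<^sup>+p. F p \<partial>liouville) = 4 * (\<integral>\<^sup>+v. \<integral>\<^sup>+t. F (horo v t) * indicator {v. snd v > 0} v \<partial>lborel \<partial>lborel)"
    unfolding nn_integral_liouville[OF F] by (subst lborel_pair.Fubini') simp_all
  also have "\<dots> = 4 * (\<integral>\<^sup>+v. G v * indicator {v. snd v > 0} v \<partial>lborel)"
    unfolding G_def by (simp add: nn_integral_multc)
  also have "\<dots> = 2 * ((\<integral>\<^sup>+v. G v * indicator {v. snd v > 0} v \<partial>lborel) + (\<integral>\<^sup>+v. G v * indicator {v. snd v > 0} v \<partial>lborel))"
    by (simp add: mult_2[symmetric] mult.assoc[symmetric])
  also have "\<dots> = 2 * ((\<integral>\<^sup>+v. G v * indicator {v. snd v < 0} v \<partial>lborel) + (\<integral>\<^sup>+v. G v * indicator {v. snd v > 0} v \<partial>lborel))"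
    by (simp only: halves)
  also have "(\<integral>\<^sup>+v. G v * indicator {v. snd v < 0} v \<partial>lborel) + (\<integral>\<^sup>+v. G v * indicator {v. snd v > 0} v \<partial>lborel)
      = (\<integral>\<^sup>+v. G v * indicator {v. snd v < 0} v + G v * indicator {v. snd v > 0} v \<partial>lborel)"
    by (rule nn_integral_add[symmetric]) simp_all
  also have "\<dots> = (\<integral>\<^sup>+v. G v \<partial>lborel)"
  proof (rule nn_integral_cong_AE)
    show "AE v in lborel. G v * indicator {v. snd v < 0} v + G v * indicator {v. snd v > 0} v = G v"
      using AE_lborel_snd by eventually_elim (auto simp: indicator_def)
  qed
  finally show ?thesis unfolding G_def .
qed

text \<open>A formula for the action that is Borel on the whole of \<open>\<complex> \<times> \<complex>\<close>.\<close>

definition moebius_rat :: "real^2^2 \<Rightarrow> complex \<times> complex \<Rightarrow> complex \<times> complex" where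
  "moebius_rat A p =
    ((of_real (A$1$1) * fst p + of_real (A$1$2)) / (of_real (A$2$1) * fst p + of_real (A$2$2)),
     snd p * (cnj (of_real (A$2$1) * fst p + of_real (A$2$2)) / (of_real (A$2$1) * fst p + of_real (A$2$2))))"

lemma moebius_rat_eq:
  assumes "det A = 1" "p \<in> T1H"
  shows "moebius_act A p = moebius_rat A p"
proof -
  obtain z w where p: "p = (z, w)" by (cases p)
  have "Im z > 0" using assms by (simp add: p T1H_iff)
  moreover have "det (mat2 (A$1$1) (A$1$2) (A$2$1) (A$2$2)) = 1" using assms by (simp add: mat2_collapse)
  ultimately show ?thesis
    using moebius_act_mat2[of "A$1$1" "A$1$2" "A$2$1" "A$2$2" z w]
    by (simp add: moebius_rat_def p mat2_collapse)
qed

lemma borel_measurable_moebius_rat [measurable]: "moebius_rat A \<in> borel_measurable borel"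
  unfolding moebius_rat_def[abs_def] borel_prod[symmetric] by measurable

text \<open>In the coordinates \<open>(v, t)\<close> an element of \<open>SL(2,\<real>)\<close> is a linear map of determinant \<open>1\<close> in \<open>v\<close>, and for fixed \<open>v\<close>
  a translation in \<open>t\<close>.\<close>

lemma nn_integral_liouville_invariant:
  fixes F :: "complex \<times> complex \<Rightarrow> ennreal"
  assumes F [measurable]: "F \<in> borel_measurable borel" and det: "det A = 1"
  shows "(\<integral>\<^sup>+p. F (moebius_act A p) \<partial>liouville) = (\<integral>\<^sup>+p. F p \<partial>liouville)"
proof -
  obtain a b c d where A: "A = mat2 a b c d" by (rule mat2_cases)
  have ad: "a * d - b * c = 1" using det unfolding A det_mat2 .
  define G where "G v = (\<integral>\<^sup>+t. F (horo v t) \<partial>lborel)" for v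
  have G [measurable]: "G \<in> borel_measurable borel" unfolding G_def by measurable
  have "(\<integral>\<^sup>+p. F (moebius_act A p) \<partial>liouville) = (\<integral>\<^sup>+p. F (moebius_rat A p) \<partial>liouville)"
    by (intro nn_integral_cong) (simp add: space_liouville moebius_rat_eq det)
  also have "\<dots> = 2 * (\<integral>\<^sup>+v. \<integral>\<^sup>+t. F (moebius_rat A (horo v t)) \<partial>lborel \<partial>lborel)"
    by (rule nn_integral_liouville_full) measurable
  also have "(\<integral>\<^sup>+v. \<integral>\<^sup>+t. F (moebius_rat A (horo v t)) \<partial>lborel \<partial>lborel)
     = (\<integral>\<^sup>+v. G (a * fst v + b * snd v, c * fst v + d * snd v) \<partial>lborel)"
  proof (rule nn_integral_cong_AE)
    have cd: "c \<noteq> 0 \<or> d \<noteq> 0" using ad by auto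
    show "AE v in lborel. (\<integral>\<^sup>+t. F (moebius_rat A (horo v t)) \<partial>lborel)
        = G (a * fst v + b * snd v, c * fst v + d * snd v)"
      using AE_lborel_line[OF cd] AE_lborel_snd
    proof eventually_elim
      case (elim v)
      obtain r s where v: "v = (r, s)" by (cases v)
      have rs: "c * r + d * s \<noteq> 0" "s \<noteq> 0" using elim by (auto simp: v)
      let ?k = "c / (s * (c * r + d * s))"
      have "moebius_rat A (horo v t) = horo (a * r + b * s, c * r + d * s) (- ?k + 1 * t)" for t
        using moebius_act_horo[of a b c d s r t] moebius_rat_eq[OF det horo_T1H[of v t]] det rs
        unfolding A v by simp
      then have "(\<integral>\<^sup>+t. F (moebius_rat A (horo v t)) \<partial>lborel)
          = (\<integral>\<^sup>+t. F (horo (a * r + b * s, c * r + d * s) (- ?k + 1 * t)) \<partial>lborel)" by simp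
      also have "\<dots> = G (a * r + b * s, c * r + d * s)"
        unfolding G_def by (subst (2) nn_integral_real_affine[where c = 1 and t = "- ?k"]) simp_all
      finally show ?case by (simp add: v)
    qed
  qed
  also have "\<dots> = (\<integral>\<^sup>+v. G v \<partial>lborel)"
    by (rule nn_integral_SL2_linear[OF G ad])
  also have "2 * \<dots> = (\<integral>\<^sup>+p. F p \<partial>liouville)"
    unfolding G_def by (rule nn_integral_liouville_full[OF F, symmetric])
  finally show ?thesis .
qed

lemma moebius_act_measurable:
  assumes "det A = 1"
  shows "moebius_act A \<in> liouville \<rightarrow>\<^sub>M liouville"
proof -
  have "moebius_rat A \<in> liouville \<rightarrow>\<^sub>M restrict_space borel T1H"
    using moebius_act_T1H[OF assms] moebius_rat_eq[OF assms]
    by (intro measurable_restrict_space2 borel_measurable_liouville)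
      (auto simp: space_liouville)
  then have "moebius_act A \<in> liouville \<rightarrow>\<^sub>M restrict_space borel T1H"
    by (subst measurable_cong[where g = "moebius_rat A"]) (auto simp: space_liouville moebius_rat_eq assms)
  then show ?thesis using measurable_cong_sets[OF refl sets_liouville] by blast
qed

lemma sets_liouville_iff: "B \<in> sets liouville \<longleftrightarrow> B \<in> sets borel \<and> B \<subseteq> T1H"
proof -
  have "T1H \<in> sets borel"
    unfolding T1H_def using open_upper_half_plane by (intro borel_Times) auto
  then show ?thesis unfolding sets_liouville by (auto simp: sets_restrict_space_iff)
qed

lemma emeasure_liouville_invariant:
  assumes A: "det A = 1" and B: "B \<in> sets liouville"
  shows "emeasure liouville {p \<in> T1H. moebius_act A p \<in> B} = emeasure liouville B"
proof -
  have [measurable]: "B \<in> sets borel" using B by (simp add: sets_liouville_iff)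
  have meas: "{p \<in> T1H. moebius_act A p \<in> B} \<in> sets liouville"
    using measurable_sets[OF moebius_act_measurable[OF A] B]
    by (simp add: vimage_def Int_def space_liouville conj_commute)
  have "emeasure liouville {p \<in> T1H. moebius_act A p \<in> B}
      = (\<integral>\<^sup>+p. indicator {p \<in> T1H. moebius_act A p \<in> B} p \<partial>liouville)"
    using meas by simp
  also have "\<dots> = (\<integral>\<^sup>+p. indicator B (moebius_act A p) \<partial>liouville)"
    by (intro nn_integral_cong) (auto simp: space_liouville indicator_def)
  also have "\<dots> = (\<integral>\<^sup>+p. indicator B p \<partial>liouville)"
    by (rule nn_integral_liouville_invariant[OF _ A]) simp
  finally show ?thesis using B by simp
qed

lemma open_fund_dom: "open fund_dom"
  unfolding fund_dom_def
  by (intro open_Collect_conj open_Collect_less continuous_intros)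

lemma emeasure_liouville_fund_dom:
  "emeasure liouville (fund_dom \<times> sphere 0 1) = ennreal (2 * pi\<^sup>2 / 3)"
proof -
  have D [measurable]: "fund_dom \<in> sets borel" using open_fund_dom by simp
  have DS [measurable]: "fund_dom \<times> (sphere 0 1 :: complex set) \<in> sets borel"
    by (intro borel_Times D borel_closed closed_sphere)
  have sub: "fund_dom \<times> sphere 0 1 \<in> sets liouville"
    unfolding sets_liouville_iff
    by (intro conjI DS) (auto simp: T1H_def fund_dom_def upper_half_plane_def)
  have inner: "(\<integral>\<^sup>+y. (\<integral>\<^sup>+\<theta>. indicator (fund_dom \<times> sphere 0 1) (Complex x y, cis \<theta>) * indicator {0..<2 * pi} \<theta> \<partial>lborel)
      * (ennreal (1 / y\<^sup>2) * indicator {0<..} y) \<partial>lborel)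
     = ennreal (2 * pi) * (ennreal (1 / sqrt (1 - x\<^sup>2)) * indicator {-1/2..1/2} x)"
    if x: "x \<noteq> 1 / 2" "x \<noteq> - 1 / 2" for x
  proof -
    have th: "(\<integral>\<^sup>+\<theta>. indicator (fund_dom \<times> sphere 0 1) (Complex x y, cis \<theta>) * indicator {0..<2 * pi} \<theta> \<partial>lborel)
       = indicator fund_dom (Complex x y) * ennreal (2 * pi)" for y
    proof -
      have "(\<integral>\<^sup>+\<theta>. indicator (fund_dom \<times> sphere 0 1) (Complex x y, cis \<theta>) * indicator {0..<2 * pi} \<theta> \<partial>lborel)
       = (\<integral>\<^sup>+\<theta>. indicator fund_dom (Complex x y) * indicator {0..<2 * pi} \<theta> \<partial>lborel)"
        by (intro nn_integral_cong) (auto simp: indicator_def)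
      then show ?thesis by (simp add: nn_integral_cmult)
    qed
    show ?thesis
    proof (cases "x \<in> {-1/2..1/2}")
      case False
      then have "Complex x y \<notin> fund_dom" for y by (auto simp: fund_dom_def)
      then show ?thesis unfolding th using False by simp
    next
      case True
      then have x2: "\<bar>x\<bar> < 1 / 2" using x by (auto simp: abs_if)
      then have "x\<^sup>2 < 1" by (simp add: abs_square_less_1)
      define q where "q = sqrt (1 - x\<^sup>2)"
      have q: "q > 0" using \<open>x\<^sup>2 < 1\<close> by (simp add: q_def)
      have mem: "Complex x y \<in> fund_dom \<longleftrightarrow> y > q" for y
      proof -
        have "cmod (Complex x y) > 1 \<longleftrightarrow> y\<^sup>2 > 1 - x\<^sup>2" by (auto simp: cmod_def)
        moreover have "y > 0 \<Longrightarrow> y\<^sup>2 > 1 - x\<^sup>2 \<longleftrightarrow> y > q"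
          unfolding q_def using real_sqrt_less_iff[of "1 - x\<^sup>2" "y\<^sup>2"] by simp
        ultimately show ?thesis using x2 q by (auto simp: fund_dom_def)
      qed
      have "(\<integral>\<^sup>+y. indicator fund_dom (Complex x y) * ennreal (2 * pi) * (ennreal (1 / y\<^sup>2) * indicator {0<..} y) \<partial>lborel)
        = (\<integral>\<^sup>+y. ennreal (2 * pi) * (ennreal (1 / y\<^sup>2) * indicator {q..} y) \<partial>lborel)"
        by (rule nn_integral_cong_AE, rule AE_mp[OF AE_lborel_singleton[of q]])
          (use q in \<open>auto simp: indicator_def mem\<close>)
      also have "\<dots> = ennreal (2 * pi) * (\<integral>\<^sup>+y. ennreal (1 / y\<^sup>2) * indicator {q..} y \<partial>lborel)"
        by (rule nn_integral_cmult) simp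
      also have "(\<integral>\<^sup>+y. ennreal (1 / y\<^sup>2) * indicator {q..} y \<partial>lborel) = ennreal (0 - (- 1 / q))"
      proof (rule nn_integral_FTC_atLeast)
        show "((\<lambda>y. - 1 / y) has_real_derivative 1 / y\<^sup>2) (at y)" if "q \<le> y" for y
          using that q by (auto intro!: derivative_eq_intros simp: power2_eq_square)
        have "((\<lambda>y. - inverse y) \<longlongrightarrow> - 0) (at_top :: real filter)"
          by (intro tendsto_minus tendsto_inverse_0_at_top filterlim_ident)
        then show "((\<lambda>y. - 1 / y) \<longlongrightarrow> 0) (at_top :: real filter)"
          by (simp add: inverse_eq_divide)
      qed simp_all
      finally show ?thesis unfolding th using True by (simp add: q_def)
    qed
  qed
  have "emeasure liouville (fund_dom \<times> sphere 0 1) = (\<integral>\<^sup>+p. indicator (fund_dom \<times> sphere 0 1) p \<partial>liouville)"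
    using sub by simp
  also have "\<dots> = (\<integral>\<^sup>+x. ennreal (2 * pi) * (ennreal (1 / sqrt (1 - x\<^sup>2)) * indicator {-1/2..1/2} x) \<partial>lborel)"
    by (subst nn_integral_liouville_polar, simp, rule nn_integral_cong_AE,
        rule AE_mp[OF AE_lborel_singleton[of "1/2"]], rule AE_mp[OF AE_lborel_singleton[of "-1/2"]])
      (use inner in auto)
  also have "\<dots> = ennreal (2 * pi) * (\<integral>\<^sup>+x. ennreal (1 / sqrt (1 - x\<^sup>2)) * indicator {-1/2..1/2} x \<partial>lborel)"
    by (rule nn_integral_cmult) simp
  also have "(\<integral>\<^sup>+x. ennreal (1 / sqrt (1 - x\<^sup>2)) * indicator {-1/2..1/2} x \<partial>lborel) = ennreal (arcsin (1/2) - arcsin (-1/2))"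
  proof (rule nn_integral_FTC_Icc)
    show "(arcsin has_real_derivative 1 / sqrt (1 - x\<^sup>2)) (at x)" if "x \<in> {-1/2..1/2}" for x
      using that DERIV_arcsin[of x] by (auto simp: inverse_eq_divide)
    show "0 \<le> 1 / sqrt (1 - x\<^sup>2)" if "x \<in> {-1/2..1/2}" for x :: real
      using that by (auto simp: abs_square_le_1 abs_le_iff)
  qed simp_all
  also have "arcsin (1/2) - arcsin (-1/2) = pi / 3"
  proof -
    have "arcsin (1/2) = pi / 6" using arcsin_sin[of "pi / 6"] by (simp add: sin_30)
    moreover have "arcsin (-1/2) = - (pi / 6)"
      using arcsin_sin[of "- (pi / 6)"] by (simp add: sin_30)
    ultimately show ?thesis by simp
  qed
  finally show ?thesis by (simp add: ennreal_mult'[symmetric] power2_eq_square)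
qed

text \<open>Meant for frames over the boundary of the fundamental domain, whose lines and circle a horizontal line meets in at most four points.\<close>

lemma liouville_null_cylinder:
  assumes N: "N \<in> sets borel" "N \<subseteq> T1H" and fin: "\<And>y. finite {x. Complex x y \<in> fst ` N}"
  shows "emeasure liouville N = 0"
proof -
  have [measurable]: "N \<in> sets borel" by (rule N)
  have [measurable]: "cis \<in> borel_measurable borel"
    by (intro borel_measurable_continuous_onI continuous_intros)
  define J where "J x y = (\<integral>\<^sup>+\<theta>. indicator N (Complex x y, cis \<theta>) * indicator {0..<2 * pi} \<theta> \<partial>lborel)
      * (ennreal (1 / y\<^sup>2) * indicator {0<..} y)" for x y
  have "emeasure liouville N = (\<integral>\<^sup>+p. indicator N p \<partial>liouville)"
    using N by (simp add: sets_liouville_iff)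
  also have "\<dots> = (\<integral>\<^sup>+x. \<integral>\<^sup>+y. J x y \<partial>lborel \<partial>lborel)"
    unfolding J_def by (rule nn_integral_liouville_polar) simp
  also have "\<dots> = (\<integral>\<^sup>+y. \<integral>\<^sup>+x. J x y \<partial>lborel \<partial>lborel)"
    by (rule lborel_pair.Fubini') (unfold J_def, measurable)
  also have "\<dots> = (\<integral>\<^sup>+y. 0 \<partial>(lborel :: real measure))"
  proof (rule nn_integral_cong)
    fix y :: real
    have "AE x in lborel. x \<notin> {x. Complex x y \<in> fst ` N}"
      using fin[of y] by (intro AE_not_in)
        (auto simp: null_sets_def emeasure_lborel_countable countable_finite borel_closed finite_imp_closed)
    then have "AE x in lborel. J x y = 0"
    proof eventually_elim
      case (elim x)
      then have "(Complex x y, cis \<theta>) \<notin> N" for \<theta> by (force simp: image_iff)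
      then show ?case by (simp add: J_def)
    qed
    then show "(\<integral>\<^sup>+x. J x y \<partial>lborel) = 0"
      by (subst nn_integral_cong_AE[where v = "\<lambda>_. 0"]) simp_all
  qed
  finally show ?thesis by simp
qed

section \<open>The quotient and its Haar measure\<close>

lemma space_borel_of [simp]: "space (borel_of X) = topspace X"
  unfolding borel_of_def by (rule space_measure_of) (auto dest: openin_subset)

lemma sets_borel_of: "sets (borel_of X) = sigma_sets (topspace X) {U. openin X U}"
  unfolding borel_of_def by (rule sets_measure_of) (auto dest: openin_subset)

lemma openin_borel_of: "openin X U \<Longrightarrow> U \<in> sets (borel_of X)"
  unfolding sets_borel_of by (rule sigma_sets.Basic) simp

lemma continuous_map_measurable:
  assumes "continuous_map X Y f"
  shows "f \<in> borel_of X \<rightarrow>\<^sub>M borel_of Y"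
  unfolding borel_of_def[of Y]
proof (rule measurable_measure_of)
  show "f \<in> space (borel_of X) \<rightarrow> topspace Y"
    using assms by (auto simp: continuous_map_def)
  fix U assume "U \<in> {U. openin Y U}"
  then have "openin X {x \<in> topspace X. f x \<in> U}"
    using assms by (auto simp: continuous_map_def)
  moreover have "f -` U \<inter> space (borel_of X) = {x \<in> topspace X. f x \<in> U}" by auto
  ultimately show "f -` U \<inter> space (borel_of X) \<in> sets (borel_of X)"
    by (simp add: openin_borel_of)
qed (auto dest: openin_subset)

lemma continuous_map_borel_measurable:
  assumes "continuous_map X euclideanreal f"
  shows "f \<in> borel_measurable (borel_of X)"
proof -
  have "sets (borel_of euclideanreal) = sets borel"
    unfolding sets_borel_of by (simp add: borel_def)
  then show ?thesis
    using continuous_map_measurable[OF assms] measurable_cong_sets[OF refl] by blast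
qed

lemma topspace_M_top: "topspace M_top = proj_M ` T1H"
  by (simp add: M_top_def)

lemma openin_M_top:
  "openin M_top U \<longleftrightarrow> U \<subseteq> proj_M ` T1H \<and> openin (top_of_set T1H) {p \<in> T1H. proj_M p \<in> U}"
  by (simp add: M_top_def openin_quotient_topology)

lemma continuous_on_moebius_act:
  assumes det: "det A = 1"
  shows "continuous_on T1H (moebius_act A)"
proof -
  have nz: "of_real (A$2$1) * fst p + of_real (A$2$2) \<noteq> (0::complex)" if "p \<in> T1H" for p
    using denominator_nonzero[of "A$1$1" "A$1$2" "A$2$1" "A$2$2" "fst p"] that det
    by (cases p) (simp add: mat2_collapse T1H_iff)
  have "continuous_on T1H (moebius_rat A)"
    unfolding moebius_rat_def using nz by (intro continuous_intros) auto
  then show ?thesis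
    by (rule continuous_on_eq) (simp add: moebius_rat_eq det)
qed

lemma continuous_map_proj_M: "continuous_map (top_of_set T1H) M_top proj_M"
  using quotient_imp_continuous_map quotient_map_quotient_topology unfolding M_top_def by blast

lemma open_map_proj_M:
  assumes "openin (top_of_set T1H) V"
  shows "openin M_top (proj_M ` V)"
proof -
  have VT: "V \<subseteq> T1H" using assms openin_subset by fastforce
  have "{p \<in> T1H. proj_M p \<in> proj_M ` V} = (\<Union>A\<in>SL2Z. T1H \<inter> moebius_act A -` V)"
  proof (intro equalityI subsetI)
    fix p assume p: "p \<in> {p \<in> T1H. proj_M p \<in> proj_M ` V}"
    then obtain q where "q \<in> V" "proj_M p = proj_M q" by auto
    then show "p \<in> (\<Union>A\<in>SL2Z. T1H \<inter> moebius_act A -` V)"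
      using p proj_M_eq_iff[of p q] by auto
  next
    fix p assume "p \<in> (\<Union>A\<in>SL2Z. T1H \<inter> moebius_act A -` V)"
    then obtain A where "A \<in> SL2Z" "p \<in> T1H" "moebius_act A p \<in> V" by auto
    then show "p \<in> {p \<in> T1H. proj_M p \<in> proj_M ` V}"
      using proj_M_eq_iff[of p "moebius_act A p"] by auto
  qed
  moreover have "openin (top_of_set T1H) (T1H \<inter> moebius_act A -` V)" if "A \<in> SL2Z" for A
  proof -
    have "continuous_map (top_of_set T1H) (top_of_set T1H) (moebius_act A)"
      using continuous_on_moebius_act[OF det_SL2Z[OF that]] moebius_act_T1H[OF det_SL2Z[OF that]]
      by (auto simp: continuous_map_iff_continuous2)
    then have "openin (top_of_set T1H) {p \<in> T1H. moebius_act A p \<in> V}"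
      using assms by (auto simp: continuous_map_def)
    moreover have "{p \<in> T1H. moebius_act A p \<in> V} = T1H \<inter> moebius_act A -` V" by auto
    ultimately show ?thesis by simp
  qed
  then have "openin (top_of_set T1H) (\<Union>A\<in>SL2Z. T1H \<inter> moebius_act A -` V)"
    by (intro openin_Union) auto
  ultimately show ?thesis
    unfolding openin_M_top using VT by (simp only: image_mono simp_thms)
qed

lemma inj_on_proj_M_free:
  assumes "\<And>A q. A \<in> SL2Z \<Longrightarrow> q \<in> U \<inter> T1H \<Longrightarrow> moebius_act A q \<in> U \<Longrightarrow> A \<in> pm_one"
  shows "inj_on proj_M (U \<inter> T1H)"
proof (rule inj_onI)
  fix p q assume p: "p \<in> U \<inter> T1H" and q: "q \<in> U \<inter> T1H" and eq: "proj_M p = proj_M q"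
  obtain A where A: "A \<in> SL2Z" "q = moebius_act A p"
    using eq p proj_M_eq_iff by blast
  then have "A \<in> pm_one" using assms p q by blast
  then show "p = q" using A moebius_act_pm_one by simp
qed

text \<open>Lindelof applied to the neighbourhoods of \<open>locally_free\<close>.\<close>

lemma countable_injective_cover:
  obtains \<U> where "countable \<U>" "T1H \<subseteq> \<Union>\<U>" "\<And>U. U \<in> \<U> \<Longrightarrow> open U"
    "\<And>U. U \<in> \<U> \<Longrightarrow> inj_on proj_M (U \<inter> T1H)"
proof -
  let ?F = "{U. open U \<and> inj_on proj_M (U \<inter> T1H)}"
  have sub: "T1H \<subseteq> \<Union>?F"
  proof
    fix p assume "p \<in> T1H"
    then show "p \<in> \<Union>?F"
    proof (rule locally_free)
      fix U assume U: "open U" "p \<in> U"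
        "\<And>A q. A \<in> SL2Z \<Longrightarrow> q \<in> U \<inter> T1H \<Longrightarrow> moebius_act A q \<in> U \<Longrightarrow> A \<in> pm_one"
      have "inj_on proj_M (U \<inter> T1H)" by (rule inj_on_proj_M_free) (rule U(3))
      then show ?thesis using U(1,2) by blast
    qed
  qed
  obtain \<U> where "\<U> \<subseteq> ?F" "countable \<U>" "\<Union>\<U> = \<Union>?F"
    by (rule Lindelof[of ?F]) auto
  then show thesis using sub by (intro that[of \<U>]) auto
qed

text \<open>On an open set where the projection is injective it commutes with complements, so the images of
  Borel subsets can be handled by induction over the \<open>\<sigma>\<close>-algebra.\<close>

lemma sets_proj_M_image:
  assumes B: "B \<in> sets liouville"
  shows "proj_M ` B \<in> sets (borel_of M_top)"
proof -
  have BT: "B \<in> sets borel" "B \<subseteq> T1H" using B by (auto simp: sets_liouville_iff)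
  obtain \<U> where \<U>: "countable \<U>" "T1H \<subseteq> \<Union>\<U>" "\<And>U. U \<in> \<U> \<Longrightarrow> open U"
    "\<And>U. U \<in> \<U> \<Longrightarrow> inj_on proj_M (U \<inter> T1H)" by (rule countable_injective_cover) blast
  have piece: "proj_M ` (U \<inter> T1H \<inter> C) \<in> sets (borel_of M_top)"
    if U: "U \<in> \<U>" and C: "C \<in> sigma_sets UNIV {S. open S}" for U C
    using C
  proof induction
    case (Basic S)
    then have "openin (top_of_set T1H) (U \<inter> T1H \<inter> S)"
      using \<U>(3)[OF U] by (auto simp: openin_open intro!: exI[of _ "U \<inter> S"])
    then show ?case using open_map_proj_M openin_borel_of by blast
  next
    case Empty
    then show ?case by simp
  next
    case (Compl S)
    have "proj_M ` (U \<inter> T1H \<inter> (UNIV - S)) = proj_M ` (U \<inter> T1H) - proj_M ` (U \<inter> T1H \<inter> S)"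
      using \<U>(4)[OF U] by (auto dest: inj_onD)
    moreover have "openin (top_of_set T1H) (U \<inter> T1H)"
      using \<U>(3)[OF U] by (auto simp: openin_open)
    then have "proj_M ` (U \<inter> T1H) \<in> sets (borel_of M_top)"
      using open_map_proj_M openin_borel_of by blast
    ultimately show ?case using Compl by simp
  next
    case (Union S)
    have "proj_M ` (U \<inter> T1H \<inter> \<Union>(range S)) = (\<Union>i. proj_M ` (U \<inter> T1H \<inter> S i))" by auto
    then show ?case using Union by auto
  qed
  have "proj_M ` B = (\<Union>U\<in>\<U>. proj_M ` (U \<inter> T1H \<inter> B))"
    using \<U>(2) BT by blast
  moreover have "B \<in> sigma_sets UNIV {S. open S}" using BT by (simp add: borel_def)
  ultimately show ?thesis using piece \<U>(1) by (auto intro!: sets.countable_UN'')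
qed

lemma measurable_proj_M: "proj_M \<in> liouville \<rightarrow>\<^sub>M borel_of M_top"
  unfolding borel_of_def
proof (rule measurable_measure_of)
  fix U assume "U \<in> {U. openin M_top U}"
  then have "openin (top_of_set T1H) {p \<in> T1H. proj_M p \<in> U}" by (simp add: openin_M_top)
  then obtain S where S: "open S" "{p \<in> T1H. proj_M p \<in> U} = T1H \<inter> S"
    unfolding openin_open by blast
  moreover have "T1H \<inter> S \<in> sets (restrict_space borel T1H)"
    using S(1) by (auto simp: sets_restrict_space)
  moreover have "proj_M -` U \<inter> space liouville = {p \<in> T1H. proj_M p \<in> U}"
    by (auto simp: space_liouville)
  ultimately show "proj_M -` U \<inter> space liouville \<in> sets liouville"
    by (simp add: sets_liouville)
next
  show "{U. openin M_top U} \<subseteq> Pow (topspace M_top)" using openin_subset by blast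
  show "proj_M \<in> space liouville \<rightarrow> topspace M_top"
    unfolding space_liouville topspace_M_top by (rule funcsetI) (rule imageI)
qed

definition frame_dom :: "(complex \<times> complex) set" where
  "frame_dom = fund_dom \<times> sphere 0 1"

lemma frame_dom_T1H: "frame_dom \<subseteq> T1H"
  by (auto simp: frame_dom_def T1H_def fund_dom_def upper_half_plane_def)

lemma sets_frame_dom: "frame_dom \<in> sets liouville"
  unfolding sets_liouville_iff frame_dom_def
  using frame_dom_T1H open_fund_dom
  by (intro conjI borel_Times borel_open borel_closed) (auto simp: frame_dom_def)

lemma frame_dom_free:
  assumes "A \<in> SL2Z" "p \<in> frame_dom" "moebius_act A p \<in> frame_dom"
  shows "A \<in> pm_one"
  using assms fund_dom_free[of A "fst p" "snd p"] by (auto simp: frame_dom_def)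

lemma frame_dom_orbit_unique:
  assumes "p \<in> frame_dom" "q \<in> frame_dom" "proj_M p = proj_M q"
  shows "p = q"
proof -
  have "inj_on proj_M (frame_dom \<inter> T1H)"
    by (rule inj_on_proj_M_free) (blast intro: frame_dom_free)
  then show ?thesis using assms frame_dom_T1H by (auto dest: inj_onD)
qed

text \<open>One matrix out of each pair \<open>A\<close>, \<open>- A\<close>.\<close>

definition PSL_reps :: "(real^2^2) set" where
  "PSL_reps = {A \<in> SL2Z. A$2$1 > 0 \<or> (A$2$1 = 0 \<and> A$2$2 > 0)}"

lemma countable_PSL_reps: "countable PSL_reps"
  using countable_SL2Z by (rule countable_subset[rotated]) (auto simp: PSL_reps_def)

lemma moebius_act_minus:
  assumes "A \<in> SL2Z" "p \<in> T1H"
  shows "moebius_act (mat2 (-1) 0 0 (-1) ** A) p = moebius_act A p"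
proof -
  have "det (mat2 (-1) 0 0 (-1)) = 1" by (simp add: det_mat2)
  from moebius_act_mult[OF this det_SL2Z[OF assms(1)] assms(2)]
  show ?thesis using moebius_act_pm_one by (simp add: pm_one_def)
qed

lemma minus_one_mult: "mat2 (-1) 0 0 (-1) ** A = mat2 (- A$1$1) (- A$1$2) (- A$2$1) (- A$2$2)"
  using mat2_mult[of "-1" 0 0 "-1" "A$1$1" "A$1$2" "A$2$1" "A$2$2"] by (simp add: mat2_collapse)

lemma PSL_reps_exist:
  assumes "A \<in> SL2Z" "p \<in> T1H"
  obtains B where "B \<in> PSL_reps" "moebius_act B p = moebius_act A p"
proof (cases "A \<in> PSL_reps")
  case True then show ?thesis by (intro that) auto
next
  case False
  let ?B = "mat2 (-1) 0 0 (-1) ** A"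
  have B: "?B \<in> SL2Z" using mat2_in_SL2Z[of "-1" "-1" 0 0] assms SL2Z_mult by simp
  have "A$2$1 \<noteq> 0 \<or> A$2$2 \<noteq> 0" using det_SL2Z[OF assms(1)] by (auto simp: det_2)
  then have "?B \<in> PSL_reps" using B False assms(1) unfolding PSL_reps_def minus_one_mult by auto
  then show ?thesis using that moebius_act_minus assms by blast
qed

lemma PSL_reps_unique:
  assumes A: "A \<in> PSL_reps" and B: "B \<in> PSL_reps" and p: "p \<in> T1H"
    and eq: "moebius_act A p = moebius_act B p"
  shows "A = B"
proof -
  have SA: "A \<in> SL2Z" and SB: "B \<in> SL2Z" using A B by (auto simp: PSL_reps_def)
  obtain A' where A': "A' \<in> SL2Z" "A ** A' = mat 1" "A' ** A = mat 1" using SL2Z_inverse[OF SA] by metis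
  define q where "q = moebius_act A p"
  have q: "q \<in> T1H" unfolding q_def by (rule moebius_act_T1H[OF det_SL2Z[OF SA] p])
  have pq: "p = moebius_act A' q" unfolding q_def using moebius_act_cancel[OF SA A'(1,3) p] by simp
  have "moebius_act (B ** A') q = moebius_act B (moebius_act A' q)"
    by (rule moebius_act_mult[OF det_SL2Z[OF SB] det_SL2Z[OF A'(1)] q, symmetric])
  also have "\<dots> = q" unfolding pq[symmetric] eq[symmetric] q_def[symmetric] ..
  finally have "moebius_act (B ** A') q = q" .
  moreover obtain U where "q \<in> U"
    "\<And>A q. A \<in> SL2Z \<Longrightarrow> q \<in> U \<inter> T1H \<Longrightarrow> moebius_act A q \<in> U \<Longrightarrow> A \<in> pm_one"
    using locally_free[OF q] by metis
  ultimately have "B ** A' \<in> pm_one" using q SL2Z_mult[OF SB A'(1)] by simp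
  moreover have BA: "B = (B ** A') ** A" using A'(3) by (simp add: matrix_mul_assoc[symmetric])
  ultimately consider "B = mat2 1 0 0 1 ** A" | "B = mat2 (-1) 0 0 (-1) ** A"
    unfolding pm_one_def by auto
  then show ?thesis
  proof cases
    case 1
    then show ?thesis using mat2_mult[of 1 0 0 1 "A$1$1" "A$1$2" "A$2$1" "A$2$2"]
      by (simp add: mat2_collapse)
  next
    case 2
    then show ?thesis using A B by (auto simp: PSL_reps_def minus_one_mult)
  qed
qed

definition exceptional :: "(complex \<times> complex) set" where
  "exceptional = {p \<in> T1H. \<forall>A\<in>SL2Z. moebius_act A p \<notin> frame_dom}"

lemma sets_moebius_preimage:
  assumes "A \<in> SL2Z" "B \<in> sets liouville"
  shows "{p \<in> T1H. moebius_act A p \<in> B} \<in> sets liouville"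
  using measurable_sets[OF moebius_act_measurable[OF det_SL2Z[OF assms(1)]] assms(2)]
  by (simp add: vimage_def Int_def space_liouville conj_commute)

text \<open>Reduction theory moves each of these frames to one over the boundary of the fundamental domain.\<close>

lemma exceptional_null: "exceptional \<in> null_sets liouville"
proof -
  define N where "N = {p \<in> T1H. \<bar>Re (fst p)\<bar> = 1 / 2 \<or> cmod (fst p) = 1}"
  have T: "T1H \<in> sets borel" using sets.top[of liouville] by (simp add: space_liouville sets_liouville_iff)
  have "closed {p :: complex \<times> complex. \<bar>Re (fst p)\<bar> = 1 / 2 \<or> cmod (fst p) = 1}"
    by (intro closed_Collect_disj closed_Collect_eq continuous_intros)
  then have "T1H \<inter> {p. \<bar>Re (fst p)\<bar> = 1 / 2 \<or> cmod (fst p) = 1} \<in> sets borel" using T by auto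
  also have "T1H \<inter> {p. \<bar>Re (fst p)\<bar> = 1 / 2 \<or> cmod (fst p) = 1} = N" by (auto simp: N_def)
  finally have N: "N \<in> sets borel" .
  have "emeasure liouville N = 0"
  proof (rule liouville_null_cylinder[OF N])
    fix y :: real
    have "{x. Complex x y \<in> fst ` N} \<subseteq> {1/2, -1/2, sqrt (1 - y\<^sup>2), - sqrt (1 - y\<^sup>2)}"
    proof
      fix x assume "x \<in> {x. Complex x y \<in> fst ` N}"
      then have "\<bar>x\<bar> = 1 / 2 \<or> cmod (Complex x y) = 1" by (auto simp: N_def)
      then show "x \<in> {1/2, -1/2, sqrt (1 - y\<^sup>2), - sqrt (1 - y\<^sup>2)}"
      proof
        assume "cmod (Complex x y) = 1"
        then have "x\<^sup>2 = 1 - y\<^sup>2" by (simp add: cmod_def algebra_simps)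
        then have "sqrt (1 - y\<^sup>2) = \<bar>x\<bar>" by (metis real_sqrt_abs)
        then show ?thesis by (auto simp: abs_if split: if_splits)
      qed (auto simp: abs_if split: if_splits)
    qed
    then show "finite {x. Complex x y \<in> fst ` N}" by (rule finite_subset) simp
  qed (auto simp: N_def)
  moreover have NL: "N \<in> sets liouville" using N by (auto simp: sets_liouville_iff N_def)
  ultimately have null: "{p \<in> T1H. moebius_act A p \<in> N} \<in> null_sets liouville" if "A \<in> SL2Z" for A
    using that sets_moebius_preimage emeasure_liouville_invariant[OF det_SL2Z[OF that] NL]
    by (auto simp: null_sets_def)
  have "(\<Union>A\<in>SL2Z. {p \<in> T1H. moebius_act A p \<in> N}) \<in> null_sets liouville"
    by (rule null_sets_UN'[OF countable_SL2Z null])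
  moreover have "exceptional \<subseteq> (\<Union>A\<in>SL2Z. {p \<in> T1H. moebius_act A p \<in> N})"
  proof
    fix p assume p: "p \<in> exceptional"
    then have pT: "p \<in> T1H" by (simp add: exceptional_def)
    obtain A where A: "A \<in> SL2Z" "\<bar>Re (fst (moebius_act A p))\<bar> \<le> 1 / 2" "cmod (fst (moebius_act A p)) \<ge> 1"
      using reduction[OF pT] by metis
    have AT: "moebius_act A p \<in> T1H" using moebius_act_T1H[OF det_SL2Z[OF A(1)] pT] .
    have "moebius_act A p \<notin> frame_dom" using p A by (simp add: exceptional_def)
    then have "moebius_act A p \<in> N"
      using A AT unfolding N_def frame_dom_def fund_dom_def
      by (cases "moebius_act A p") (auto simp: T1H_iff)
    then show "p \<in> (\<Union>A\<in>SL2Z. {p \<in> T1H. moebius_act A p \<in> N})" using A pT by auto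
  qed
  moreover have "exceptional \<in> sets liouville"
  proof -
    have e: "exceptional = T1H - (\<Union>A\<in>SL2Z. {p \<in> T1H. moebius_act A p \<in> frame_dom})"
      by (auto simp: exceptional_def)
    have "T1H \<in> sets liouville" using sets.top[of liouville] by (simp add: space_liouville)
    then show ?thesis
      unfolding e by (intro sets.Diff sets.countable_UN'' countable_SL2Z sets_moebius_preimage sets_frame_dom)
  qed
  ultimately show ?thesis using null_sets_subset by blast
qed

text \<open>Cut \<open>B\<close> into the pieces \<open>E A\<close> that \<open>A\<close> moves into the domain. The pieces are disjoint as the domain is
  injective, their images \<open>F A\<close> are disjoint as \<open>B\<close> is, and corresponding pieces have the same measure.\<close>

lemma emeasure_liouville_transport:
  assumes B: "B \<in> sets liouville" and inj: "inj_on proj_M B"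
  shows "emeasure liouville {q \<in> frame_dom. proj_M q \<in> proj_M ` B} = emeasure liouville B"
proof -
  have BT: "B \<subseteq> T1H" using B by (simp add: sets_liouville_iff)
  define E where "E A = {p \<in> B. moebius_act A p \<in> frame_dom}" for A
  define F where "F A = {q \<in> frame_dom. \<exists>p\<in>B. q = moebius_act A p}" for A
  have EF: "E A = {p \<in> T1H. moebius_act A p \<in> F A}" if A: "A \<in> PSL_reps" for A
  proof (intro equalityI subsetI)
    fix p assume "p \<in> {p \<in> T1H. moebius_act A p \<in> F A}"
    then obtain p' where p: "p \<in> T1H" "moebius_act A p \<in> frame_dom" "p' \<in> B"
      "moebius_act A p = moebius_act A p'" by (auto simp: F_def)
    obtain A' where A': "A' \<in> SL2Z" "A' ** A = mat 1"
      using A SL2Z_inverse unfolding PSL_reps_def by blast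
    have SA: "A \<in> SL2Z" using A by (simp add: PSL_reps_def)
    have "p = moebius_act A' (moebius_act A p)"
      by (rule moebius_act_cancel[OF SA A' p(1), symmetric])
    also have "\<dots> = p'"
      unfolding p(4) by (rule moebius_act_cancel[OF SA A']) (use p BT in blast)
    finally have "p = p'" .
    then show "p \<in> E A" using p by (simp add: E_def)
  qed (use BT in \<open>auto simp: E_def F_def\<close>)
  have FE: "F A = {q \<in> T1H. moebius_act A' q \<in> E A}"
    if A: "A \<in> SL2Z" and A': "A' \<in> SL2Z" "A ** A' = mat 1" "A' ** A = mat 1" for A A'
  proof (intro equalityI subsetI)
    fix q assume "q \<in> F A"
    then obtain p where p: "q \<in> frame_dom" "p \<in> B" "q = moebius_act A p" by (auto simp: F_def)
    then show "q \<in> {q \<in> T1H. moebius_act A' q \<in> E A}"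
      using moebius_act_cancel[OF A A'(1,3)] BT frame_dom_T1H by (auto simp: E_def subset_eq)
  next
    fix q assume q: "q \<in> {q \<in> T1H. moebius_act A' q \<in> E A}"
    then have "q = moebius_act A (moebius_act A' q)"
      using moebius_act_cancel[OF A'(1) A A'(2)] by simp
    then show "q \<in> F A" using q by (auto simp: E_def F_def)
  qed
  have E_sets: "E A \<in> sets liouville" if "A \<in> PSL_reps" for A
  proof -
    have "E A = B \<inter> {p \<in> T1H. moebius_act A p \<in> frame_dom}" using BT by (auto simp: E_def)
    then show ?thesis using that B sets_moebius_preimage[OF _ sets_frame_dom]
      by (auto simp: PSL_reps_def)
  qed
  have F_sets: "F A \<in> sets liouville" if A: "A \<in> PSL_reps" for A
  proof -
    have SA: "A \<in> SL2Z" using A by (simp add: PSL_reps_def)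
    obtain A' where A': "A' \<in> SL2Z" "A ** A' = mat 1" "A' ** A = mat 1"
      using SL2Z_inverse[OF SA] by metis
    show ?thesis unfolding FE[OF SA A'] by (rule sets_moebius_preimage[OF A'(1) E_sets[OF A]])
  qed
  have same: "emeasure liouville (E A) = emeasure liouville (F A)" if A: "A \<in> PSL_reps" for A
    using emeasure_liouville_invariant[OF _ F_sets[OF A]] A det_SL2Z unfolding EF[OF A]
    by (simp add: PSL_reps_def)
  have equiv: "proj_M (moebius_act A p) = proj_M p" if "A \<in> PSL_reps" "p \<in> T1H" for A p
    using that proj_M_eq_iff[of p "moebius_act A p"] by (auto simp: PSL_reps_def)
  have disjE: "disjoint_family_on E PSL_reps"
  proof (unfold disjoint_family_on_def, intro ballI impI, rule ccontr)
    fix A A' assume AA: "A \<in> PSL_reps" "A' \<in> PSL_reps" "A \<noteq> A'" "E A \<inter> E A' \<noteq> {}"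
    then obtain p where p: "p \<in> B" "moebius_act A p \<in> frame_dom" "moebius_act A' p \<in> frame_dom"
      by (auto simp: E_def)
    have "moebius_act A p = moebius_act A' p"
      using p BT AA by (intro frame_dom_orbit_unique) (auto simp: equiv subset_eq)
    then show False using PSL_reps_unique[OF AA(1,2) subsetD[OF BT p(1)]] p AA(3) by simp
  qed
  have disjF: "disjoint_family_on F PSL_reps"
  proof (unfold disjoint_family_on_def, intro ballI impI, rule ccontr)
    fix A A' assume AA: "A \<in> PSL_reps" "A' \<in> PSL_reps" "A \<noteq> A'" "F A \<inter> F A' \<noteq> {}"
    then obtain q where "q \<in> F A" "q \<in> F A'" by blast
    then obtain p p' where pq: "p \<in> B" "p' \<in> B" "q = moebius_act A p" "q = moebius_act A' p'"
      unfolding F_def by blast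
    then have p: "p \<in> B" "p' \<in> B" "moebius_act A p = moebius_act A' p'" by simp_all
    have "proj_M p = proj_M p'" using p BT AA equiv by (metis subsetD)
    then have "p = p'" using inj p by (auto dest: inj_onD)
    then show False using PSL_reps_unique[OF AA(1,2) subsetD[OF BT p(1)]] p AA(3) by simp
  qed
  have UE: "(\<Union>A\<in>PSL_reps. E A) = B - exceptional"
  proof (intro equalityI subsetI)
    fix p assume "p \<in> (\<Union>A\<in>PSL_reps. E A)"
    then show "p \<in> B - exceptional" by (auto simp: E_def exceptional_def PSL_reps_def)
  next
    fix p assume p: "p \<in> B - exceptional"
    then obtain A where "A \<in> SL2Z" "moebius_act A p \<in> frame_dom" using BT by (auto simp: exceptional_def)
    then obtain A' where "A' \<in> PSL_reps" "moebius_act A' p \<in> frame_dom"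
      using PSL_reps_exist[of A p] p BT by (metis DiffD1 subsetD)
    then show "p \<in> (\<Union>A\<in>PSL_reps. E A)" using p by (auto simp: E_def)
  qed
  have UF: "(\<Union>A\<in>PSL_reps. F A) = {q \<in> frame_dom. proj_M q \<in> proj_M ` B}"
  proof (intro equalityI subsetI)
    fix q assume "q \<in> (\<Union>A\<in>PSL_reps. F A)"
    then show "q \<in> {q \<in> frame_dom. proj_M q \<in> proj_M ` B}" using equiv BT by (auto simp: F_def)
  next
    fix q assume "q \<in> {q \<in> frame_dom. proj_M q \<in> proj_M ` B}"
    then obtain p where p: "q \<in> frame_dom" "p \<in> B" "proj_M p = proj_M q" by auto
    then obtain A where "A \<in> SL2Z" "q = moebius_act A p" using proj_M_eq_iff[of p q] BT by auto
    then obtain A' where "A' \<in> PSL_reps" "q = moebius_act A' p"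
      using PSL_reps_exist[of A p] p BT by (metis subsetD)
    then show "q \<in> (\<Union>A\<in>PSL_reps. F A)" using p by (auto simp: F_def)
  qed
  have "emeasure liouville B = emeasure liouville (B - exceptional)"
    using B exceptional_null by (rule emeasure_Diff_null_set[symmetric, rotated])
  also have "\<dots> = (\<integral>\<^sup>+A. emeasure liouville (E A) \<partial>count_space PSL_reps)"
    unfolding UE[symmetric] by (rule emeasure_UN_countable[OF E_sets countable_PSL_reps disjE])
  also have "\<dots> = (\<integral>\<^sup>+A. emeasure liouville (F A) \<partial>count_space PSL_reps)"
    by (rule nn_integral_cong) (simp add: same)
  also have "\<dots> = emeasure liouville (\<Union>A\<in>PSL_reps. F A)"
    by (rule emeasure_UN_countable[OF F_sets countable_PSL_reps disjF, symmetric])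
  finally show ?thesis unfolding UF ..
qed

text \<open>Evaluates the definite description. A competing measure is determined on images of subsets of the
  domain, and the rest of the quotient is the image of the exceptional set, whose injective pieces are null.\<close>

lemma M_induced_eq: "M_induced = distr (restrict_space liouville frame_dom) (borel_of M_top) proj_M"
proof -
  let ?N = "distr (restrict_space liouville frame_dom) (borel_of M_top) proj_M"
  have FD: "frame_dom \<inter> space liouville \<in> sets liouville"
    using sets_frame_dom frame_dom_T1H by (simp add: space_liouville Int_absorb2)
  have space_FD: "space (restrict_space liouville frame_dom) = frame_dom"
    using frame_dom_T1H by (auto simp: space_restrict_space space_liouville)
  have em: "emeasure ?N X = emeasure liouville {q \<in> frame_dom. proj_M q \<in> X}"
    if "X \<in> sets (borel_of M_top)" for X
  proof -
    have "emeasure ?N X = emeasure (restrict_space liouville frame_dom) (proj_M -` X \<inter> frame_dom)"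
      using that measurable_restrict_space1[OF measurable_proj_M] by (simp add: emeasure_distr space_FD)
    also have "\<dots> = emeasure liouville (proj_M -` X \<inter> frame_dom)"
      by (rule emeasure_restrict_space[OF FD]) auto
    also have "proj_M -` X \<inter> frame_dom = {q \<in> frame_dom. proj_M q \<in> X}" by auto
    finally show ?thesis .
  qed
  show ?thesis
    unfolding M_induced_def
  proof (rule the_equality)
    show "space ?N = topspace M_top \<and> sets ?N = sets (borel_of M_top) \<and>
      (\<forall>B\<in>sets liouville. inj_on proj_M B \<longrightarrow> emeasure ?N (proj_M ` B) = emeasure liouville B)"
      by (simp add: em sets_proj_M_image emeasure_liouville_transport)
  next
    fix \<nu> assume "space \<nu> = topspace M_top \<and> sets \<nu> = sets (borel_of M_top) \<and>
      (\<forall>B\<in>sets liouville. inj_on proj_M B \<longrightarrow> emeasure \<nu> (proj_M ` B) = emeasure liouville B)"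
    then have \<nu>: "space \<nu> = topspace M_top" "sets \<nu> = sets (borel_of M_top)"
      "\<And>B. B \<in> sets liouville \<Longrightarrow> inj_on proj_M B \<Longrightarrow> emeasure \<nu> (proj_M ` B) = emeasure liouville B"
      by auto
    obtain \<U> where \<U>: "countable \<U>" "T1H \<subseteq> \<Union>\<U>" "\<And>U. U \<in> \<U> \<Longrightarrow> open U"
      "\<And>U. U \<in> \<U> \<Longrightarrow> inj_on proj_M (U \<inter> T1H)" by (rule countable_injective_cover) blast
    have exT: "exceptional \<subseteq> T1H" by (auto simp: exceptional_def)
    have piece: "proj_M ` (exceptional \<inter> U) \<in> null_sets \<nu>" if U: "U \<in> \<U>" for U
    proof -
      have s: "exceptional \<inter> U \<in> sets liouville"
        using exceptional_null \<U>(3)[OF U] by (auto simp: sets_liouville_iff null_sets_def)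
      have "inj_on proj_M (exceptional \<inter> U)"
        using \<U>(4)[OF U] by (rule inj_on_subset) (use exT in auto)
      then have "emeasure \<nu> (proj_M ` (exceptional \<inter> U)) = emeasure liouville (exceptional \<inter> U)"
        by (rule \<nu>(3)[OF s])
      also have "\<dots> = 0"
        using null_sets_subset[OF exceptional_null s] by auto
      finally show ?thesis using sets_proj_M_image[OF s] \<nu>(2) by (simp add: null_sets_def)
    qed
    have "(\<Union>U\<in>\<U>. proj_M ` (exceptional \<inter> U)) \<in> null_sets \<nu>"
      by (rule null_sets_UN'[OF \<U>(1) piece])
    also have "(\<Union>U\<in>\<U>. proj_M ` (exceptional \<inter> U)) = proj_M ` exceptional"
      using \<U>(2) exT by blast
    finally have null: "proj_M ` exceptional \<in> null_sets \<nu>" .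
    show "\<nu> = ?N"
    proof (rule measure_eqI)
      fix X assume "X \<in> sets \<nu>"
      then have X: "X \<in> sets (borel_of M_top)" using \<nu> by simp
      let ?F = "{q \<in> frame_dom. proj_M q \<in> X}"
      have Fs: "?F \<in> sets liouville"
      proof -
        have "frame_dom \<inter> (proj_M -` X \<inter> space liouville) \<in> sets liouville"
          using sets_frame_dom measurable_sets[OF measurable_proj_M X] by blast
        moreover have "frame_dom \<inter> (proj_M -` X \<inter> space liouville) = ?F"
          using frame_dom_T1H by (auto simp: space_liouville)
        ultimately show ?thesis by simp
      qed
      have inj: "inj_on proj_M ?F" by (rule inj_onI, rule frame_dom_orbit_unique) auto
      have FX: "proj_M ` ?F \<in> sets \<nu>" using sets_proj_M_image[OF Fs] \<nu> by simp
      have "X - proj_M ` exceptional = proj_M ` ?F - proj_M ` exceptional"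
      proof (intro equalityI subsetI)
        fix x assume x: "x \<in> X - proj_M ` exceptional"
        then have "x \<in> topspace M_top" using sets.sets_into_space[OF X] by auto
        then obtain p where p: "p \<in> T1H" "x = proj_M p" by (auto simp: topspace_M_top)
        then obtain A where A: "A \<in> SL2Z" "moebius_act A p \<in> frame_dom"
          using x by (auto simp: exceptional_def)
        have "proj_M p = proj_M (moebius_act A p)" using A p proj_M_eq_iff by blast
        then show "x \<in> proj_M ` ?F - proj_M ` exceptional" using x p A by auto
      qed auto
      then have "emeasure \<nu> X = emeasure \<nu> (proj_M ` ?F)"
        using emeasure_Diff_null_set[OF null] \<open>X \<in> sets \<nu>\<close> FX by metis
      then show "emeasure \<nu> X = emeasure ?N X"
        using em[OF X] \<nu>(3)[OF Fs inj] by simp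
    qed (simp add: \<nu>)
  qed
qed

lemma nn_integral_M_haar:
  assumes g: "g \<in> borel_measurable (borel_of M_top)"
  shows "(\<integral>\<^sup>+x. g x \<partial>M_haar)
    = (\<integral>\<^sup>+p. g (proj_M p) * indicator frame_dom p \<partial>liouville) / ennreal (2 * pi\<^sup>2 / 3)"
proof -
  have FD: "frame_dom \<inter> space liouville \<in> sets liouville"
    using sets_frame_dom frame_dom_T1H by (simp add: space_liouville Int_absorb2)
  have proj: "proj_M \<in> restrict_space liouville frame_dom \<rightarrow>\<^sub>M borel_of M_top"
    by (rule measurable_restrict_space1[OF measurable_proj_M])
  have space: "space M_induced = topspace M_top" by (simp add: M_induced_eq)
  have int: "(\<integral>\<^sup>+x. h x \<partial>M_induced) = (\<integral>\<^sup>+p. h (proj_M p) * indicator frame_dom p \<partial>liouville)"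
    if "h \<in> borel_measurable (borel_of M_top)" for h
    unfolding M_induced_eq using that proj
    by (simp add: nn_integral_distr nn_integral_restrict_space[OF FD])
  have top: "topspace M_top \<in> sets M_induced" using sets.top[of M_induced] by (simp add: space)
  have "emeasure M_induced (topspace M_top) = (\<integral>\<^sup>+x. 1 \<partial>M_induced)"
    by (simp add: space)
  also have "\<dots> = (\<integral>\<^sup>+p. 1 * indicator frame_dom p \<partial>liouville)"
    by (rule int) simp
  also have "\<dots> = emeasure liouville frame_dom"
    using sets_frame_dom by simp
  also have "\<dots> = ennreal (2 * pi\<^sup>2 / 3)"
    unfolding frame_dom_def by (rule emeasure_liouville_fund_dom)
  finally have total: "emeasure M_induced (topspace M_top) = ennreal (2 * pi\<^sup>2 / 3)" .
  have "g \<in> borel_measurable M_induced"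
    using g by (simp add: M_induced_eq)
  then have "(\<integral>\<^sup>+x. g x \<partial>M_haar)
     = (\<integral>\<^sup>+x. g x * indicator (topspace M_top) x \<partial>M_induced) / emeasure M_induced (topspace M_top)"
    unfolding M_haar_def using top by (rule nn_integral_uniform_measure)
  also have "(\<integral>\<^sup>+x. g x * indicator (topspace M_top) x \<partial>M_induced) = (\<integral>\<^sup>+x. g x \<partial>M_induced)"
    by (intro nn_integral_cong) (simp add: space)
  finally show ?thesis unfolding total int[OF g] .
qed

section \<open>Unfolding the closed horocycles\<close>

lemma borel_measurable_count_space_integral:
  fixes F :: "'i \<Rightarrow> 'a \<Rightarrow> ennreal"
  assumes I: "countable I" and F: "\<And>i. i \<in> I \<Longrightarrow> F i \<in> borel_measurable M"
  shows "(\<lambda>x. \<integral>\<^sup>+i. F i x \<partial>count_space I) \<in> borel_measurable M"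
proof -
  have "(\<lambda>(i, x). F i x) \<in> borel_measurable (count_space I \<Otimes>\<^sub>M M)"
    using F by (intro measurable_pair_measure_countable1[OF I]) simp
  then have "(\<lambda>(x, i). F i x) \<in> borel_measurable (M \<Otimes>\<^sub>M count_space I)"
    by (rule measurable_pair_swap[where f = "\<lambda>(i, x). F i x", simplified])
  then show ?thesis
    by (rule sigma_finite_measure.borel_measurable_nn_integral[OF sigma_finite_measure_count_space_countable[OF I]])
qed

text \<open>Bounds a sum over an orbit in which only one term can be nonzero.\<close>

lemma nn_integral_count_space_at_most_one:
  fixes g :: "'i \<Rightarrow> ennreal"
  assumes le: "\<And>i. g i \<le> c" and unique: "\<And>i j. g i \<noteq> 0 \<Longrightarrow> g j \<noteq> 0 \<Longrightarrow> i = j"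
  shows "(\<integral>\<^sup>+i. g i \<partial>count_space UNIV) \<le> c"
proof (cases "\<exists>i. g i \<noteq> 0")
  case True
  then obtain i where i: "g i \<noteq> 0" by blast
  have "(\<integral>\<^sup>+i. g i \<partial>count_space UNIV) = (\<Sum>j\<in>{i}. g j)"
    by (rule nn_integral_count_space') (use unique i in auto)
  then show ?thesis using le by simp
next
  case False
  then show ?thesis by simp
qed

text \<open>The unrolling of the circle \<open>\<real>/\<int>\<close>.\<close>

lemma nn_integral_tile:
  fixes H :: "real \<Rightarrow> ennreal"
  assumes [measurable]: "H \<in> borel_measurable borel"
  shows "(\<integral>\<^sup>+(k::int). \<integral>\<^sup>+x. H (x + of_int k) * indicator {0..<1} x \<partial>lborel \<partial>count_space UNIV)
    = (\<integral>\<^sup>+x. H x \<partial>lborel)"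
proof -
  have "(\<integral>\<^sup>+x. H (x + of_int k) * indicator {0..<1} x \<partial>lborel)
    = (\<integral>\<^sup>+x. H x * indicator {of_int k..<of_int k + 1} x \<partial>lborel)" for k :: int
    by (subst nn_integral_real_affine[where c = 1 and t = "- of_int k"])
      (auto intro!: nn_integral_cong simp: indicator_def)
  then have "(\<integral>\<^sup>+(k::int). \<integral>\<^sup>+x. H (x + of_int k) * indicator {0..<1} x \<partial>lborel \<partial>count_space UNIV)
    = (\<integral>\<^sup>+(k::int). \<integral>\<^sup>+x. H x * indicator {of_int k..<of_int k + 1} x \<partial>lborel \<partial>count_space UNIV)" by simp
  also have "\<dots> = (\<integral>\<^sup>+x. \<integral>\<^sup>+(k::int). H x * indicator {of_int k..<of_int k + 1} x \<partial>count_space UNIV \<partial>lborel)"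
    by (rule nn_integral_count_space_nn_integral[symmetric]) auto
  also have "\<dots> = (\<integral>\<^sup>+x. H x \<partial>lborel)"
  proof (rule nn_integral_cong)
    fix x :: real
    have mem: "x \<in> {of_int k..<of_int k + 1} \<longleftrightarrow> k = \<lfloor>x\<rfloor>" for k :: int
      by (auto simp: floor_eq_iff eq_commute[of k])
    have "(\<integral>\<^sup>+(k::int). H x * indicator {of_int k..<of_int k + 1} x \<partial>count_space UNIV)
       = (\<Sum>k\<in>{\<lfloor>x\<rfloor>}. H x * indicator {of_int k..<of_int k + 1} x)"
      by (rule nn_integral_count_space') (auto simp: indicator_def mem simp del: atLeastLessThan_iff)
    then show "(\<integral>\<^sup>+(k::int). H x * indicator {of_int k..<of_int k + 1} x \<partial>count_space UNIV) = H x"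
      by (simp add: indicator_def mem del: atLeastLessThan_iff)
  qed
  finally show ?thesis .
qed

text \<open>The frame \<open>((x, y), \<pi>)\<close> belongs to the matrix \<open>(\<surd>y, x/\<surd>y; 0, 1/\<surd>y)\<close>; multiplication from the left by a matrix
  with first column \<open>(a, c)\<close> produces the first column \<open>\<surd>y (a, c)\<close>. The remaining entry \<open>d\<close> only shifts
  the position on the horocycle.\<close>

lemma moebius_act_horocycle:
  assumes det: "det (mat2 a b c d) = 1" and c: "c > 0" and y: "y > 0"
  shows "moebius_act (mat2 a b c d) (Complex x y, -1) = horo (sqrt y * a, sqrt y * c) ((x + d / c) / y)"
proof -
  define u where "u = Complex (x + d / c) y"
  have u0: "u \<noteq> 0" using y by (simp add: u_def complex_eq_iff)
  have "Im (Complex x y) > 0" using y by simp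
  note act = moebius_act_mat2[OF det this, of "-1"]
  have ad: "a * d - b * c = 1" using det by (simp add: det_mat2)
  have den: "of_real c * Complex x y + of_real d = of_real c * u"
    using c by (simp add: u_def complex_eq_iff field_simps)
  have num: "of_real a * Complex x y + of_real b = of_real a * u - of_real (1 / c)"
  proof -
    have "b = a * (d / c) - 1 / c" using ad c by (simp add: field_simps)
    then show ?thesis by (simp add: u_def complex_eq_iff algebra_simps)
  qed
  have t: "Complex ((x + d / c) / y) 1 = u / of_real y"
    using y by (simp add: u_def complex_eq_iff Re_divide_of_real Im_divide_of_real)
  have sq: "(sqrt y * c)\<^sup>2 = y * c\<^sup>2" using y by (simp add: power_mult_distrib)
  have "(of_real a * u - of_real (1 / c)) / (of_real c * u)
      = of_real (a / c) - 1 / (of_real (y * c\<^sup>2) * (u / of_real y))"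
    using c y u0 by (simp add: field_simps power2_eq_square)
  moreover have "- (cnj (of_real c * u) / (of_real c * u)) = - cnj (u / of_real y) / (u / of_real y)"
    using c y u0 by (simp add: field_simps)
  moreover have "sqrt y * a / (sqrt y * c) = a / c" using y by simp
  ultimately show ?thesis
    unfolding act horo_def fst_conv snd_conv t sq den num by simp
qed

lemma borel_measurable_frame_dom_indicator:
  fixes f :: "complex \<times> complex \<Rightarrow> real"
  assumes "continuous_on T1H f"
  shows "(\<lambda>p. ennreal (f p) * indicator frame_dom p) \<in> borel_measurable borel"
  using sets_frame_dom continuous_on_subset[OF assms frame_dom_T1H]
  by (intro borel_measurable_ennreal_indicator) (simp_all add: sets_liouville_iff)

text \<open>At most one representative of \<open>PSL(2,\<int>)\<close> moves a frame into the fundamental domain, so the sum of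
  the cut-off function over any family of representatives is at most \<open>f\<close>. The family used consists
  of the matrices \<open>\<gamma> v k\<close> with first column \<open>v\<close>, where \<open>v\<close> is primitive with positive second
  entry. Changing \<open>k\<close> amounts to an integer translation of \<open>x\<close> before \<open>\<gamma> v 0\<close> is applied, so
  the sum over \<open>k\<close> turns the integral over \<open>[0, 1)\<close> into an integral over the real line.\<close>

lemma horocycle_unfolding:
  fixes f :: "complex \<times> complex \<Rightarrow> real"
  assumes inv: "\<And>A p. A \<in> SL2Z \<Longrightarrow> p \<in> T1H \<Longrightarrow> f (moebius_act A p) = f p"
    and cont: "continuous_on T1H f" and y: "y > 0"
  shows "(\<integral>\<^sup>+t. ennreal y * (\<integral>\<^sup>+v. ennreal (f (horo (scaled (sqrt y) v) t))
        * indicator {w. snd w > 0 \<and> horo w t \<in> frame_dom} (scaled (sqrt y) v) \<partial>count_space primitive) \<partial>lborel)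
    \<le> (\<integral>\<^sup>+x. ennreal (f (Complex x y, -1)) * indicator {0..1} x \<partial>lborel)"
    (is "(\<integral>\<^sup>+t. ennreal y * ?W t \<partial>lborel) \<le> _")
proof -
  define F where "F p = ennreal (f p) * indicator frame_dom p" for p
  have [measurable]: "F \<in> borel_measurable borel"
    unfolding F_def by (rule borel_measurable_frame_dom_indicator[OF cont])
  define P where "P = {v \<in> primitive. snd v > 0}"
  have "\<exists>b d. fst v * d - b * snd v = 1" if "v \<in> P" for v
  proof -
    obtain d b where "d * fst v + b * snd v = 1"
      using bezout_int[of "fst v" "snd v"] \<open>v \<in> P\<close> by (auto simp: P_def primitive_def)
    then show ?thesis by (intro exI[of _ "- b"] exI[of _ d]) (simp add: mult.commute)
  qed
  then obtain b d where bd: "\<And>v. v \<in> P \<Longrightarrow> fst v * d v - b v * snd v = 1" by metis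
  define \<gamma> where "\<gamma> v k = mat2 (of_int (fst v)) (of_int (b v + k * fst v)) (of_int (snd v)) (of_int (d v + k * snd v))"
    for v and k :: int
  have \<gamma>: "\<gamma> v k \<in> PSL_reps" if "v \<in> P" for v k
  proof -
    have "fst v * (d v + k * snd v) - (b v + k * fst v) * snd v = 1"
      using bd[OF that] by (simp add: algebra_simps)
    from mat2_in_SL2Z[OF this] show ?thesis
      using that by (simp add: PSL_reps_def \<gamma>_def P_def)
  qed
  then have \<gamma>SL: "\<gamma> v k \<in> SL2Z" if "v \<in> P" for v k using that by (auto simp: PSL_reps_def)
  have \<gamma>_inj: "v = v' \<and> k = k'" if "\<gamma> v k = \<gamma> v' k'" "v \<in> P" for v v' k k'
  proof -
    have "fst v = fst v'" "snd v = snd v'" "d v + k * snd v = d v' + k' * snd v'"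
      using that(1) unfolding \<gamma>_def mat2_eq_iff of_int_eq_iff by auto
    moreover then have "v = v'" by (simp add: prod_eq_iff)
    ultimately show ?thesis using that(2) by (simp add: P_def)
  qed
  define p where "p x = (Complex x y, - 1 :: complex)" for x
  have pT: "p x \<in> T1H" for x using y by (simp add: p_def T1H_iff)
  define Q where "Q v t = F (horo (scaled (sqrt y) v) t)" for v t
  have [measurable]: "Q v \<in> borel_measurable borel" for v unfolding Q_def by measurable
  have Q: "F (moebius_act (\<gamma> v k) (p x)) = Q v ((x + of_int k + of_int (d v) / of_int (snd v)) / y)" if v: "v \<in> P" for v k x
  proof -
    have "det (\<gamma> v k) = 1" using \<gamma>SL[OF v] det_SL2Z by blast
    then have "moebius_act (\<gamma> v k) (p x) = horo (scaled (sqrt y) v) ((x + of_int (d v + k * snd v) / of_int (snd v)) / y)"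
      unfolding \<gamma>_def p_def scaled_def using v y
      by (subst moebius_act_horocycle) (simp_all add: P_def)
    moreover have "real_of_int (d v + k * snd v) / of_int (snd v) = of_int k + of_int (d v) / of_int (snd v)"
      using v by (simp add: P_def field_simps)
    ultimately show ?thesis by (simp add: Q_def add.assoc)
  qed
  define g where "g v k x = F (moebius_act (\<gamma> v k) (p x)) * indicator P v" for v k x
  have g_eq: "g v k x = Q v ((x + of_int k + of_int (d v) / of_int (snd v)) / y) * indicator P v" for v k x
    unfolding g_def using Q by (auto simp: indicator_def)
  have [measurable]: "g v k \<in> borel_measurable borel" for v k
    unfolding g_eq[abs_def] by measurable
  have g_le: "(\<integral>\<^sup>+v. \<integral>\<^sup>+k. g v k x \<partial>count_space UNIV \<partial>count_space UNIV) \<le> ennreal (f (p x))" for x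
  proof -
    have "(\<integral>\<^sup>+v. \<integral>\<^sup>+k. g v k x \<partial>count_space UNIV \<partial>count_space UNIV)
       = (\<integral>\<^sup>+(v, k). g v k x \<partial>count_space UNIV)"
      by (subst nn_integral_fst_count_space[symmetric]) simp
    also have "\<dots> \<le> ennreal (f (p x))"
    proof (rule nn_integral_count_space_at_most_one)
      fix vk :: "(int \<times> int) \<times> int"
      obtain v k where [simp]: "vk = (v, k)" by (cases vk)
      show "(case vk of (v, k) \<Rightarrow> g v k x) \<le> ennreal (f (p x))"
        using inv[OF \<gamma>SL pT, of v k x] by (auto simp: g_def F_def indicator_def)
    next
      fix vk vk' :: "(int \<times> int) \<times> int"
      obtain v k v' k' where [simp]: "vk = (v, k)" "vk' = (v', k')" by (cases vk; cases vk')
      assume "(case vk of (v, k) \<Rightarrow> g v k x) \<noteq> 0" "(case vk' of (v, k) \<Rightarrow> g v k x) \<noteq> 0"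
      then have *: "v \<in> P" "v' \<in> P" "moebius_act (\<gamma> v k) (p x) \<in> frame_dom" "moebius_act (\<gamma> v' k') (p x) \<in> frame_dom"
        by (auto simp: g_def F_def indicator_def split: if_splits)
      have "proj_M (p x) = proj_M (moebius_act (\<gamma> v k) (p x))" "proj_M (p x) = proj_M (moebius_act (\<gamma> v' k') (p x))"
        using * \<gamma>SL pT proj_M_eq_iff by blast+
      then have "moebius_act (\<gamma> v k) (p x) = moebius_act (\<gamma> v' k') (p x)"
        using * by (intro frame_dom_orbit_unique) auto
      from PSL_reps_unique[OF \<gamma> \<gamma> pT this] show "vk = vk'" using * \<gamma>_inj[of v k v' k'] by simp
    qed
    finally show ?thesis .
  qed
  have "(\<integral>\<^sup>+t. ennreal y * ?W t \<partial>lborel)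
     = (\<integral>\<^sup>+t. \<integral>\<^sup>+v. ennreal y * (Q v t * indicator P v) \<partial>count_space UNIV \<partial>lborel)"
  proof (rule nn_integral_cong)
    fix t :: real
    have "?W t
      = (\<integral>\<^sup>+v. Q v t * indicator P v \<partial>count_space UNIV)"
      using y by (subst nn_integral_count_space_indicator)
        (auto intro!: nn_integral_cong simp: Q_def F_def P_def scaled_def indicator_def zero_less_mult_iff)
    then show "ennreal y * ?W t
      = (\<integral>\<^sup>+v. ennreal y * (Q v t * indicator P v) \<partial>count_space UNIV)"
      by (simp add: nn_integral_cmult)
  qed
  also have "\<dots> = (\<integral>\<^sup>+v. \<integral>\<^sup>+t. ennreal y * (Q v t * indicator P v) \<partial>lborel \<partial>count_space UNIV)"
    by (rule nn_integral_count_space_nn_integral) auto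
  also have "\<dots> = (\<integral>\<^sup>+v. \<integral>\<^sup>+k. \<integral>\<^sup>+x. g v k x * indicator {0..<1} x \<partial>lborel \<partial>count_space UNIV \<partial>count_space UNIV)"
  proof (rule nn_integral_cong)
    fix v :: "int \<times> int"
    define e where "e = real_of_int (d v) / of_int (snd v)"
    have "(\<integral>\<^sup>+k. \<integral>\<^sup>+x. g v k x * indicator {0..<1} x \<partial>lborel \<partial>count_space UNIV)
       = (\<integral>\<^sup>+x. Q v ((x + e) / y) * indicator P v \<partial>lborel)"
      using nn_integral_tile[of "\<lambda>x. Q v ((x + e) / y) * indicator P v"] by (simp add: g_eq e_def)
    also have "\<dots> = ennreal \<bar>y\<bar> * (\<integral>\<^sup>+t. Q v ((- e + y * t + e) / y) * indicator P v \<partial>lborel)"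
      using y by (intro nn_integral_real_affine) auto
    also have "\<dots> = (\<integral>\<^sup>+t. ennreal y * (Q v t * indicator P v) \<partial>lborel)"
      using y by (simp add: nn_integral_cmult)
    finally show "(\<integral>\<^sup>+t. ennreal y * (Q v t * indicator P v) \<partial>lborel)
      = (\<integral>\<^sup>+k. \<integral>\<^sup>+x. g v k x * indicator {0..<1} x \<partial>lborel \<partial>count_space UNIV)" ..
  qed
  also have "\<dots> = (\<integral>\<^sup>+v. \<integral>\<^sup>+x. \<integral>\<^sup>+k. g v k x * indicator {0..<1} x \<partial>count_space UNIV \<partial>lborel \<partial>count_space UNIV)"
    by (intro nn_integral_cong nn_integral_count_space_nn_integral[symmetric]) auto
  also have "\<dots> = (\<integral>\<^sup>+x. \<integral>\<^sup>+v. \<integral>\<^sup>+k. g v k x * indicator {0..<1} x \<partial>count_space UNIV \<partial>count_space UNIV \<partial>lborel)"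
    by (rule nn_integral_count_space_nn_integral[symmetric])
      (auto intro!: borel_measurable_count_space_integral)
  also have "\<dots> = (\<integral>\<^sup>+x. (\<integral>\<^sup>+v. \<integral>\<^sup>+k. g v k x \<partial>count_space UNIV \<partial>count_space UNIV) * indicator {0..<1} x \<partial>lborel)"
    by (simp add: nn_integral_multc)
  also have "\<dots> \<le> (\<integral>\<^sup>+x. ennreal (f (p x)) * indicator {0..1} x \<partial>lborel)"
    by (intro nn_integral_mono mult_mono g_le) (auto simp: indicator_def)
  finally show ?thesis unfolding p_def .
qed

lemma continuous_on_horo: "continuous_on {v. snd v \<noteq> 0} (\<lambda>v. horo v t)"
  unfolding horo_def using Complex_t_1_nonzero[of t]
  by (intro continuous_intros) auto

text \<open>For fixed \<open>t\<close> the integrand is a sum over scaled primitive vectors, to which \<open>liminf_primitive_sum\<close>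
  applies; Fatou's lemma in \<open>t\<close> does the rest. The constants agree because
  \<open>4/(2\<pi>\<^sup>2/3) = 6/\<pi>\<^sup>2\<close>.\<close>

lemma liminf_horocycle_nn_integral:
  fixes f :: "complex \<times> complex \<Rightarrow> real"
  assumes inv: "\<And>A p. A \<in> SL2Z \<Longrightarrow> p \<in> T1H \<Longrightarrow> f (moebius_act A p) = f p"
    and cont: "continuous_on T1H f"
    and bounds: "\<And>p. p \<in> T1H \<Longrightarrow> 0 \<le> f p" "\<And>p. p \<in> T1H \<Longrightarrow> f p \<le> C"
    and Y: "\<And>n. Y n > 0" "Y \<longlonglongrightarrow> 0"
  shows "(\<integral>\<^sup>+p. ennreal (f p) * indicator frame_dom p \<partial>liouville) / ennreal (2 * pi\<^sup>2 / 3)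
    \<le> liminf (\<lambda>n. \<integral>\<^sup>+x. ennreal (f (Complex x (Y n), -1)) * indicator {0..1} x \<partial>lborel)"
proof -
  define F where "F p = ennreal (f p) * indicator frame_dom p" for p
  have F [measurable]: "F \<in> borel_measurable borel"
    unfolding F_def by (rule borel_measurable_frame_dom_indicator[OF cont])
  define U where "U t = {w. snd w > 0 \<and> horo w t \<in> frame_dom}" for t
  define S where "S n t = ennreal (Y n) * (\<integral>\<^sup>+v. ennreal (f (horo (scaled (sqrt (Y n)) v) t))
        * indicator (U t) (scaled (sqrt (Y n)) v) \<partial>count_space primitive)" for n t
  have FU: "ennreal (f (horo w t)) * indicator (U t) w = F (horo w t) * indicator {w. snd w > 0} w" for w t
    by (auto simp: F_def U_def indicator_def)
  have S_meas [measurable]: "S n \<in> borel_measurable lborel" for n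
    unfolding S_def FU
    by (intro borel_measurable_times_ennreal borel_measurable_const borel_measurable_count_space_integral) auto
  have pointwise: "ennreal (6 / pi\<^sup>2) * (\<integral>\<^sup>+w. F (horo w t) * indicator {w. snd w > 0} w \<partial>lborel)
      \<le> liminf (\<lambda>n. S n t)" for t
  proof -
    have U_eq: "U t = {w. snd w > 0} \<inter> (\<lambda>w. horo w t) -` (fund_dom \<times> UNIV)"
    proof (intro equalityI subsetI)
      fix w assume "w \<in> {w. snd w > 0} \<inter> (\<lambda>w. horo w t) -` (fund_dom \<times> UNIV)"
      moreover then have "horo w t \<in> T1H" by (intro horo_T1H) auto
      ultimately show "w \<in> U t" by (auto simp: U_def frame_dom_def T1H_def)
    qed (auto simp: U_def frame_dom_def)
    have pos: "open {w :: real \<times> real. snd w > 0}"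
      by (intro open_Collect_less continuous_intros)
    have cont_h: "continuous_on {w. snd w > 0} (\<lambda>w. horo w t)"
      by (rule continuous_on_subset[OF continuous_on_horo]) auto
    have "open (U t)"
      unfolding U_eq by (rule continuous_open_preimage[OF cont_h pos]) (intro open_Times open_fund_dom open_UNIV)
    moreover have "(0, 0) \<notin> U t" by (simp add: U_def)
    moreover have "continuous_on (U t) (\<lambda>w. f (horo w t))"
    proof (rule continuous_on_compose2[OF cont])
      show "continuous_on (U t) (\<lambda>w. horo w t)"
        by (rule continuous_on_subset[OF cont_h]) (auto simp: U_def)
      show "(\<lambda>w. horo w t) ` U t \<subseteq> T1H" using frame_dom_T1H by (auto simp: U_def)
    qed
    moreover have "horo w t \<in> T1H" if "w \<in> U t" for w
      using that frame_dom_T1H by (auto simp: U_def)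
    then have "0 \<le> f (horo w t)" "f (horo w t) \<le> C" if "w \<in> U t" for w
      using bounds that by simp_all
    moreover have "sqrt (Y n) > 0" for n using Y(1) by simp
    moreover have "(\<lambda>n. sqrt (Y n)) \<longlonglongrightarrow> 0" using tendsto_real_sqrt[OF Y(2)] by simp
    ultimately have "ennreal (6 / pi\<^sup>2) * (\<integral>\<^sup>+w. ennreal (f (horo w t)) * indicator (U t) w \<partial>lborel)
      \<le> liminf (\<lambda>n. ennreal ((sqrt (Y n))\<^sup>2) * (\<integral>\<^sup>+v. ennreal (f (horo (scaled (sqrt (Y n)) v) t))
         * indicator (U t) (scaled (sqrt (Y n)) v) \<partial>count_space primitive))"
      by (rule liminf_primitive_sum)
    moreover have "(sqrt (Y n))\<^sup>2 = Y n" for n using Y(1)[of n] by simp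
    ultimately show ?thesis unfolding S_def FU by simp
  qed
  have "(\<integral>\<^sup>+p. F p \<partial>liouville) / ennreal (2 * pi\<^sup>2 / 3)
      = ennreal (6 / pi\<^sup>2) * (\<integral>\<^sup>+t. \<integral>\<^sup>+w. F (horo w t) * indicator {w. snd w > 0} w \<partial>lborel \<partial>lborel)"
    (is "_ = _ * ?I")
  proof -
    have "4 / ennreal (2 * pi\<^sup>2 / 3) = ennreal 4 / ennreal (2 * pi\<^sup>2 / 3)" by simp
    also have "\<dots> = ennreal (6 / pi\<^sup>2)"
      by (subst divide_ennreal) (simp_all add: field_simps)
    finally have "4 / ennreal (2 * pi\<^sup>2 / 3) = ennreal (6 / pi\<^sup>2)" .
    moreover have "4 * ?I / ennreal (2 * pi\<^sup>2 / 3) = ?I * (4 / ennreal (2 * pi\<^sup>2 / 3))"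
      unfolding ennreal_times_divide by (simp only: mult.commute)
    ultimately show ?thesis
      unfolding nn_integral_liouville[OF F] by (simp only: mult.commute)
  qed
  also have "\<dots> = (\<integral>\<^sup>+t. ennreal (6 / pi\<^sup>2) * (\<integral>\<^sup>+w. F (horo w t) * indicator {w. snd w > 0} w \<partial>lborel) \<partial>lborel)"
  proof (rule nn_integral_cmult[symmetric])
    show "(\<lambda>t. \<integral>\<^sup>+w. F (horo w t) * indicator {w. snd w > 0} w \<partial>lborel) \<in> borel_measurable lborel"
      by measurable
  qed
  also have "\<dots> \<le> (\<integral>\<^sup>+t. liminf (\<lambda>n. S n t) \<partial>lborel)"
    by (rule nn_integral_mono) (rule pointwise)
  also have "\<dots> \<le> liminf (\<lambda>n. \<integral>\<^sup>+t. S n t \<partial>lborel)"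
    by (rule nn_integral_liminf) (rule S_meas)
  also have "\<dots> \<le> liminf (\<lambda>n. \<integral>\<^sup>+x. ennreal (f (Complex x (Y n), -1)) * indicator {0..1} x \<partial>lborel)"
    unfolding S_def U_def
    by (rule Liminf_mono, rule always_eventually, rule allI,
        rule horocycle_unfolding[OF inv cont Y(1)])
  finally show ?thesis unfolding F_def .
qed

lemma measurable_horocycle:
  assumes y: "y > 0"
  shows "(\<lambda>x. proj_M (Complex x y, cis pi)) \<in> restrict_space lborel {0..1} \<rightarrow>\<^sub>M borel_of M_top"
proof -
  have "(\<lambda>x. (Complex x y, cis pi)) \<in> borel \<rightarrow>\<^sub>M restrict_space borel T1H"
    using y by (intro measurable_restrict_space2 borel_measurable_Pair) (auto simp: T1H_iff)
  then have "(\<lambda>x. (Complex x y, cis pi)) \<in> borel \<rightarrow>\<^sub>M liouville"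
    using measurable_cong_sets[OF refl sets_liouville] by blast
  from measurable_compose[OF this measurable_proj_M] show ?thesis
    by (intro measurable_restrict_space1) simp
qed

lemma sets_M_haar [simp]: "sets M_haar = sets (borel_of M_top)"
  by (simp add: M_haar_def M_induced_eq)

lemma sets_horocycle_measure [simp]: "sets (horocycle_measure y) = sets (borel_of M_top)"
  by (simp add: horocycle_measure_def)

lemma liminf_horocycle_measure:
  fixes f :: "(complex \<times> complex) set \<Rightarrow> real"
  assumes cont: "continuous_map M_top euclideanreal f"
    and bounds: "\<And>x. x \<in> topspace M_top \<Longrightarrow> 0 \<le> f x" "\<And>x. x \<in> topspace M_top \<Longrightarrow> f x \<le> C"
    and Y: "\<And>n. Y n > 0" "Y \<longlonglongrightarrow> 0"
  shows "(\<integral>\<^sup>+x. ennreal (f x) \<partial>M_haar) \<le> liminf (\<lambda>n. \<integral>\<^sup>+x. ennreal (f x) \<partial>horocycle_measure (Y n))"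
proof -
  have meas: "f \<in> borel_measurable (borel_of M_top)"
      by (rule continuous_map_borel_measurable[OF cont])
  then have meas': "(\<lambda>x. ennreal (f x)) \<in> borel_measurable (borel_of M_top)" by simp
  have "(\<integral>\<^sup>+x. ennreal (f x) \<partial>M_haar)
      = (\<integral>\<^sup>+p. ennreal (f (proj_M p)) * indicator frame_dom p \<partial>liouville) / ennreal (2 * pi\<^sup>2 / 3)"
    by (rule nn_integral_M_haar[OF meas'])
  also have "\<dots> \<le> liminf (\<lambda>n. \<integral>\<^sup>+x. ennreal (f (proj_M (Complex x (Y n), -1))) * indicator {0..1} x \<partial>lborel)"
  proof (rule liminf_horocycle_nn_integral[OF _ _ _ _ Y])
    show "f (proj_M (moebius_act A p)) = f (proj_M p)" if "A \<in> SL2Z" "p \<in> T1H" for A p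
      using that proj_M_eq_iff[of p "moebius_act A p"] by auto
    have "continuous_map (top_of_set T1H) euclideanreal (f \<circ> proj_M)"
      by (rule continuous_map_compose[OF continuous_map_proj_M cont])
    then show "continuous_on T1H (\<lambda>p. f (proj_M p))" by (simp add: o_def)
    show "0 \<le> f (proj_M p)" "f (proj_M p) \<le> C" if "p \<in> T1H" for p
      using bounds that by (auto simp: topspace_M_top)
  qed
  also have "(\<lambda>n. \<integral>\<^sup>+x. ennreal (f (proj_M (Complex x (Y n), -1))) * indicator {0..1} x \<partial>lborel)
      = (\<lambda>n. \<integral>\<^sup>+x. ennreal (f x) \<partial>horocycle_measure (Y n))"
    unfolding horocycle_measure_def
    using measurable_horocycle[OF Y(1)] meas' by (simp add: nn_integral_distr nn_integral_restrict_space)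
  finally show ?thesis .
qed

lemma emeasure_M_haar: "emeasure M_haar (space M_haar) = 1"
proof -
  have "emeasure M_haar (space M_haar) = (\<integral>\<^sup>+x. 1 \<partial>M_haar)" by simp
  also have "\<dots> = (\<integral>\<^sup>+p. 1 * indicator frame_dom p \<partial>liouville) / ennreal (2 * pi\<^sup>2 / 3)"
    by (rule nn_integral_M_haar[of "\<lambda>_. 1"]) simp
  also have "\<dots> = 1"
    using sets_frame_dom emeasure_liouville_fund_dom
    by (simp add: frame_dom_def ennreal_divide_self)
  finally show "emeasure M_haar (space M_haar) = 1" .
qed

lemma emeasure_horocycle_measure:
  assumes "y > 0"
  shows "emeasure (horocycle_measure y) (space (horocycle_measure y)) = 1"
proof -
  let ?I = "restrict_space lborel {0..1::real}"
  have "(\<lambda>x. proj_M (Complex x y, cis pi)) -` topspace M_top \<inter> space ?I = space ?I"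
    using measurable_space[OF measurable_horocycle[OF assms]] by auto
  then show ?thesis
    unfolding horocycle_measure_def using measurable_horocycle[OF assms]
      sets.top[of "borel_of M_top"]
    by (simp add: emeasure_distr space_restrict_space emeasure_restrict_space)
qed

theorem mainTheorem2:
  fixes f :: "(complex \<times> complex) set option \<Rightarrow> real"
  assumes "continuous_map Mhat_top euclideanreal f"
  shows "((\<lambda>y. \<integral>p. f p \<partial>(on_Mhat (horocycle_measure y)))
           \<longlongrightarrow> (\<integral>p. f p \<partial>(on_Mhat M_haar))) (at_right 0)"
proof (rule tendsto_at_right_sequentially[of 0 1])
  fix Y :: "nat \<Rightarrow> real"
  assume Y: "\<And>n. 0 < Y n" "Y \<longlonglongrightarrow> 0"
  define g where "g = f \<circ> Some"
  have g: "continuous_map M_top euclideanreal g"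
    unfolding g_def by (rule continuous_map_compose[OF continuous_map_Some assms])
  have f_meas: "f \<in> borel_measurable (borel_of Mhat_top)"
      by (rule continuous_map_borel_measurable[OF assms])
  have integral_on_Mhat: "(\<integral>p. f p \<partial>(on_Mhat \<mu>)) = (\<integral>x. g x \<partial>\<mu>)" if "sets \<mu> = sets (borel_of M_top)" for \<mu>
  proof -
    have "Some \<in> \<mu> \<rightarrow>\<^sub>M borel_of Mhat_top"
      using continuous_map_measurable[OF continuous_map_Some] measurable_cong_sets[OF that refl] by blast
    then show ?thesis unfolding on_Mhat_def g_def using f_meas by (simp add: integral_distr)
  qed
  have "compactin euclideanreal (f ` topspace Mhat_top)"
    by (rule image_compactin[OF _ assms]) (use compact_space_Alexandroff_compactification in \<open>simp add: compact_space_def\<close>)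
  then have "bounded (f ` topspace Mhat_top)"
    unfolding compactin_euclidean_iff by (rule compact_imp_bounded)
  then obtain B where B: "\<And>p. p \<in> topspace Mhat_top \<Longrightarrow> \<bar>f p\<bar> \<le> B"
    by (auto simp: bounded_iff)
  define C where "C = \<bar>B\<bar> + 1"
  have gC: "\<bar>g x\<bar> < C" if "x \<in> topspace M_top" for x
    using B[of "Some x"] that unfolding g_def C_def by simp
  have lower: "\<forall>\<^sub>F n in sequentially. (\<integral>x. h x \<partial>M_haar) - e < (\<integral>x. h x \<partial>horocycle_measure (Y n))"
    if h: "continuous_map M_top euclideanreal h" and hC: "\<And>x. x \<in> topspace M_top \<Longrightarrow> \<bar>h x\<bar> < C" and e: "e > 0"
    for h e
  proof -
    have h_meas: "h \<in> borel_measurable (borel_of M_top)"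
      by (rule continuous_map_borel_measurable[OF h])
    have nn: "(\<integral>\<^sup>+x. ennreal (C + h x) \<partial>\<mu>) = ennreal (C + (\<integral>x. h x \<partial>\<mu>)) \<and> 0 \<le> C + (\<integral>x. h x \<partial>\<mu>)"
      if \<mu>: "emeasure \<mu> (space \<mu>) = 1" "sets \<mu> = sets (borel_of M_top)" for \<mu>
    proof -
      interpret finite_measure \<mu> by (rule finite_measureI) (simp add: \<mu>)
      have total: "measure \<mu> (space \<mu>) = 1" using \<mu>(1) by (simp add: measure_def)
      have sp: "space \<mu> = topspace M_top" using sets_eq_imp_space_eq[OF \<mu>(2)] by simp
      have "h \<in> borel_measurable \<mu>" using h_meas measurable_cong_sets[OF \<mu>(2) refl] by blast
      then have int: "integrable \<mu> h"
        using hC by (intro integrable_const_bound[where B = C]) (auto simp: sp intro!: AE_I2 less_imp_le)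
      have nonneg: "AE x in \<mu>. 0 \<le> C + h x"
        using hC by (intro AE_I2) (force simp: sp abs_less_iff)
      have "(\<integral>\<^sup>+x. ennreal (C + h x) \<partial>\<mu>) = ennreal (\<integral>x. C + h x \<partial>\<mu>)"
        using int nonneg by (intro nn_integral_eq_integral) auto
      moreover have "(\<integral>x. C + h x \<partial>\<mu>) = C + (\<integral>x. h x \<partial>\<mu>)"
        using int by (simp add: total)
      moreover have "0 \<le> (\<integral>x. C + h x \<partial>\<mu>)" by (rule integral_nonneg_AE[OF nonneg])
      ultimately show ?thesis by simp
    qed
    note nnH = nn[OF emeasure_M_haar sets_M_haar]
      and nnY = nn[OF emeasure_horocycle_measure[OF Y(1)] sets_horocycle_measure]
    have "(\<integral>\<^sup>+x. ennreal (C + h x) \<partial>M_haar)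
        \<le> liminf (\<lambda>n. \<integral>\<^sup>+x. ennreal (C + h x) \<partial>horocycle_measure (Y n))"
    proof (rule liminf_horocycle_measure[OF _ _ _ Y])
      show "continuous_map M_top euclideanreal (\<lambda>x. C + h x)"
        using h by (intro continuous_intros)
      show "0 \<le> C + h x" "C + h x \<le> 2 * C" if "x \<in> topspace M_top" for x
        using hC[OF that] by auto
    qed
    then have le: "ennreal (C + (\<integral>x. h x \<partial>M_haar)) \<le> liminf (\<lambda>n. ennreal (C + (\<integral>x. h x \<partial>horocycle_measure (Y n))))"
      using nnH nnY by simp
    show ?thesis
    proof (cases "C + (\<integral>x. h x \<partial>M_haar) - e < 0")
      case True
      show ?thesis
      proof (rule always_eventually, rule allI)
        fix n show "(\<integral>x. h x \<partial>M_haar) - e < (\<integral>x. h x \<partial>horocycle_measure (Y n))"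
          using nnY[of n] True by linarith
      qed
    next
      case False
      then have "ennreal (C + (\<integral>x. h x \<partial>M_haar) - e) < ennreal (C + (\<integral>x. h x \<partial>M_haar))"
        using e by (subst ennreal_less_iff) auto
      from less_LiminfD[OF less_le_trans[OF this le]] show ?thesis
        by eventually_elim (use False in \<open>simp add: ennreal_less_iff\<close>)
    qed
  qed
  have "(\<lambda>n. \<integral>x. g x \<partial>horocycle_measure (Y n)) \<longlonglongrightarrow> (\<integral>x. g x \<partial>M_haar)"
  proof (rule tendstoI)
    fix e :: real assume e: "e > 0"
    have neg: "continuous_map M_top euclideanreal (\<lambda>x. - g x)"
      using g by (intro continuous_intros)
    have "\<forall>\<^sub>F n in sequentially. (\<integral>x. g x \<partial>M_haar) - e < (\<integral>x. g x \<partial>horocycle_measure (Y n))"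
      by (rule lower[OF g gC e])
    moreover have "\<forall>\<^sub>F n in sequentially. (\<integral>x. - g x \<partial>M_haar) - e < (\<integral>x. - g x \<partial>horocycle_measure (Y n))"
      by (rule lower[OF neg _ e]) (simp add: gC)
    ultimately show "\<forall>\<^sub>F n in sequentially. dist (\<integral>x. g x \<partial>horocycle_measure (Y n)) (\<integral>x. g x \<partial>M_haar) < e"
      by eventually_elim (simp add: dist_real_def abs_less_iff)
  qed
  then show "(\<lambda>n. \<integral>p. f p \<partial>(on_Mhat (horocycle_measure (Y n)))) \<longlonglongrightarrow> (\<integral>p. f p \<partial>(on_Mhat M_haar))"
    by (simp add: integral_on_Mhat)
qed simp

end
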